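(* Let $n\ge 2$, let $\Omega\subset\mathbb{R}^n$ be a bounded convex domain with $C^1$ boundary, and let $E$ be an ellipsoid of maximal volume contained in $\Omega$. Then there exist constants $C_1,C_2>0$, depending only on the geometry of $\Omega$ and $E$, such that for every integer $k\ge 1$, $$\frac{1}{C_2\,n}\,\sigma_k(E)\le\sigma_k(\Omega)\le C_1\,\sigma_k(E).$$ Furthermore, let $\hat B$ be the unit ball in $\mathbb{R}^n$, let $\phi:\mathbb{R}^n\to\mathbb{R}^n$ be a non-singular affine transformation satisfying $\hat B=\phi^{-1}(E)$, and set $\widetilde\Omega:=\phi^{-1}(\Omega)$. Then there exist constants $c_1,c_2>0$, depending only on the geometry of $\widetilde\Omega$ and $\hat B$, such that for every integer $k\ge 1$, $$\frac{1}{n\,c_2}\,\sigma_k(\hat B)\le\sigma_k(\widetilde\Omega)\le c_1\,\sigma_k(\hat B).$$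
   Context: A domain is a connected open set; ellipsoids and balls are taken open when regarded as domains. Steklov eigenvalues: for a bounded Lipschitz domain $\Omega\subset\mathbb{R}^n$, the Steklov problem is $\Delta u=0$ in $\Omega$, $\partial u/\partial\nu=\sigma u$ on $\partial\Omega$, where $\nu$ is the outward unit normal. Its eigenvalues, repeated according to multiplicity, are $0=\sigma_0(\Omega)<\sigma_1(\Omega)\le\sigma_2(\Omega)\le\cdots\to\infty$, and $$\sigma_k(\Omega)=\min_{\substack{V\subset H^1(\Omega)\\ \dim V=k+1}}\ \max_{0\ne u\in V}\frac{\int_\Omega\|\nabla u\|^2\,dV}{\int_{\partial\Omega}u^2\,dS},$$ where $V$ ranges over linear subspaces and the quotient is read as $+\infty$ when the denominator vanishes. The constants $C_1,C_2,c_1,c_2$ do not depend on $k$. *)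

theory Defs
  imports "HOL-Analysis.Analysis"
begin

section \<open>Domains, affine maps, ellipsoids\<close>

definition domain :: "'a::euclidean_space set \<Rightarrow> bool" where
  "domain \<Omega> \<longleftrightarrow> open \<Omega> \<and> connected \<Omega> \<and> \<Omega> \<noteq> {}"

definition nonsingular_affine :: "('a::euclidean_space \<Rightarrow> 'a) \<Rightarrow> bool" where
  "nonsingular_affine \<phi> \<longleftrightarrow> (\<exists>A b. linear A \<and> bij A \<and> \<phi> = (\<lambda>x. A x + b))"

text \<open>Ellipsoids are open, because they are also used as domains.  For a convex open set this does
  not change which volumes occur: an open ellipsoid lies in it iff the closed one lies in its closure.\<close>

definition ellipsoid :: "'a::euclidean_space set \<Rightarrow> bool" where
  "ellipsoid E \<longleftrightarrow> (\<exists>\<phi>. nonsingular_affine \<phi> \<and> E = \<phi> ` ball 0 1)"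

definition max_volume_ellipsoid :: "'a::euclidean_space set \<Rightarrow> 'a set \<Rightarrow> bool" where
  "max_volume_ellipsoid E \<Omega> \<longleftrightarrow>
     ellipsoid E \<and> E \<subseteq> \<Omega> \<and>
     (\<forall>E'. ellipsoid E' \<and> E' \<subseteq> \<Omega> \<longrightarrow> emeasure lebesgue E' \<le> emeasure lebesgue E)"


section \<open>Functions of class \<open>C\<^sup>k\<close> and \<open>C\<^sup>1\<close> boundaries\<close>

fun Ck :: "nat \<Rightarrow> ('a::euclidean_space \<Rightarrow> real) \<Rightarrow> bool" where
  "Ck 0 f \<longleftrightarrow> continuous_on UNIV f"
| "Ck (Suc k) f \<longleftrightarrow>
     (\<forall>x. f differentiable at x) \<and> (\<forall>i\<in>Basis. Ck k (\<lambda>x. frechet_derivative f (at x) i))"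

text \<open>Near each boundary point the set is the strict epigraph, in the direction of some unit vector
  \<open>e\<close>, of a \<open>C\<^sup>1\<close> function on the hyperplane orthogonal to \<open>e\<close>.  The function is given on the whole
  space but evaluated only at points of that hyperplane; a \<open>C\<^sup>1\<close> function on the hyperplane extends
  by composition with the orthogonal projection.\<close>

definition C1_boundary :: "'a::euclidean_space set \<Rightarrow> bool" where
  "C1_boundary \<Omega> \<longleftrightarrow>
     (\<forall>p\<in>frontier \<Omega>. \<exists>r>0. \<exists>e \<gamma>. norm e = 1 \<and> Ck 1 \<gamma> \<and>
        \<Omega> \<inter> ball p r = {x \<in> ball p r. \<gamma> (x - (x \<bullet> e) *\<^sub>R e) < x \<bullet> e})"


section \<open>Surface measure\<close>

text \<open>The \<open>d\<close>-dimensional Hausdorff measure for \<open>d \<ge> 1\<close>, normalised so that in dimension \<open>d\<close> it is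
  Lebesgue measure.  (For \<open>d = 0\<close> the convention \<open>0 ^ 0 = 1\<close> would also charge empty covering sets.)
  The outer measure is a metric outer measure, so it is countably additive on the Borel sets, which
  \<open>measure_of\<close> needs in order to return it.\<close>

definition hausdorff_outer :: "nat \<Rightarrow> 'a::euclidean_space set \<Rightarrow> ennreal" where
  "hausdorff_outer d A =
     (SUP \<delta>\<in>{0<..}. INF U\<in>{U :: nat \<Rightarrow> 'a set.
          A \<subseteq> (\<Union>i. U i) \<and> (\<forall>i. bounded (U i) \<and> diameter (U i) \<le> \<delta>)}.
        (\<Sum>i. ennreal (unit_ball_vol (real d) * (diameter (U i) / 2) ^ d)))"

definition hausdorff_measure :: "nat \<Rightarrow> 'a::euclidean_space measure" where
  "hausdorff_measure d = measure_of UNIV (sets borel) (hausdorff_outer d)"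

definition surface_measure :: "'a::euclidean_space set \<Rightarrow> 'a measure" where
  "surface_measure \<Omega> = restrict_space (hausdorff_measure (DIM('a) - 1)) (frontier \<Omega>)"


section \<open>The Sobolev space \<open>H\<^sup>1\<close> and boundary traces\<close>

definition L2_sqnorm :: "'a measure \<Rightarrow> ('a \<Rightarrow> 'b::euclidean_space) \<Rightarrow> ennreal" where
  "L2_sqnorm M f = (\<integral>\<^sup>+x. ennreal ((norm (f x))\<^sup>2) \<partial>M)"

definition L2 :: "'a measure \<Rightarrow> ('a \<Rightarrow> 'b::euclidean_space) set" where
  "L2 M = {f \<in> borel_measurable M. L2_sqnorm M f < \<infinity>}"

definition test_function :: "'a::euclidean_space set \<Rightarrow> ('a \<Rightarrow> real) \<Rightarrow> bool" where
  "test_function \<Omega> \<psi> \<longleftrightarrow>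
     (\<forall>k. Ck k \<psi>) \<and> compact (closure {x. \<psi> x \<noteq> 0}) \<and> closure {x. \<psi> x \<noteq> 0} \<subseteq> \<Omega>"

definition has_weak_gradient ::
    "'a::euclidean_space set \<Rightarrow> ('a \<Rightarrow> real) \<Rightarrow> ('a \<Rightarrow> 'a) \<Rightarrow> bool" where
  "has_weak_gradient \<Omega> u G \<longleftrightarrow>
     G \<in> L2 (lebesgue_on \<Omega>) \<and>
     (\<forall>\<psi>. test_function \<Omega> \<psi> \<longrightarrow> (\<forall>i\<in>Basis.
        (LINT x|lebesgue_on \<Omega>. u x * frechet_derivative \<psi> (at x) i) =
        - (LINT x|lebesgue_on \<Omega>. (G x \<bullet> i) * \<psi> x)))"

definition H1 :: "'a::euclidean_space set \<Rightarrow> ('a \<Rightarrow> real) set" where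
  "H1 \<Omega> = {u \<in> L2 (lebesgue_on \<Omega>). \<exists>G. has_weak_gradient \<Omega> u G}"

text \<open>The weak gradient is unique almost everywhere; the infimum only selects the common value.\<close>

definition dirichlet_energy :: "'a::euclidean_space set \<Rightarrow> ('a \<Rightarrow> real) \<Rightarrow> ennreal" where
  "dirichlet_energy \<Omega> u = (INF G\<in>{G. has_weak_gradient \<Omega> u G}. L2_sqnorm (lebesgue_on \<Omega>) G)"

definition H1_sqnorm :: "'a::euclidean_space set \<Rightarrow> ('a \<Rightarrow> real) \<Rightarrow> ennreal" where
  "H1_sqnorm \<Omega> u = L2_sqnorm (lebesgue_on \<Omega>) u + dirichlet_energy \<Omega> u"

text \<open>The trace operator is the continuous extension of \<open>v \<mapsto> v|\<^bsub>\<partial>\<Omega>\<^esub>\<close> from the functions in \<open>H\<^sup>1(\<Omega>)\<close>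
  that are continuous up to the boundary, as a relation between \<open>u\<close> and its trace \<open>w\<close>.  On a bounded
  Lipschitz domain every \<open>u\<close> in \<open>H\<^sup>1(\<Omega>)\<close> has a trace, unique almost everywhere.\<close>

definition has_trace :: "'a::euclidean_space set \<Rightarrow> ('a \<Rightarrow> real) \<Rightarrow> ('a \<Rightarrow> real) \<Rightarrow> bool" where
  "has_trace \<Omega> u w \<longleftrightarrow>
     u \<in> H1 \<Omega> \<and> w \<in> L2 (surface_measure \<Omega>) \<and>
     (\<exists>v :: nat \<Rightarrow> 'a \<Rightarrow> real.
        (\<forall>m. v m \<in> H1 \<Omega> \<and> continuous_on (closure \<Omega>) (v m)) \<and>
        (\<lambda>m. H1_sqnorm \<Omega> (\<lambda>x. v m x - u x)) \<longlonglongrightarrow> 0 \<and>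
        (\<lambda>m. L2_sqnorm (surface_measure \<Omega>) (\<lambda>x. v m x - w x)) \<longlonglongrightarrow> 0)"

definition boundary_energy :: "'a::euclidean_space set \<Rightarrow> ('a \<Rightarrow> real) \<Rightarrow> ennreal" where
  "boundary_energy \<Omega> u = (INF w\<in>{w. has_trace \<Omega> u w}. L2_sqnorm (surface_measure \<Omega>) w)"


section \<open>Steklov eigenvalues\<close>

definition rayleigh_quotient :: "'a::euclidean_space set \<Rightarrow> ('a \<Rightarrow> real) \<Rightarrow> ennreal" where
  "rayleigh_quotient \<Omega> u =
     (if boundary_energy \<Omega> u = 0 then \<infinity> else dirichlet_energy \<Omega> u / boundary_energy \<Omega> u)"

definition null_on :: "'a::euclidean_space set \<Rightarrow> ('a \<Rightarrow> real) \<Rightarrow> bool" where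
  "null_on \<Omega> u \<longleftrightarrow> (AE x in lebesgue_on \<Omega>. u x = 0)"

text \<open>Elements of \<open>H\<^sup>1(\<Omega>)\<close> are functions modulo equality almost everywhere, so linear independence is
  modulo null functions and a subspace is represented by the set of all representatives of its
  elements.\<close>

definition H1_subspace :: "'a::euclidean_space set \<Rightarrow> nat \<Rightarrow> ('a \<Rightarrow> real) set \<Rightarrow> bool" where
  "H1_subspace \<Omega> d V \<longleftrightarrow>
     (\<exists>b :: nat \<Rightarrow> 'a \<Rightarrow> real.
        (\<forall>i<d. b i \<in> H1 \<Omega>) \<and>
        (\<forall>c :: nat \<Rightarrow> real. null_on \<Omega> (\<lambda>x. \<Sum>i<d. c i * b i x) \<longrightarrow> (\<forall>i<d. c i = 0)) \<and>
        V = {u \<in> H1 \<Omega>. \<exists>c :: nat \<Rightarrow> real. null_on \<Omega> (\<lambda>x. u x - (\<Sum>i<d. c i * b i x))})"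

definition steklov_eigenvalue :: "nat \<Rightarrow> 'a::euclidean_space set \<Rightarrow> ennreal" where
  "steklov_eigenvalue k \<Omega> =
     (INF V\<in>{V. H1_subspace \<Omega> (k + 1) V}. SUP u\<in>{u \<in> V. \<not> null_on \<Omega> u}. rayleigh_quotient \<Omega> u)"

end

theory Submission
  imports Defs
begin

text \<open>Write \<open>n\<close> for the dimension.  A Steklov eigenvalue is a min-max of the quotient of the Dirichlet
  energy by the boundary energy over \<open>(k + 1)\<close>-dimensional subspaces of \<open>H\<^sup>1\<close>.  If a bijection \<open>F\<close> of
  the whole space and its inverse are both \<open>L\<close>-Lipschitz, then \<open>u \<mapsto> u \<circ> F\<close> carries the
  \<open>(k + 1)\<close>-dimensional subspaces of \<open>H\<^sup>1(\<Omega>)\<close> bijectively to those of \<open>H\<^sup>1(F\<inverse>(\<Omega>))\<close> and changes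
  both energies by at most a factor that depends on \<open>n\<close> and \<open>L\<close> only.  So \<open>\<sigma>\<^sub>k\<close> changes by at most a
  factor that is the same for all \<open>k\<close> (\<open>steklov_eigenvalue_vimage_le\<close>).  It remains to map the
  domains of the theorem to one reference domain, the unit ball, and to compose.

  For an ellipsoid, and for passing between a domain and its preimage under \<open>\<phi>\<close>, the map is affine.
  For the convex domain \<open>\<Omega>\<close>, translated so that it contains the origin, let \<open>g\<close> be its Minkowski gauge;
  the radial map \<open>x \<mapsto> (\<bar>x\<bar> / g(x)) x\<close> sends the unit ball onto \<open>\<Omega>\<close>.  It is bi-Lipschitz
  because \<open>g\<close> is Lipschitz and comparable to the norm.  The \<open>C\<^sup>1\<close> boundary makes \<open>g\<close>, hence the map and
  its inverse, differentiable away from the origin (\<open>gauge_has_derivative_frontier\<close>); this is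
  what the chain rule below asks for.

  The analytic core is that chain rule: if \<open>u\<close> has weak gradient \<open>G\<close>, then \<open>u \<circ> F\<close> has weak gradient
  \<open>DF\<^sup>T (G \<circ> F)\<close> (\<open>has_weak_gradient_pullback\<close>).  Given a test function \<open>\<psi>\<close>, mollify \<open>u\<close> at a
  small scale; near the image of the support of \<open>\<psi>\<close> the mollification \<open>v\<close> is a smooth function whose
  gradient is the mollification of \<open>G\<close>.  The product \<open>(v \<circ> F) \<psi>\<close> is Lipschitz with bounded support and
  differentiable almost everywhere.  Its difference quotients have integral zero by translation
  invariance, so by dominated convergence its partial derivatives do too
  (\<open>integral_directional_derivative_eq_0\<close>).  This is the identity to be shown with mollified data, and
  it passes to the limit because mollifications converge in \<open>L\<^sup>1\<close> (\<open>mollify_tendsto_L1\<close>) and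
  \<open>F\<close> distorts Lebesgue measure by at most \<open>L\<^sup>n\<close> (\<open>emeasure_vimage_F_le\<close>).

  On the boundary only measures enter: a Lipschitz map distorts the \<open>(n - 1)\<close>-dimensional Hausdorff outer
  measure by at most \<open>L\<^bsup>n-1\<^esup>\<close> (\<open>hausdorff_outer_lipschitz_image_le\<close>), and traces, being limits of
  continuous functions, are carried along.

  In both parts of the theorem the inequalities between the eigenvalues mention only the two domains
  compared, so the constants can be chosen as functions of that pair.\<close>

section \<open>Bi-Lipschitz changes of variables and Lebesgue measure\<close>

text \<open>The maps act on the whole space, so that closures, boundaries and both measures can be
  transported without reference to a particular domain.  The null sets allow the radial map between
  two convex bodies, which has a singular centre.\<close>

locale bilipschitz_change =
  fixes L :: real and F G :: "'a::euclidean_space \<Rightarrow> 'a"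
  assumes L_pos: "0 < L"
    and lipschitz_F: "L-lipschitz_on UNIV F"
    and lipschitz_G: "L-lipschitz_on UNIV G"
    and F_G [simp]: "F (G y) = y"
    and G_F [simp]: "G (F x) = x"
    and differentiable_F: "negligible {x. \<not> F differentiable (at x)}"
    and differentiable_G: "negligible {x. \<not> G differentiable (at x)}"

lemma (in bilipschitz_change) swap: "bilipschitz_change L G F"
  using L_pos lipschitz_F lipschitz_G differentiable_F differentiable_G
  by unfold_locales auto

lemma lipschitz_image_ball_subset:
  fixes f :: "'a::metric_space \<Rightarrow> 'b::metric_space"
  assumes "L-lipschitz_on UNIV f" "0 < L"
  shows "f ` ball x r \<subseteq> ball (f x) (L * r)"
proof (rule image_subsetI)
  fix y assume "y \<in> ball x r"
  then have "dist (f x) (f y) \<le> L * dist x y" "L * dist x y < L * r"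
    using lipschitz_onD[OF assms(1)] assms(2) by auto
  then show "f y \<in> ball (f x) (L * r)" by simp
qed

lemma lipschitz_image_negligible:
  fixes f :: "'a::euclidean_space \<Rightarrow> 'a"
  assumes "L-lipschitz_on UNIV f" "negligible S"
  shows "negligible (f ` S)"
proof (rule negligible_locally_Lipschitz_image)
  fix x assume "x \<in> S"
  show "\<exists>T B. open T \<and> x \<in> T \<and> (\<forall>y\<in>S \<inter> T. norm (f y - f x) \<le> B * norm (y - x))"
    using lipschitz_on_normD[OF assms(1)] by (intro exI[of _ UNIV] exI[of _ L]) auto
qed (use assms in auto)

lemma emeasure_lebesgue_ball_scale:
  fixes x y :: "'a::euclidean_space"
  assumes "0 < L"
  shows "emeasure lebesgue (ball y (L * r)) = ennreal (L ^ DIM('a)) * emeasure lebesgue (ball x r)"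
proof (cases "0 \<le> r")
  case True
  then show ?thesis
    using assms by (simp add: emeasure_ball power_mult_distrib ennreal_mult ac_simps)
next
  case False
  then show ?thesis using assms
    by (simp add: ball_empty mult_le_0_iff not_le less_imp_le)
qed

text \<open>Vitali's theorem fills the open set, up to a null set, by disjoint balls; the image of a ball
  lies in a ball whose radius is \<open>L\<close> times larger, and images of null sets are null.\<close>

lemma emeasure_lipschitz_image_open_le:
  fixes f :: "'a::euclidean_space \<Rightarrow> 'a"
  assumes f: "L-lipschitz_on UNIV f" "0 < L" and inj: "inj f" and U: "open U"
    and meas: "\<And>A. A \<in> sets lebesgue \<Longrightarrow> f ` A \<in> sets lebesgue"
  shows "emeasure lebesgue (f ` U) \<le> ennreal (L ^ DIM('a)) * emeasure lebesgue U"
proof -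
  define K where "K = {(x, r). 0 < r \<and> ball x r \<subseteq> U}"
  obtain C where C: "countable C" "C \<subseteq> K"
     "pairwise (\<lambda>i j. disjnt (ball (fst i) (snd i)) (ball (fst j) (snd j))) C"
     "negligible (U - (\<Union>i \<in> C. ball (fst i) (snd i)))"
  proof (rule Vitali_covering_theorem_balls[of U K fst snd])
    fix x d assume "x \<in> U" "0 < (d::real)"
    then obtain e where "e > 0" "ball x e \<subseteq> U" using U openE by blast
    with \<open>0 < d\<close> show "\<exists>i. i \<in> K \<and> x \<in> ball (fst i) (snd i) \<and> snd i < d"
      unfolding K_def by (intro exI[of _ "(x, min e (d/2))"]) auto
  qed
  define B where "B = (\<lambda>i::'a \<times> real. ball (fst i) (snd i))"
  define N where "N = U - (\<Union>i \<in> C. B i)"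
  have dis: "disjoint_family_on B C"
    using C(3) by (auto simp: disjoint_family_on_def pairwise_def disjnt_def B_def)
  have sub: "(\<Union>i\<in>C. B i) \<subseteq> U" using C(2) by (fastforce simp: K_def B_def)
  have N: "f ` N \<in> null_sets lebesgue"
    using lipschitz_image_negligible[OF f(1)] C(4) negligible_iff_null_sets
    unfolding N_def B_def by blast
  have "f ` U = (\<Union>i\<in>C. f ` B i) \<union> f ` N" using sub unfolding N_def by blast
  then have "emeasure lebesgue (f ` U) \<le> emeasure lebesgue (\<Union>i\<in>C. f ` B i)"
    using emeasure_Un_null_set[OF _ N] C(1) meas
    by (simp add: B_def sets.countable_UN'')
  also have "\<dots> = (\<integral>\<^sup>+i. emeasure lebesgue (f ` B i) \<partial>count_space C)"
  proof (rule emeasure_UN_countable)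
    show "disjoint_family_on (\<lambda>i. f ` B i) C"
      using dis inj by (simp add: disjoint_family_on_def image_Int[symmetric])
  qed (use C(1) meas in \<open>auto simp: B_def\<close>)
  also have "\<dots> \<le> (\<integral>\<^sup>+i. ennreal (L ^ DIM('a)) * emeasure lebesgue (B i) \<partial>count_space C)"
  proof (rule nn_integral_mono)
    fix i
    have "emeasure lebesgue (f ` B i) \<le> emeasure lebesgue (ball (f (fst i)) (L * snd i))"
      unfolding B_def by (rule emeasure_mono[OF lipschitz_image_ball_subset[OF f]]) simp
    also have "\<dots> = ennreal (L ^ DIM('a)) * emeasure lebesgue (B i)"
      unfolding B_def by (rule emeasure_lebesgue_ball_scale[OF f(2)])
    finally show "emeasure lebesgue (f ` B i) \<le> ennreal (L ^ DIM('a)) * emeasure lebesgue (B i)" .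
  qed
  also have "\<dots> = ennreal (L ^ DIM('a)) * (\<integral>\<^sup>+i. emeasure lebesgue (B i) \<partial>count_space C)"
    by (simp add: nn_integral_cmult)
  also have "(\<integral>\<^sup>+i. emeasure lebesgue (B i) \<partial>count_space C) = emeasure lebesgue (\<Union>i\<in>C. B i)"
    by (rule emeasure_UN_countable[symmetric]) (use C(1) dis in \<open>auto simp: B_def\<close>)
  also have "\<dots> \<le> emeasure lebesgue U"
    by (rule emeasure_mono[OF sub]) (use U in auto)
  finally show ?thesis by (simp add: mult_left_mono)
qed

text \<open>Outer regularity reduces measurable sets to open ones.\<close>

lemma emeasure_lipschitz_image_le:
  fixes f :: "'a::euclidean_space \<Rightarrow> 'a"
  assumes f: "L-lipschitz_on UNIV f" "0 < L" and inj: "inj f" and A: "A \<in> sets lebesgue"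
    and meas: "\<And>A. A \<in> sets lebesgue \<Longrightarrow> f ` A \<in> sets lebesgue"
  shows "emeasure lebesgue (f ` A) \<le> ennreal (L ^ DIM('a)) * emeasure lebesgue A"
proof (rule ennreal_le_epsilon)
  fix e :: real assume "0 < e"
  define c where "c = L ^ DIM('a)"
  have c: "0 < c" using f(2) by (simp add: c_def)
  obtain U where U: "open U" "A \<subseteq> U" "(U - A) \<in> lmeasurable"
      "emeasure lebesgue (U - A) < ennreal (e / c)"
    using sets_lebesgue_outer_open[OF A, of "e / c"] \<open>0 < e\<close> c by auto
  have "emeasure lebesgue (f ` A) \<le> emeasure lebesgue (f ` U)"
    by (rule emeasure_mono) (use U meas in auto)
  also have "\<dots> \<le> ennreal c * emeasure lebesgue U"
    using emeasure_lipschitz_image_open_le[OF f inj U(1) meas] by (simp add: c_def)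
  also have "emeasure lebesgue U \<le> emeasure lebesgue A + emeasure lebesgue (U - A)"
  proof -
    have "U = A \<union> (U - A)" using U(2) by auto
    then show ?thesis using emeasure_subadditive[OF A, of "U - A"] U(3) by auto
  qed
  also have "\<dots> \<le> emeasure lebesgue A + ennreal (e / c)" using U(4) by (simp add: less_imp_le)
  also have "ennreal c * (emeasure lebesgue A + ennreal (e / c)) =
      ennreal c * emeasure lebesgue A + ennreal e"
    using c by (simp add: distrib_left ennreal_mult[symmetric] \<open>0 < e\<close> less_imp_le)
  finally show "emeasure lebesgue (f ` A) \<le> ennreal (L ^ DIM('a)) * emeasure lebesgue A + ennreal e"
    by (simp add: c_def mult_left_mono)
qed

text \<open>A bound on preimages says that the image measure of \<open>M\<close> is at most \<open>c\<close> times \<open>N\<close>.  Both Lebesgue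
  and surface integrals are transported through this.\<close>

lemma nn_integral_compose_le:
  assumes T: "T \<in> measurable M N" and f: "f \<in> borel_measurable N"
    and le: "\<And>B. B \<in> sets N \<Longrightarrow> emeasure M (T -` B \<inter> space M) \<le> c * emeasure N B"
  shows "(\<integral>\<^sup>+x. f (T x) \<partial>M) \<le> c * (\<integral>\<^sup>+y. f y \<partial>N)"
proof -
  have "(\<integral>\<^sup>+x. f (T x) \<partial>M) = (\<integral>\<^sup>+y. f y \<partial>distr M N T)"
    by (rule nn_integral_distr[symmetric]) (use T f in auto)
  also have "\<dots> \<le> (\<integral>\<^sup>+y. f y \<partial>scale_measure c N)"
  proof (rule nn_integral_mono_measure)
    show "distr M N T \<le> scale_measure c N"
      using le by (intro le_measure[THEN iffD2])
        (auto simp: emeasure_distr[OF T])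
  qed simp
  also have "\<dots> = c * (\<integral>\<^sup>+y. f y \<partial>N)" by (rule nn_integral_scale_measure[OF f])
  finally show ?thesis .
qed

context bilipschitz_change
begin

lemma vimage_F: "F -` A = G ` A"
proof
  show "F -` A \<subseteq> G ` A" by (metis G_F image_eqI subsetI vimageD)
qed auto

lemma inj_G: "inj G"
  by (metis F_G injI)

lemma continuous_F: "continuous_on A F"
  using continuous_on_subset[OF lipschitz_on_continuous_on[OF lipschitz_F]] by simp

lemma continuous_G: "continuous_on A G"
  using continuous_on_subset[OF lipschitz_on_continuous_on[OF lipschitz_G]] by simp

lemma borel_F: "B \<in> sets borel \<Longrightarrow> F -` B \<in> sets borel"
  using measurable_sets_borel[OF borel_measurable_continuous_onI[OF continuous_F]] by blast

text \<open>A Lebesgue set is a Borel set together with part of a null set; preimages of null sets are images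
  under the Lipschitz map \<open>G\<close> and hence null.\<close>

lemma measurable_F: "F \<in> measurable lebesgue lebesgue"
proof (rule measurableI)
  fix A :: "'a set" assume "A \<in> sets lebesgue"
  then obtain S N N' where *: "A = S \<union> N" "N \<subseteq> N'" "N' \<in> null_sets lborel" "S \<in> sets lborel"
    by (rule sets_completionE)
  have "negligible N'"
    using *(3) by (simp add: negligible_iff_null_sets null_sets_completionI)
  then have "negligible N" using *(2) negligible_subset by blast
  then have "negligible (G ` N)" using lipschitz_image_negligible[OF lipschitz_G] by blast
  then have 1: "G ` N \<in> sets lebesgue" by (simp add: negligible_imp_sets)
  have "F -` S \<in> sets lebesgue" using *(4) borel_F[of S] by simp
  moreover have "F -` A = F -` S \<union> G ` N" using *(1) by (simp add: vimage_F image_Un)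
  ultimately show "F -` A \<inter> space lebesgue \<in> sets lebesgue" using 1 by simp
qed auto

lemma sets_G_image: "A \<in> sets lebesgue \<Longrightarrow> G ` A \<in> sets lebesgue"
  using measurable_sets[OF measurable_F, of A] by (simp add: vimage_F)

lemma emeasure_vimage_F_le:
  "A \<in> sets lebesgue \<Longrightarrow> emeasure lebesgue (F -` A) \<le> ennreal (L ^ DIM('a)) * emeasure lebesgue A"
  unfolding vimage_F by (rule emeasure_lipschitz_image_le[OF lipschitz_G L_pos inj_G _ sets_G_image])

lemma AE_F:
  assumes "AE y in lebesgue. P y"
  shows "AE x in lebesgue. P (F x)"
proof -
  obtain N where N: "N \<in> null_sets lebesgue" "{y. \<not> P y} \<subseteq> N"
    using assms by (auto simp: eventually_ae_filter)
  then have "G ` N \<in> null_sets lebesgue"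
    using lipschitz_image_negligible[OF lipschitz_G] negligible_iff_null_sets by blast
  then show ?thesis by (rule AE_I') (use N(2) in \<open>auto simp flip: vimage_F\<close>)
qed

lemma nn_integral_lebesgue_pullback_le:
  assumes S: "S \<in> sets lebesgue" and f: "f \<in> borel_measurable (lebesgue_on S)"
  shows "(\<integral>\<^sup>+x. f (F x) \<partial>lebesgue_on (F -` S)) \<le> ennreal (L ^ DIM('a)) * (\<integral>\<^sup>+y. f y \<partial>lebesgue_on S)"
proof -
  have S': "F -` S \<in> sets lebesgue" using sets_G_image[OF S] by (simp add: vimage_F)
  show ?thesis
  proof (rule nn_integral_compose_le[OF _ f])
    show "F \<in> lebesgue_on (F -` S) \<rightarrow>\<^sub>M lebesgue_on S"
      by (rule measurable_restrict_space3[OF measurable_F]) auto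
    fix B assume "B \<in> sets (lebesgue_on S)"
    then have B: "B \<in> sets lebesgue" "B \<subseteq> S"
      using S by (auto simp: sets_restrict_space_iff)
    have "emeasure lebesgue (F -` B \<inter> F -` S) \<le> ennreal (L ^ DIM('a)) * emeasure lebesgue B"
      using emeasure_vimage_F_le[OF B(1)] B(2) by (metis inf.absorb1 vimage_mono)
    then show "emeasure (lebesgue_on (F -` S)) (F -` B \<inter> space (lebesgue_on (F -` S)))
        \<le> ennreal (L ^ DIM('a)) * emeasure (lebesgue_on S) B"
      using S S' B by (simp add: emeasure_restrict_space)
  qed
qed

lemma measurable_lebesgue_on_F:
  assumes "f \<in> borel_measurable (lebesgue_on S)"
  shows "(\<lambda>x. f (F x)) \<in> borel_measurable (lebesgue_on (F -` S))"
  by (rule measurable_compose[OF measurable_restrict_space3[OF measurable_F] assms]) auto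

end

section \<open>Hausdorff measure on the boundary\<close>

text \<open>A positive finite factor can be moved across an infimum in the extended nonnegative reals.  All
  quantities that are compared below, from Hausdorff measure to eigenvalues, are infima.\<close>

lemma le_cmult_INF_ennreal:
  fixes f :: "'i \<Rightarrow> ennreal"
  assumes r: "0 < (r::real)" and le: "\<And>i. i \<in> I \<Longrightarrow> x \<le> ennreal r * f i"
  shows "x \<le> ennreal r * (INF i\<in>I. f i)"
proof -
  have one: "ennreal (1 / r) * ennreal r = 1" using r by (simp add: ennreal_mult'[symmetric])
  have "ennreal (1 / r) * x \<le> (INF i\<in>I. f i)"
  proof (rule INF_greatest)
    fix i assume "i \<in> I"
    then have "ennreal (1 / r) * x \<le> ennreal (1 / r) * (ennreal r * f i)"
      by (intro mult_left_mono le) auto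
    then show "ennreal (1 / r) * x \<le> f i" by (simp add: mult.assoc[symmetric] one)
  qed
  then have "ennreal r * (ennreal (1 / r) * x) \<le> ennreal r * (INF i\<in>I. f i)"
    by (intro mult_left_mono) auto
  then show ?thesis using one by (simp add: mult.assoc[symmetric] mult.commute[of "ennreal r"])
qed

text \<open>The image of a cover by sets of diameter at most \<open>\<delta> / L\<close> is a cover by sets of diameter at
  most \<open>\<delta>\<close>.\<close>

lemma hausdorff_outer_lipschitz_image_le:
  fixes f :: "'a::euclidean_space \<Rightarrow> 'a"
  assumes f: "L-lipschitz_on UNIV f" "0 < L"
  shows "hausdorff_outer d (f ` A) \<le> ennreal (L ^ d) * hausdorff_outer d A"
proof -
  define cov where "cov \<delta> A = {U :: nat \<Rightarrow> 'a set.
      A \<subseteq> (\<Union>i. U i) \<and> (\<forall>i. bounded (U i) \<and> diameter (U i) \<le> \<delta>)}" for \<delta> A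
  define cost where
    "cost U = (\<Sum>i. ennreal (unit_ball_vol (real d) * (diameter (U i) / 2) ^ d))" for U :: "nat \<Rightarrow> 'a set"
  have outer: "hausdorff_outer d B = (SUP \<delta>\<in>{0<..}. INF U\<in>cov \<delta> B. cost U)" for B
    by (simp add: hausdorff_outer_def cov_def cost_def)
  have diam: "diameter (f ` S) \<le> L * diameter S" "bounded (f ` S)" if "bounded S" for S
  proof -
    have *: "dist (f x) (f y) \<le> L * diameter S" if "x \<in> S" "y \<in> S" for x y
    proof -
      have "dist (f x) (f y) \<le> L * dist x y" using lipschitz_onD[OF f(1)] by auto
      also have "\<dots> \<le> L * diameter S"
        using diameter_bounded_bound[OF \<open>bounded S\<close> that] f(2) by simp
      finally show ?thesis .
    qed
    then show "diameter (f ` S) \<le> L * diameter S"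
      using f(2) diameter_ge_0[OF \<open>bounded S\<close>] by (intro diameter_le) (auto simp: dist_norm)
    show "bounded (f ` S)"
      using * unfolding bounded_two_points by blast
  qed
  have cost: "cost (\<lambda>i. f ` U i) \<le> ennreal (L ^ d) * cost U" if "\<And>i. bounded (U i)" for U
  proof -
    have "cost (\<lambda>i. f ` U i) \<le>
        (\<Sum>i. ennreal (L ^ d) * ennreal (unit_ball_vol (real d) * (diameter (U i) / 2) ^ d))"
      unfolding cost_def
    proof (rule suminf_le)
      fix i
      have "(diameter (f ` U i) / 2) ^ d \<le> (L * diameter (U i) / 2) ^ d"
        using diam[OF that[of i]] diameter_ge_0 by (intro power_mono) auto
      then have "unit_ball_vol (real d) * (diameter (f ` U i) / 2) ^ d
          \<le> L ^ d * (unit_ball_vol (real d) * (diameter (U i) / 2) ^ d)"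
        by (rule order_trans[OF mult_left_mono])
          (simp_all add: power_mult_distrib power_divide mult.left_commute)
      then show "ennreal (unit_ball_vol (real d) * (diameter (f ` U i) / 2) ^ d) \<le>
          ennreal (L ^ d) * ennreal (unit_ball_vol (real d) * (diameter (U i) / 2) ^ d)"
        using f(2) by (simp add: ennreal_mult'[symmetric] ennreal_leI)
    qed auto
    then show ?thesis by (simp add: cost_def)
  qed
  show ?thesis
    unfolding outer[of "f ` A"]
  proof (rule SUP_least)
    fix \<delta> :: real assume "\<delta> \<in> {0<..}"
    then have \<delta>: "0 < \<delta>" by simp
    have "(INF U\<in>cov \<delta> (f ` A). cost U) \<le> ennreal (L ^ d) * (INF U\<in>cov (\<delta> / L) A. cost U)"
    proof (rule le_cmult_INF_ennreal)
      fix U assume U: "U \<in> cov (\<delta> / L) A"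
      have "(\<lambda>i. f ` U i) \<in> cov \<delta> (f ` A)"
      proof -
        have "diameter (f ` U i) \<le> \<delta>" for i
          using diam(1)[of "U i"] U f(2) mult_left_mono[of "diameter (U i)" "\<delta> / L" L]
          by (auto simp: cov_def)
        moreover have "f ` A \<subseteq> (\<Union>i. f ` U i)"
          using U image_mono[of A "\<Union>i. U i" f] by (simp add: cov_def image_UN)
        ultimately show ?thesis using diam(2) U by (auto simp: cov_def)
      qed
      then show "(INF U\<in>cov \<delta> (f ` A). cost U) \<le> ennreal (L ^ d) * cost U"
        using cost[of U] U by (intro INF_lower2[of "\<lambda>i. f ` U i"]) (auto simp: cov_def)
    qed (use f(2) in simp)
    also have "(INF U\<in>cov (\<delta> / L) A. cost U) \<le> hausdorff_outer d A"
      unfolding outer using \<delta> f(2) by (intro SUP_upper) auto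
    finally show "(INF U\<in>cov \<delta> (f ` A). cost U) \<le> ennreal (L ^ d) * hausdorff_outer d A"
      by (simp add: mult_left_mono)
  qed
qed

lemma space_hausdorff_measure [simp]: "space (hausdorff_measure d) = UNIV"
  by (simp add: hausdorff_measure_def space_measure_of_conv)

lemma sets_hausdorff_measure [simp, measurable_cong]:
  "sets (hausdorff_measure d :: 'a::euclidean_space measure) = sets borel"
  using sets.sigma_sets_eq[of "borel :: 'a measure"]
  by (simp add: hausdorff_measure_def sets_measure_of_conv)

text \<open>By the definition of \<open>measure_of\<close>, the Hausdorff measure is either the outer measure on all Borel
  sets or zero on all of them.  The inequality is inherited from the outer measure in the first case
  and trivial in the second.\<close>

lemma (in bilipschitz_change) emeasure_hausdorff_vimage_le:
  assumes "A \<in> sets borel"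
  shows "emeasure (hausdorff_measure d) (F -` A) \<le> ennreal (L ^ d) * emeasure (hausdorff_measure d) A"
proof -
  have "F -` A \<in> sets borel"
    using assms by (rule borel_F)
  then show ?thesis
    using assms hausdorff_outer_lipschitz_image_le[OF lipschitz_G L_pos, of d A]
      sets.sigma_sets_eq[of "borel :: 'a measure"]
    by (simp add: hausdorff_measure_def emeasure_measure_of_conv vimage_F)
qed

context bilipschitz_change
begin

lemma closure_vimage: "closure (F -` S) = F -` closure S"
proof
  show "closure (F -` S) \<subseteq> F -` closure S"
    by (rule closure_minimal) (use continuous_F in \<open>auto intro!: closed_vimage simp: closure_subset[THEN subsetD]\<close>)
  show "F -` closure S \<subseteq> closure (F -` S)"
    unfolding vimage_F by (rule image_closure_subset) (use continuous_G in \<open>auto simp: closure_subset[THEN subsetD]\<close>)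
qed

lemma frontier_vimage: "frontier (F -` S) = F -` frontier S"
proof -
  have "- F -` S = F -` (- S)" by auto
  then show ?thesis by (simp add: frontier_closures closure_vimage)
qed

lemma measurable_surface_measure_F: 
  "F \<in> measurable (surface_measure (F -` S)) (surface_measure S)"
  unfolding surface_measure_def frontier_vimage
  using borel_measurable_continuous_onI[OF continuous_F]
  by (intro measurable_restrict_space3) (auto simp: measurable_cong_sets[OF sets_hausdorff_measure sets_hausdorff_measure])

lemma nn_integral_surface_pullback_le:
  assumes f: "f \<in> borel_measurable (surface_measure S)"
  shows "(\<integral>\<^sup>+x. f (F x) \<partial>surface_measure (F -` S))
    \<le> ennreal (L ^ (DIM('a) - 1)) * (\<integral>\<^sup>+y. f y \<partial>surface_measure S)"
proof (rule nn_integral_compose_le[OF measurable_surface_measure_F f])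
  fix B assume B: "B \<in> sets (surface_measure S)"
  then have B': "B \<in> sets borel" "B \<subseteq> frontier S"
    by (auto simp: surface_measure_def sets_restrict_space_iff)
  have "F -` B \<inter> space (surface_measure (F -` S)) = F -` B"
    using B'(2) by (auto simp: surface_measure_def space_restrict_space frontier_vimage)
  moreover have "F -` B \<in> sets borel"
    using B'(1) by (rule borel_F)
  moreover have "F -` B \<subseteq> frontier (F -` S)" using B'(2) by (auto simp: frontier_vimage)
  ultimately show "emeasure (surface_measure (F -` S)) (F -` B \<inter> space (surface_measure (F -` S)))
      \<le> ennreal (L ^ (DIM('a) - 1)) * emeasure (surface_measure S) B"
    using B' emeasure_hausdorff_vimage_le[OF B'(1), of "DIM('a) - 1"]
    by (simp add: surface_measure_def emeasure_restrict_space)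
qed

end

section \<open>Smooth bump functions\<close>

text \<open>The functions \<open>exp (- 1 / t) / t\<^sup>m\<close>, extended by zero, are taken together because their derivatives
  are combinations of functions of the same family.\<close>

fun flat_power :: "nat \<Rightarrow> real \<Rightarrow> real" where
  "flat_power m t = (if 0 < t then exp (- (1 / t)) / t ^ m else 0)"
declare flat_power.simps [simp del]

lemma flat_power_tendsto_0: "(flat_power m \<longlongrightarrow> 0) (at 0)"
proof -
  have "((\<lambda>s::real. s ^ m / exp s) \<longlongrightarrow> 0) at_top"
    by (rule tendsto_power_div_exp_0)
  then have "((\<lambda>t::real. (inverse t) ^ m / exp (inverse t)) \<longlongrightarrow> 0) (at_right 0)"
    by (rule filterlim_compose) (rule filterlim_inverse_at_top_right)
  then have "(flat_power m \<longlongrightarrow> 0) (at_right 0)"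
    by (rule Lim_transform_eventually)
      (auto simp: eventually_at_filter flat_power.simps exp_minus field_simps)
  moreover have "(flat_power m \<longlongrightarrow> 0) (at_left 0)"
    by (rule Lim_transform_eventually[OF tendsto_const])
      (auto simp: eventually_at_filter flat_power.simps)
  ultimately show ?thesis by (simp add: filterlim_at_split)
qed

lemma has_real_derivative_flat_power:
  "(flat_power m has_real_derivative flat_power (m + 2) t - real m * flat_power (m + 1) t) (at t)"
proof -
  consider "t < 0" | "t = 0" | "0 < t" by linarith
  then show ?thesis
  proof cases
    case 1
    have "((\<lambda>t. 0) has_real_derivative 0) (at t)" by simp
    moreover have "\<forall>\<^sub>F x in nhds t. 0 = flat_power m x"
      using 1 order_tendstoD(2)[OF filterlim_ident[of "nhds t"], of 0] 
      by (auto elim!: eventually_mono simp: flat_power.simps)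
    ultimately have "(flat_power m has_real_derivative 0) (at t)"
      by (subst (asm) DERIV_cong_ev[OF refl _ refl]) auto
    then show ?thesis using 1 by (simp add: flat_power.simps)
  next
    case 2
    have "flat_power (m + 1) h = (flat_power m (0 + h) - flat_power m 0) / h" for h
      by (simp add: flat_power.simps)
    then have "(flat_power m has_real_derivative 0) (at 0)"
      unfolding DERIV_def using flat_power_tendsto_0[of "m + 1"] by presburger
    then show ?thesis using 2 by (simp add: flat_power.simps)
  next
    case 3
    have "((\<lambda>t. exp (- (1 / t)) / t ^ m) has_real_derivative
        (exp (- (1 / t)) * (1 / t^2) * t ^ m - exp (- (1 / t)) * (real m * t ^ (m - 1))) / (t ^ m * t ^ m)) (at t)"
      using 3 by (auto intro!: derivative_eq_intros simp: field_simps power2_eq_square)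
    moreover have "(exp (- (1 / t)) * (1 / t^2) * t ^ m - exp (- (1 / t)) * (real m * t ^ (m - 1))) / (t ^ m * t ^ m)
        = flat_power (m + 2) t - real m * flat_power (m + 1) t"
      using 3 by (cases m) (simp_all add: flat_power.simps field_simps power2_eq_square)
    moreover have "\<forall>\<^sub>F x in nhds t. exp (- (1 / x)) / x ^ m = flat_power m x"
      using 3 order_tendstoD(1)[OF filterlim_ident[of "nhds t"], of 0] 
      by (auto elim!: eventually_mono simp: flat_power.simps)
    ultimately show ?thesis
      using DERIV_cong_ev[OF refl, of "\<lambda>t. exp (- (1 / t)) / t ^ m" "flat_power m" t] by metis
  qed
qed

text \<open>A set of functions that contains a bump on the ball of radius \<open>r\<close> about \<open>y\<close> and is closed under
  partial derivatives; everything in it is therefore smooth.\<close>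

inductive bump_algebra :: "'a::euclidean_space \<Rightarrow> real \<Rightarrow> ('a \<Rightarrow> real) \<Rightarrow> bool" for y r where
  const: "bump_algebra y r (\<lambda>z. c)"
| coord: "bump_algebra y r (\<lambda>z. z \<bullet> v)"
| flat: "bump_algebra y r (\<lambda>z. flat_power m (r\<^sup>2 - (norm (z - y))\<^sup>2))"
| add: "bump_algebra y r f \<Longrightarrow> bump_algebra y r g \<Longrightarrow> bump_algebra y r (\<lambda>z. f z + g z)"
| mult: "bump_algebra y r f \<Longrightarrow> bump_algebra y r g \<Longrightarrow> bump_algebra y r (\<lambda>z. f z * g z)"

lemma bump_algebra_derivative:
  "bump_algebra y r f \<Longrightarrow>
    \<exists>f'. (\<forall>x. (f has_derivative f' x) (at x)) \<and> (\<forall>i. bump_algebra y r (\<lambda>x. f' x i))"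
proof (induction rule: bump_algebra.induct)
  case (const c)
  show ?case by (rule exI[of _ "\<lambda>_ _. 0"]) (auto intro: bump_algebra.intros)
next
  case (coord v)
  show ?case
    by (rule exI[of _ "\<lambda>_ h. h \<bullet> v"]) (auto intro!: derivative_eq_intros bump_algebra.intros)
next
  case (flat m)
  define f' where "f' x h = (flat_power (m + 2) (r\<^sup>2 - (norm (x - y))\<^sup>2)
      + (- real m) * flat_power (m + 1) (r\<^sup>2 - (norm (x - y))\<^sup>2)) * (-2 * (x \<bullet> h) + 2 * (y \<bullet> h))" for x h :: 'a
  have *: "((\<lambda>z. r\<^sup>2 - (norm (z - y))\<^sup>2) has_derivative (\<lambda>h. -2 * (x \<bullet> h) + 2 * (y \<bullet> h))) (at x)" for x
    unfolding power2_norm_eq_inner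
    by (auto intro!: derivative_eq_intros simp: inner_diff algebra_simps inner_commute)
  have "((\<lambda>z. flat_power m (r\<^sup>2 - (norm (z - y))\<^sup>2)) has_derivative f' x) (at x)" for x
    using has_derivative_compose[OF * has_real_derivative_flat_power[THEN has_field_derivative_imp_has_derivative]]
    unfolding f'_def by simp
  moreover have "bump_algebra y r (\<lambda>x. f' x i)" for i
    unfolding f'_def by (intro bump_algebra.intros)
  ultimately show ?case by blast
next
  case (add f g)
  then obtain f' g' where "\<And>x. (f has_derivative f' x) (at x)" "\<And>i. bump_algebra y r (\<lambda>x. f' x i)"
    "\<And>x. (g has_derivative g' x) (at x)" "\<And>i. bump_algebra y r (\<lambda>x. g' x i)" by metis
  then show ?case
    by (intro exI[of _ "\<lambda>x h. f' x h + g' x h"])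
      (auto intro!: derivative_eq_intros bump_algebra.add)
next
  case (mult f g)
  then obtain f' g' where "\<And>x. (f has_derivative f' x) (at x)" "\<And>i. bump_algebra y r (\<lambda>x. f' x i)"
    "\<And>x. (g has_derivative g' x) (at x)" "\<And>i. bump_algebra y r (\<lambda>x. g' x i)" by metis
  with mult.hyps show ?case
    by (intro exI[of _ "\<lambda>x h. f x * g' x h + f' x h * g x"])
      (auto intro!: has_derivative_mult bump_algebra.add bump_algebra.mult)
qed

lemma Ck_bump_algebra: "bump_algebra y r f \<Longrightarrow> Ck k f"
proof (induction k arbitrary: f)
  case 0
  then obtain f' where "\<forall>x. (f has_derivative f' x) (at x)"
    using bump_algebra_derivative by blast
  then show ?case
    by (auto simp: continuous_on_eq_continuous_at intro: has_derivative_continuous)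
next
  case (Suc k)
  then obtain f' where f': "\<And>x. (f has_derivative f' x) (at x)" "\<And>i. bump_algebra y r (\<lambda>x. f' x i)"
    using bump_algebra_derivative by blast
  then have "frechet_derivative f (at x) = f' x" for x
    using frechet_derivative_at by metis
  then show ?case using f' Suc.IH by (auto simp: differentiable_def)
qed

lemma has_derivative_0_outside_support:
  fixes f :: "'a::euclidean_space \<Rightarrow> real"
  assumes "x \<notin> closure {x. f x \<noteq> 0}"
  shows "(f has_derivative (\<lambda>h. 0)) (at x)"
proof -
  have "((\<lambda>x. 0) has_derivative (\<lambda>h. 0)) (at x)" by simp
  then show ?thesis
    by (rule has_derivative_transform_within_open[where s = "- closure {x. f x \<noteq> 0}"])
      (use assms closure_subset[of "{x. f x \<noteq> 0}"] in auto)
qed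

lemma linear_functional_expand:
  fixes D :: "'a::euclidean_space \<Rightarrow> real"
  assumes "linear D"
  shows "D h = (\<Sum>i\<in>Basis. (h \<bullet> i) * D i)"
proof -
  have "D h = D (\<Sum>i\<in>Basis. (h \<bullet> i) *\<^sub>R i)" by (simp add: euclidean_representation)
  also have "\<dots> = (\<Sum>i\<in>Basis. (h \<bullet> i) * D i)"
    using assms by (simp add: linear_sum linear_cmul)
  finally show ?thesis .
qed

lemma Ck_compact_support_bounds:
  fixes f :: "'a::euclidean_space \<Rightarrow> real"
  assumes f: "Ck 1 f" and K: "compact (closure {x. f x \<noteq> 0})"
  obtains B where "0 \<le> B" "\<And>x. \<bar>f x\<bar> \<le> B" "\<And>x i. i \<in> Basis \<Longrightarrow> \<bar>frechet_derivative f (at x) i\<bar> \<le> B"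
    "B-lipschitz_on UNIV f"
proof -
  define K where "K = closure {x. f x \<noteq> 0}"
  define D where "D x = frechet_derivative f (at x)" for x
  have der: "(f has_derivative D x) (at x)" for x
    using f by (auto simp: D_def frechet_derivative_works)
  have cont: "continuous_on UNIV (\<lambda>x. D x i)" if "i \<in> Basis" for i
    using f that by (auto simp: D_def)
  have cf: "continuous_on UNIV f"
    using der by (auto simp: continuous_on_eq_continuous_at intro: has_derivative_continuous)
  have bd: "\<exists>B\<ge>0. \<forall>x. \<bar>g x\<bar> \<le> B" if "continuous_on UNIV g" "\<And>x. x \<notin> K \<Longrightarrow> g x = 0" for g :: "'a \<Rightarrow> real"
  proof -
    have "bounded (g ` K)"
      using K continuous_on_subset[OF that(1), of K]
      by (intro compact_imp_bounded compact_continuous_image) (auto simp: K_def)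
    then obtain B where "\<And>x. x \<in> K \<Longrightarrow> \<bar>g x\<bar> \<le> B" by (auto simp: bounded_iff)
    then show ?thesis using that(2) by (intro exI[of _ "max B 0"]) (metis abs_zero max.cobounded2 max.coboundedI1)
  qed
  obtain B0 where B0: "0 \<le> B0" "\<And>x. \<bar>f x\<bar> \<le> B0"
    using bd[OF cf] closure_subset[of "{x. f x \<noteq> 0}"] by (fastforce simp: K_def)
  have D0: "D x = (\<lambda>h. 0)" if "x \<notin> K" for x
    using has_derivative_0_outside_support[of x f] that der[of x] has_derivative_unique by (auto simp: K_def)
  have "\<exists>B. 0 \<le> B \<and> (\<forall>x. \<bar>D x i\<bar> \<le> B)" if "i \<in> Basis" for i
    using bd[OF cont[OF that]] D0 by auto
  then obtain B1 where B1: "\<And>i. i \<in> Basis \<Longrightarrow> 0 \<le> B1 i" "\<And>x i. i \<in> Basis \<Longrightarrow> \<bar>D x i\<bar> \<le> B1 i"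
    by metis
  define B where "B = B0 + sum B1 Basis"
  have s: "B1 i \<le> sum B1 Basis" if "i \<in> Basis" for i
    using member_le_sum[of i Basis B1] that B1 by auto
  have s0: "0 \<le> sum B1 Basis" using B1 by (intro sum_nonneg) auto
  have "\<bar>D x h\<bar> \<le> sum B1 Basis * norm h" for x h
  proof -
    have lin: "linear (D x)" using der has_derivative_linear by blast
    have "\<bar>D x h\<bar> = \<bar>\<Sum>i\<in>Basis. (h \<bullet> i) * D x i\<bar>"
      using linear_functional_expand[OF lin, of h] by simp
    also have "\<dots> \<le> (\<Sum>i\<in>Basis. \<bar>(h \<bullet> i) * D x i\<bar>)" by (rule sum_abs)
    also have "\<dots> \<le> (\<Sum>i\<in>Basis. norm h * B1 i)"
      using B1 by (intro sum_mono) (auto simp: abs_mult Basis_le_norm intro!: mult_mono)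
    finally show ?thesis by (simp add: sum_distrib_left mult.commute)
  qed
  then have "onorm (D x) \<le> sum B1 Basis" for x
    by (intro onorm_le) auto
  then have "norm (f x - f y) \<le> sum B1 Basis * norm (x - y)" for x y
    by (intro differentiable_bound[of UNIV f D]) (use der in auto)
  then have lip: "(sum B1 Basis)-lipschitz_on UNIV f"
    using s0 by (auto simp: lipschitz_on_def dist_norm)
  show thesis
  proof
    show "0 \<le> B" "\<bar>f x\<bar> \<le> B" for x using B0[of] s0 by (auto simp: B_def intro: order_trans[OF B0(2)])
    show "\<bar>frechet_derivative f (at x) i\<bar> \<le> B" if "i \<in> Basis" for x i
      using B1(2)[OF that, of x] s[OF that] B0(1) by (auto simp: B_def D_def)
    show "B-lipschitz_on UNIV f" using lip B0(1) by (auto intro: lipschitz_on_mono simp: B_def)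
  qed
qed

section \<open>Continuity of translation in the mean\<close>

text \<open>The partial derivatives are \<open>C\<^sup>1\<close> with compact support and so Lipschitz; the mean value inequality
  turns this into a quadratic remainder with a uniform constant.\<close>

lemma Ck_quadratic_remainder:
  fixes f :: "'a::euclidean_space \<Rightarrow> real"
  assumes f: "Ck 2 f" and K: "compact (closure {x. f x \<noteq> 0})"
  obtains M where "0 \<le> M"
    "\<And>x h. \<bar>f (x + h) - f x - frechet_derivative f (at x) h\<bar> \<le> M * (norm h)\<^sup>2"
proof -
  define D where "D x = frechet_derivative f (at x)" for x
  have der: "(f has_derivative D x) (at x)" for x
    using f by (auto simp: D_def frechet_derivative_works numeral_2_eq_2)
  have "\<exists>B. 0 \<le> B \<and> B-lipschitz_on UNIV (\<lambda>x. D x i)" if i: "i \<in> Basis" for i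
  proof -
    have D0: "D x i = 0" if "x \<notin> closure {x. f x \<noteq> 0}" for x
      using has_derivative_0_outside_support[OF that] der[of x] has_derivative_unique by metis
    then have "{x. D x i \<noteq> 0} \<subseteq> closure {x. f x \<noteq> 0}" by auto
    then have "closure {x. D x i \<noteq> 0} \<subseteq> closure {x. f x \<noteq> 0}" by (simp add: closure_minimal)
    then have "compact (closure {x. D x i \<noteq> 0})"
      using closed_Int_compact[OF closed_closure K, of "{x. D x i \<noteq> 0}"] by (simp add: inf.absorb1 del: compact_closure)
    moreover have "Ck 1 (\<lambda>x. D x i)" using f i by (simp add: D_def numeral_2_eq_2)
    ultimately show ?thesis by (metis Ck_compact_support_bounds)
  qed
  then obtain B where B: "\<And>i. i \<in> Basis \<Longrightarrow> 0 \<le> B i" "\<And>i. i \<in> Basis \<Longrightarrow> (B i)-lipschitz_on UNIV (\<lambda>x. D x i)"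
    by metis
  define M where "M = sum B Basis"
  have "0 \<le> M" unfolding M_def using B by (intro sum_nonneg) auto
  have *: "\<bar>D x h - D y h\<bar> \<le> (M * norm (x - y)) * norm h" for x y h
  proof -
    have lin: "linear (D x)" for x using der has_derivative_linear by blast
    have "D x h = (\<Sum>i\<in>Basis. (h \<bullet> i) * D x i)" for x
      by (rule linear_functional_expand[OF lin])
    then have "\<bar>D x h - D y h\<bar> = \<bar>\<Sum>i\<in>Basis. (h \<bullet> i) * (D x i - D y i)\<bar>"
      by (simp add: sum_subtractf right_diff_distrib)
    also have "\<dots> \<le> (\<Sum>i\<in>Basis. \<bar>(h \<bullet> i) * (D x i - D y i)\<bar>)" by (rule sum_abs)
    also have "\<dots> \<le> (\<Sum>i\<in>Basis. norm h * (B i * norm (x - y)))"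
      using B lipschitz_on_normD[OF B(2), of _ x y]
      by (intro sum_mono) (auto simp: abs_mult Basis_le_norm intro!: mult_mono)
    finally show ?thesis by (simp add: M_def sum_distrib_left sum_distrib_right ac_simps)
  qed
  have "\<bar>f (x + h) - f x - D x h\<bar> \<le> M * (norm h)\<^sup>2" for x h
  proof -
    have "norm (f (x + h) - f x - D x ((x + h) - x)) \<le> norm ((x + h) - x) * (M * norm h)"
    proof (rule differentiable_bound_linearization[where S = "cball x (norm h)"])
      fix y assume y: "y \<in> cball x (norm h)"
      show "(f has_derivative D y) (at y within cball x (norm h))"
        using der has_derivative_at_withinI by blast
      have "M * norm (y - x) \<le> M * norm h"
        using y \<open>0 \<le> M\<close> by (auto simp: dist_norm norm_minus_commute intro: mult_left_mono)
      then show "onorm (D y - D x) \<le> M * norm h"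
        using * order_trans[OF * mult_right_mono]
        by (intro onorm_le) (simp add: fun_diff_def)
    qed (auto simp: dist_norm mult_left_le_one_le)
    then show ?thesis by (simp add: power2_eq_square mult.left_commute)
  qed
  then show thesis using that \<open>0 \<le> M\<close> by (auto simp: D_def)
qed

text \<open>A uniform quadratic remainder survives integration against an integrable function, which makes
  this criterion convenient for differentiating convolutions.\<close>

lemma has_derivative_quadratic_remainder:
  fixes f :: "'a::real_normed_vector \<Rightarrow> real"
  assumes D: "bounded_linear D" and le: "\<And>h. \<bar>f (x + h) - f x - D h\<bar> \<le> M * (norm h)\<^sup>2"
  shows "(f has_derivative D) (at x)"
  unfolding has_derivative_at
proof (rule conjI[OF D], rule tendsto_sandwich[OF _ _ tendsto_const])
  show "\<forall>\<^sub>F h in at 0. norm (f (x + h) - f x - D h) / norm h \<le> M * norm h"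
    using le by (intro always_eventually allI) (auto simp: power2_eq_square divide_le_eq mult.assoc)
  show "((\<lambda>h. M * norm h) \<longlongrightarrow> 0) (at 0)"
    by (intro tendsto_mult_right_zero tendsto_norm_zero tendsto_ident_at)
qed auto

lemma lborel_distr_reflect: "distr lborel borel (\<lambda>x::'a::euclidean_space. y - x) = lborel"
  using lborel_affine[of "-1" y] by (simp add: density_1)

lemma integral_reflect:
  fixes f :: "'a::euclidean_space \<Rightarrow> 'b::{banach, second_countable_topology}"
  shows "f \<in> borel_measurable borel \<Longrightarrow> (LINT z|lborel. f (y - z)) = (LINT z|lborel. f z)"
  by (subst (2) lborel_distr_reflect[of y, symmetric], subst integral_distr) auto

lemma integrable_reflect:
  fixes f :: "'a::euclidean_space \<Rightarrow> 'b::{banach, second_countable_topology}"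
  assumes "integrable lborel f" shows "integrable lborel (\<lambda>z. f (y - z))"
  using assms by (subst (asm) lborel_distr_reflect[of y, symmetric], subst (asm) integrable_distr_eq) auto

lemma lborel_distr_translate: "distr lborel borel (\<lambda>x::'a::euclidean_space. x - w) = lborel"
proof -
  have "(\<lambda>x. x - w) = (+) (- w)" by auto
  then show ?thesis using lborel_distr_plus[of "-w"] by simp
qed

lemma nn_integral_translate:
  fixes f :: "'a::euclidean_space \<Rightarrow> ennreal"
  assumes "f \<in> borel_measurable borel"
  shows "(\<integral>\<^sup>+x. f (x - w) \<partial>lborel) = (\<integral>\<^sup>+x. f x \<partial>lborel)"
  by (subst (2) lborel_distr_translate[of w, symmetric], subst nn_integral_distr) (use assms in auto)

lemma integrable_translate:
  fixes f :: "'a::euclidean_space \<Rightarrow> 'b::{banach, second_countable_topology}"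
  assumes "integrable lborel f" shows "integrable lborel (\<lambda>z. f (z - w))"
  using assms by (subst (asm) lborel_distr_translate[of w, symmetric], subst (asm) integrable_distr_eq) auto

lemma integral_translate:
  fixes f :: "'a::euclidean_space \<Rightarrow> 'b::{banach, second_countable_topology}"
  shows "f \<in> borel_measurable borel \<Longrightarrow> (LINT z|lborel. f (z - w)) = (LINT z|lborel. f z)"
  by (subst (2) lborel_distr_translate[of w, symmetric], subst integral_distr) auto

lemma compact_inner_approximation:
  fixes A :: "'a::euclidean_space set"
  assumes A: "A \<in> sets borel" "emeasure lborel A < \<infinity>" and e: "0 < (e::real)"
  obtains K where "compact K" "K \<subseteq> A" "emeasure lborel (A - K) < ennreal e"
proof -
  have A': "A \<in> sets lebesgue" "0 < e/2" using A(1) e by simp_all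
  obtain T where T: "closed T" "T \<subseteq> A" "emeasure lebesgue (A - T) < ennreal (e/2)"
    by (rule sets_lebesgue_inner_closed[OF A'])
  have T': "emeasure lborel T < \<infinity>" 
    using emeasure_mono[OF T(2), of lborel] A by (auto intro: order_le_less_trans)
  define D where "D n = T - cball 0 (real n)" for n
  have "(\<lambda>n. emeasure lborel (D n)) \<longlonglongrightarrow> emeasure lborel (\<Inter>n. D n)"
  proof (rule Lim_emeasure_decseq)
    show "range D \<subseteq> sets lborel" using T(1) by (auto simp: D_def intro!: sets.Diff)
    show "decseq D" by (auto simp: D_def decseq_def)
    show "emeasure lborel (D i) \<noteq> \<infinity>" for i
      using emeasure_mono[of "D i" T lborel] T' T(1) by (auto simp: D_def top_unique)
  qed
  moreover have "(\<Inter>n. D n) = {}"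
    using real_arch_simple by (auto simp: D_def)
  ultimately have "(\<lambda>n. emeasure lborel (D n)) \<longlonglongrightarrow> 0" by simp
  then have "\<forall>\<^sub>F n in sequentially. emeasure lborel (D n) < ennreal (e/2)"
    using e by (intro order_tendstoD(2)) auto
  then obtain n where n: "emeasure lborel (D n) < ennreal (e/2)"
    by (auto simp: eventually_sequentially)
  have sub: "A - (T \<inter> cball 0 (real n)) \<subseteq> (A - T) \<union> D n" by (auto simp: D_def)
  have "emeasure lborel (A - (T \<inter> cball 0 (real n))) \<le> emeasure lborel ((A - T) \<union> D n)"
    by (rule emeasure_mono[OF sub]) (use A T(1) in \<open>auto simp: D_def intro!: sets.Diff sets.Un\<close>)
  also have "\<dots> \<le> emeasure lborel (A - T) + emeasure lborel (D n)"
    by (rule emeasure_subadditive) (use A T(1) in \<open>auto simp: D_def intro!: sets.Diff\<close>)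
  also have "\<dots> < ennreal (e/2) + ennreal (e/2)"
    using T A n by (intro add_strict_mono) (simp_all add: emeasure_completion sets.Diff)
  also have "\<dots> = ennreal e" using e by (simp add: ennreal_plus[symmetric] del: ennreal_plus)
  finally show thesis
    using T by (intro that[of "T \<inter> cball 0 (real n)"]) (auto simp: closed_Int_compact)
qed

text \<open>The distance in \<open>L\<^sup>1\<close> between \<open>f\<close> and its translate by \<open>w\<close>.\<close>

definition translation_gap :: "('a::euclidean_space \<Rightarrow> real) \<Rightarrow> 'a \<Rightarrow> ennreal" where
  "translation_gap f w = (\<integral>\<^sup>+x. ennreal \<bar>f (x - w) - f x\<bar> \<partial>lborel)"

lemma translation_gap_add:
  assumes [measurable]: "f \<in> borel_measurable borel" "g \<in> borel_measurable borel"
  shows "translation_gap (\<lambda>x. f x + g x) w \<le> translation_gap f w + translation_gap g w"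
proof -
  have "translation_gap (\<lambda>x. f x + g x) w
      \<le> (\<integral>\<^sup>+x. ennreal \<bar>f (x - w) - f x\<bar> + ennreal \<bar>g (x - w) - g x\<bar> \<partial>lborel)"
    unfolding translation_gap_def
    by (intro nn_integral_mono) (simp add: ennreal_plus[symmetric] del: ennreal_plus)
  also have "\<dots> = translation_gap f w + translation_gap g w"
    unfolding translation_gap_def by (rule nn_integral_add) auto
  finally show ?thesis .
qed

lemma translation_gap_le_norm:
  assumes [measurable]: "f \<in> borel_measurable borel"
  shows "translation_gap f w \<le> 2 * (\<integral>\<^sup>+x. ennreal \<bar>f x\<bar> \<partial>lborel)"
proof -
  have "translation_gap f w
      \<le> (\<integral>\<^sup>+x. ennreal \<bar>f (x - w)\<bar> + ennreal \<bar>f x\<bar> \<partial>lborel)"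
    unfolding translation_gap_def
    by (intro nn_integral_mono) (simp add: ennreal_plus[symmetric] del: ennreal_plus)
  also have "\<dots> = (\<integral>\<^sup>+x. ennreal \<bar>f (x - w)\<bar> \<partial>lborel) + (\<integral>\<^sup>+x. ennreal \<bar>f x\<bar> \<partial>lborel)"
    by (rule nn_integral_add) auto
  also have "(\<integral>\<^sup>+x. ennreal \<bar>f (x - w)\<bar> \<partial>lborel) = (\<integral>\<^sup>+x. ennreal \<bar>f x\<bar> \<partial>lborel)"
    by (rule nn_integral_translate[where f = "\<lambda>x. ennreal \<bar>f x\<bar>"]) auto
  finally show ?thesis by (simp add: mult_2)
qed

text \<open>Squeeze the set between a compact \<open>K\<close> and an open \<open>U\<close> whose difference has small measure.  A
  translation too short to move \<open>K\<close> out of \<open>U\<close> changes the indicator only on \<open>U - K\<close> and its translate.\<close>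

lemma translation_gap_indicator:
  assumes A: "A \<in> sets borel" "emeasure lborel A < \<infinity>" and e: "0 < (e::real)"
  shows "\<exists>d>0. \<forall>w. norm w < d \<longrightarrow> translation_gap (\<lambda>x::'a::euclidean_space. indicator A x *\<^sub>R c) w \<le> ennreal e"
proof -
  define a where "a = e / (4 * (\<bar>c\<bar> + 1))"
  have a: "0 < a" using e by (simp add: a_def)
  obtain K where K: "compact K" "K \<subseteq> A" "emeasure lborel (A - K) < ennreal a"
    using compact_inner_approximation[OF A a] .
  obtain U where U: "open U" "A \<subseteq> U" "emeasure lborel (U - A) < ennreal a"
    using outer_regular_lborel[OF A(1) a] by blast
  obtain d where d: "d > 0" "\<And>x w. x \<in> K \<Longrightarrow> norm w < d \<Longrightarrow> x + w \<in> U"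
  proof (cases "K = {} \<or> - U = {}")
    case True
    then show ?thesis using that[of 1] by auto
  next
    case False
    have "0 < setdist K (- U)"
      using K U False setdist_gt_0_compact_closed[of K "- U"] by (auto simp: closed_Compl)
    moreover have "x + w \<in> U" if "x \<in> K" "norm w < setdist K (- U)" for x w
    proof (rule ccontr)
      assume "x + w \<notin> U"
      then have "setdist K (- U) \<le> dist x (x + w)" using that by (intro setdist_le_dist) auto
      then show False using that by (simp add: dist_norm)
    qed
    ultimately show ?thesis using that by blast
  qed
  have "translation_gap (\<lambda>x. indicator A x *\<^sub>R c) w \<le> ennreal e" if w: "norm w < d" for w
  proof -
    have mU: "emeasure lborel (U - K) \<le> ennreal (2 * a)"
    proof -
      have "U - K = (U - A) \<union> (A - K)" using U K by auto
      then have "emeasure lborel (U - K) \<le> emeasure lborel (U - A) + emeasure lborel (A - K)"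
        using emeasure_subadditive[of "U - A" lborel "A - K"] U(1) A borel_compact[OF K(1)]
        by (simp add: sets.Diff)
      also have "\<dots> \<le> ennreal a + ennreal a" using U K by (intro add_mono) (auto simp: less_imp_le)
      finally show ?thesis using a by (simp add: ennreal_plus[symmetric] del: ennreal_plus)
    qed
    have [measurable]: "A \<in> sets borel" "U \<in> sets borel" "K \<in> sets borel"
      using A U K by (auto simp: borel_closed compact_imp_closed)
    have pt: "\<bar>indicator A (x - w) *\<^sub>R c - indicator A x *\<^sub>R c\<bar>
        \<le> \<bar>c\<bar> * (indicator (U - K) (x - w) + indicator (U - K) x)" for x
    proof (cases "x - w \<in> A \<longleftrightarrow> x \<in> A")
      case True
      then show ?thesis by (auto simp: indicator_def)
    next
      case False
      \<comment> \<open>If exactly one of \<open>x - w\<close> and \<open>x\<close> is in \<open>A\<close>, the one in \<open>A\<close> is in \<open>U\<close>.  If it is not in \<open>U - K\<close> it is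
        in \<open>K\<close>, and then the other one is in \<open>U\<close> and not in \<open>K\<close>.\<close>
      have "x \<in> U" if "x - w \<in> K" using d(2)[OF that w] by simp
      moreover have "x - w \<in> U" if "x \<in> K" using d(2)[OF that, of "-w"] w by simp
      ultimately have "x - w \<in> U - K \<or> x \<in> U - K" using False U K by auto
      then show ?thesis using False by (auto simp: indicator_def)
    qed
    have "translation_gap (\<lambda>x. indicator A x *\<^sub>R c) w
        \<le> (\<integral>\<^sup>+x. ennreal \<bar>c\<bar> * (indicator (U - K) (x - w) + indicator (U - K) x) \<partial>lborel)"
      unfolding translation_gap_def
    proof (rule nn_integral_mono)
      fix x
      show "ennreal \<bar>indicator A (x - w) *\<^sub>R c - indicator A x *\<^sub>R c\<bar>
          \<le> ennreal \<bar>c\<bar> * (indicator (U - K) (x - w) + indicator (U - K) x)"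
        using ennreal_leI[OF pt[of x]]
        by (simp add: ennreal_mult' ennreal_indicator[symmetric] flip: ennreal_plus del: ennreal_indicator)
    qed
    also have "\<dots> = ennreal \<bar>c\<bar> * ((\<integral>\<^sup>+x. indicator (U - K) (x - w) \<partial>lborel)
        + (\<integral>\<^sup>+x. indicator (U - K) x \<partial>lborel))"
      by (subst nn_integral_cmult, measurable, subst nn_integral_add) auto
    also have "(\<integral>\<^sup>+x. indicator (U - K) (x - w) \<partial>lborel) = (\<integral>\<^sup>+x. indicator (U - K) x \<partial>lborel)"
      by (rule nn_integral_translate) measurable
    also have "(\<integral>\<^sup>+x. indicator (U - K) x \<partial>lborel) = emeasure lborel (U - K)"
      by (rule nn_integral_indicator) measurable
    also have "ennreal \<bar>c\<bar> * (emeasure lborel (U - K) + emeasure lborel (U - K))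
        \<le> ennreal \<bar>c\<bar> * (ennreal (2 * a) + ennreal (2 * a))"
      by (intro mult_left_mono add_mono mU) auto
    also have "\<dots> = ennreal (\<bar>c\<bar> * (4 * a))"
      using a by (simp add: ennreal_mult'[symmetric] flip: ennreal_plus)
    also have "\<dots> \<le> ennreal e"
      using e by (intro ennreal_leI) (simp add: a_def field_simps)
    finally show ?thesis .
  qed
  then show ?thesis using d(1) by blast
qed

lemma translation_gap_tendsto_0:
  fixes f :: "'a::euclidean_space \<Rightarrow> real"
  assumes "integrable lborel f" "0 < e"
  shows "\<exists>d>0. \<forall>w. norm w < d \<longrightarrow> translation_gap f w \<le> ennreal e"
  using assms
proof (induction arbitrary: e rule: integrable_induct)
  case (base A c)
  then show ?case by (intro translation_gap_indicator) simp_all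
next
  case (add f g)
  obtain d where d: "d > 0" "\<And>w. norm w < d \<Longrightarrow> translation_gap f w \<le> ennreal (e/2)"
    using add.IH(1)[of "e/2"] add.prems by auto
  obtain d' where d': "d' > 0" "\<And>w. norm w < d' \<Longrightarrow> translation_gap g w \<le> ennreal (e/2)"
    using add.IH(2)[of "e/2"] add.prems by auto
  have "translation_gap (\<lambda>x. f x + g x) w \<le> ennreal e" if "norm w < min d d'" for w
  proof -
    have "translation_gap (\<lambda>x. f x + g x) w \<le> translation_gap f w + translation_gap g w"
      using add.hyps by (intro translation_gap_add) auto
    also have "\<dots> \<le> ennreal (e/2) + ennreal (e/2)" using d d' that by (intro add_mono) auto
    finally show ?thesis using add.prems ennreal_plus[of "e/2" "e/2"] by simp
  qed
  then show ?case using d(1) d'(1) by (intro exI[of _ "min d d'"]) auto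
next
  case (lim f s)
  have [measurable]: "f \<in> borel_measurable borel" "\<And>i. s i \<in> borel_measurable borel"
    using lim.hyps by auto
  have "(\<lambda>i. \<integral>\<^sup>+x. norm (f x - s i x) \<partial>lborel) \<longlonglongrightarrow> 0"
  proof (rule nn_integral_dominated_convergence_norm[where w = "\<lambda>x. 2 * norm (f x)"])
    have "integrable lborel (\<lambda>x. 2 * norm (f x))" using lim.hyps(4) by simp
    then show "(\<integral>\<^sup>+x. ennreal (2 * norm (f x)) \<partial>lborel) < \<infinity>"
      unfolding integrable_iff_bounded by simp
    show "AE x in lborel. (\<lambda>i. s i x) \<longlonglongrightarrow> f x" using lim.hyps(2) by simp
    show "AE x in lborel. norm (s i x) \<le> 2 * norm (f x)" for i using lim.hyps(3) by simp
  qed auto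
  then have "\<forall>\<^sub>F i in sequentially. (\<integral>\<^sup>+x. norm (f x - s i x) \<partial>lborel) < ennreal (e/4)"
    using lim.prems by (intro order_tendstoD(2)) auto
  then obtain i where i: "(\<integral>\<^sup>+x. norm (f x - s i x) \<partial>lborel) < ennreal (e/4)"
    by (auto simp: eventually_sequentially)
  obtain d where d: "d > 0" "\<And>w. norm w < d \<Longrightarrow> translation_gap (s i) w \<le> ennreal (e/2)"
    using lim.IH[of "e/2" i] lim.prems by auto
  have "translation_gap f w \<le> ennreal e" if "norm w < d" for w
  proof -
    have "translation_gap f w = translation_gap (\<lambda>x. s i x + (f x - s i x)) w" by simp
    also have "\<dots> \<le> translation_gap (s i) w + translation_gap (\<lambda>x. f x - s i x) w"
      by (rule translation_gap_add) auto
    also have "\<dots> \<le> ennreal (e/2) + 2 * (\<integral>\<^sup>+x. norm (f x - s i x) \<partial>lborel)"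
      using d(2)[OF that] translation_gap_le_norm[of "\<lambda>x. f x - s i x" w]
      by (intro add_mono) simp_all
    also have "\<dots> \<le> ennreal (e/2) + 2 * ennreal (e/4)"
      using less_imp_le[OF i] by (intro add_left_mono mult_left_mono) simp_all
    also have "2 * ennreal (e/4) = ennreal (e/2)"
      using ennreal_mult'[of 2 "e/4"] by simp
    also have "ennreal (e/2) + ennreal (e/2) = ennreal e"
      using lim.prems ennreal_plus[of "e/2" "e/2"] by simp
    finally show ?thesis .
  qed
  then show ?case using d(1) by blast
qed

section \<open>Mollification\<close>

text \<open>Smoothness is required of all reflected translates as well, because \<open>z \<mapsto> \<rho> (y - z)\<close> is what serves
  as a test function.\<close>

definition mollifier :: "real \<Rightarrow> ('a::euclidean_space \<Rightarrow> real) \<Rightarrow> bool" where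
  "mollifier r \<rho> \<longleftrightarrow> (\<forall>k y. Ck k (\<lambda>z. \<rho> (y - z))) \<and> (\<forall>k. Ck k \<rho>) \<and>
     (\<forall>w. 0 \<le> \<rho> w) \<and> (\<forall>w. r \<le> norm w \<longrightarrow> \<rho> w = 0) \<and> (LINT w|lborel. \<rho> w) = 1"

lemma integrable_continuous_bounded_support:
  fixes f :: "'a::euclidean_space \<Rightarrow> real"
  assumes "continuous_on UNIV f" "\<And>x. r \<le> norm x \<Longrightarrow> f x = 0"
  shows "integrable lborel f"
proof -
  have "integrable lborel (\<lambda>x. indicator (cball 0 r) x *\<^sub>R f x)"
    using assms(1) by (intro borel_integrable_compact) (auto intro: continuous_on_subset)
  moreover have "(\<lambda>x. indicator (cball 0 r) x *\<^sub>R f x) = f"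
    using assms(2) by (force simp: indicator_def)
  ultimately show ?thesis by simp
qed

lemma mollifier_exists:
  assumes r: "0 < r"
  shows "\<exists>\<rho> :: 'a::euclidean_space \<Rightarrow> real. mollifier r \<rho>"
proof -
  define f where "f w = flat_power 0 (r\<^sup>2 - (norm w)\<^sup>2)" for w :: 'a
  define c where "c = (LINT w|lborel. f w)"
  have zero: "f w = 0" if "r \<le> norm w" for w
    using power_mono[OF that, of 2] r by (simp add: f_def flat_power.simps not_less)
  have pos: "0 < f w" if "norm w < r" for w
    using power_strict_mono[OF that, of 2] by (simp add: f_def flat_power.simps)
  have nonneg: "0 \<le> f w" for w by (simp add: f_def flat_power.simps)
  have alg0: "bump_algebra 0 r f"
    using bump_algebra.flat[of 0 r 0] by (simp add: f_def[abs_def])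
  have algy: "bump_algebra y r (\<lambda>z. f (y - z))" for y
    using bump_algebra.flat[of y r 0] by (simp add: f_def norm_minus_commute)
  have cont: "continuous_on UNIV f" using Ck_bump_algebra[OF alg0, of 0] by simp
  have int: "integrable lborel f"
    by (rule integrable_continuous_bounded_support[OF cont zero])
  have "c \<noteq> 0"
  proof
    assume "c = 0"
    then have "AE w in lborel. f w = 0"
      using int nonneg integral_nonneg_eq_0_iff_AE[of lborel f] by (simp add: c_def)
    then obtain N where N: "{w. f w \<noteq> 0} \<subseteq> N" "N \<in> null_sets lborel"
      by (auto simp: eventually_ae_filter)
    have "ball 0 r \<subseteq> N" using pos N(1) by force
    then have "emeasure lborel (ball (0::'a) r) = 0"
      using N(2) emeasure_mono[of "ball 0 r" N lborel] by (simp add: null_sets_def)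
    then show False using r unit_ball_vol_pos[of "DIM('a)"] by (simp add: emeasure_ball)
  qed
  moreover have "0 \<le> c" unfolding c_def by (intro integral_nonneg_AE) (use nonneg in simp)
  ultimately have c: "0 < c" by simp
  have "mollifier r (\<lambda>w. f w * (1 / c))"
    unfolding mollifier_def
  proof (intro conjI allI impI)
    show "Ck k (\<lambda>z. f (y - z) * (1 / c))" for k y
      by (rule Ck_bump_algebra[OF bump_algebra.mult[OF algy bump_algebra.const]])
    show "Ck k (\<lambda>w. f w * (1 / c))" for k
      by (rule Ck_bump_algebra[OF bump_algebra.mult[OF alg0 bump_algebra.const]])
    show "(LINT w|lborel. f w * (1 / c)) = 1" using c by (simp add: c_def)
  qed (use zero nonneg c in auto)
  then show ?thesis by blast
qed

lemma Ck_all_orders: "\<forall>k. Ck k f \<Longrightarrow> Ck 1 f" "\<forall>k. Ck k f \<Longrightarrow> Ck 2 f" "\<forall>k. Ck k f \<Longrightarrow> continuous_on UNIV f"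
  using Ck.simps(1) by blast+

lemma integrable_mult_bounded:
  fixes f g :: "'a \<Rightarrow> real"
  assumes "integrable M f" "g \<in> borel_measurable M" "AE x in M. \<bar>g x\<bar> \<le> B"
  shows "integrable M (\<lambda>x. f x * g x)"
proof (rule Bochner_Integration.integrable_bound)
  show "integrable M (\<lambda>x. B * f x)" using assms by simp
  show "AE x in M. norm (f x * g x) \<le> norm (B * f x)"
    using assms(3)
  proof eventually_elim
    case (elim x)
    then have "\<bar>f x\<bar> * \<bar>g x\<bar> \<le> \<bar>f x\<bar> * \<bar>B\<bar>" by (intro mult_left_mono) auto
    then show ?case by (simp add: abs_mult mult.commute)
  qed
qed (use assms in auto)

definition mollify :: "('a::euclidean_space \<Rightarrow> real) \<Rightarrow> ('a \<Rightarrow> real) \<Rightarrow> 'a \<Rightarrow> real" where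
  "mollify \<rho> f y = (LINT z|lborel. f z * \<rho> (y - z))"

lemma mollifierD:
  assumes "mollifier r \<rho>"
  shows mollifier_smooth: "Ck k \<rho>" and mollifier_reflect_smooth: "Ck k (\<lambda>z. \<rho> (y - z))"
    and mollifier_nonneg: "0 \<le> \<rho> w" and mollifier_zero: "r \<le> norm w \<Longrightarrow> \<rho> w = 0"
    and mollifier_integral: "(LINT w|lborel. \<rho> w) = 1"
    and mollifier_continuous: "continuous_on A \<rho>"
    and mollifier_integrable: "integrable lborel \<rho>"
    and mollifier_support: "closure {w. \<rho> w \<noteq> 0} \<subseteq> cball 0 r"
    and mollifier_compact_support: "compact (closure {w. \<rho> w \<noteq> 0})"
proof -
  show "Ck k \<rho>" "Ck k (\<lambda>z. \<rho> (y - z))" "0 \<le> \<rho> w" "r \<le> norm w \<Longrightarrow> \<rho> w = 0"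
    "(LINT w|lborel. \<rho> w) = 1"
    using assms by (auto simp: mollifier_def)
  have cont: "continuous_on UNIV \<rho>" using assms by (simp add: mollifier_def Ck_all_orders(3))
  then show "continuous_on A \<rho>" using continuous_on_subset by blast
  show "integrable lborel \<rho>"
    by (rule integrable_continuous_bounded_support[OF cont, of r]) (use assms in \<open>auto simp: mollifier_def\<close>)
  have "{w. \<rho> w \<noteq> 0} \<subseteq> cball 0 r" using assms by (force simp: mollifier_def)
  then show *: "closure {w. \<rho> w \<noteq> 0} \<subseteq> cball 0 r" by (simp add: closure_minimal)
  then have "bounded (closure {w. \<rho> w \<noteq> 0})" using bounded_cball bounded_subset by blast
  then show "compact (closure {w. \<rho> w \<noteq> 0})" by (simp only: compact_eq_bounded_closed closed_closure)
qed

lemma frechet_derivative_reflect: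
  assumes "Ck 1 \<rho>"
  shows "frechet_derivative (\<lambda>z. \<rho> (y - z)) (at z) i = - frechet_derivative \<rho> (at (y - z)) i"
proof -
  have d: "(\<rho> has_derivative frechet_derivative \<rho> (at (y - z))) (at (y - z))"
    using assms by (simp add: frechet_derivative_works)
  have "((\<lambda>z. y - z) has_derivative (\<lambda>h. - h)) (at z)"
    by (auto intro!: derivative_eq_intros)
  from has_derivative_compose[OF this d]
  have "frechet_derivative (\<lambda>z. \<rho> (y - z)) (at z) = (\<lambda>h. frechet_derivative \<rho> (at (y - z)) (- h))"
    using frechet_derivative_at by metis
  then show ?thesis using has_derivative_linear[OF d] by (simp add: linear_neg)
qed

context
  fixes r :: real and \<rho> f :: "'a::euclidean_space \<Rightarrow> real"
  assumes mol: "mollifier r \<rho>" and f: "integrable lborel f"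
begin

lemma measurable_mollifier [measurable]: "\<rho> \<in> borel_measurable borel"
  using mollifier_continuous[OF mol] by (rule borel_measurable_continuous_onI)

lemma measurable_partial_mollifier:
  assumes "i \<in> Basis" 
  shows "(\<lambda>z. frechet_derivative \<rho> (at z) i) \<in> borel_measurable borel"
  using mollifier_smooth[OF mol, of 1] assms by (intro borel_measurable_continuous_onI) auto

lemma integrable_mollify_integrand: "integrable lborel (\<lambda>z. f z * \<rho> (y - z))"
proof -
  obtain B where "\<And>x. \<bar>\<rho> x\<bar> \<le> B"
    using Ck_compact_support_bounds[OF mollifier_smooth[OF mol] mollifier_compact_support[OF mol]] by metis
  then show ?thesis by (intro integrable_mult_bounded[OF f]) auto
qed

text \<open>Differentiation under the integral sign, with the quadratic remainder of \<open>\<rho>\<close> integrated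
  against \<open>\<bar>f\<bar>\<close>.\<close>

lemma has_derivative_mollify:
  "(mollify \<rho> f has_derivative
    (\<lambda>h. \<Sum>i\<in>Basis. (h \<bullet> i) * (LINT z|lborel. f z * frechet_derivative \<rho> (at (y - z)) i))) (at y)"
proof -
  define D where "D x = frechet_derivative \<rho> (at x)" for x
  obtain M where M: "0 \<le> M" "\<And>x h. \<bar>\<rho> (x + h) - \<rho> x - D x h\<bar> \<le> M * (norm h)\<^sup>2"
    using Ck_quadratic_remainder[OF mollifier_smooth[OF mol] mollifier_compact_support[OF mol]]
    unfolding D_def by metis
  obtain B where B: "\<And>x i. i \<in> Basis \<Longrightarrow> \<bar>D x i\<bar> \<le> B"
    using Ck_compact_support_bounds[OF mollifier_smooth[OF mol] mollifier_compact_support[OF mol]]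
    unfolding D_def by metis
  have int: "integrable lborel (\<lambda>z. f z * D (y - z) i)" if "i \<in> Basis" for i
    using B[OF that] measurable_partial_mollifier[OF that]
    by (intro integrable_mult_bounded[OF f]) (auto simp: D_def)
  show ?thesis
    unfolding D_def[symmetric]
  proof (rule has_derivative_quadratic_remainder[where M = "M * (LINT z|lborel. \<bar>f z\<bar>)"])
    show "bounded_linear (\<lambda>h. \<Sum>i\<in>Basis. (h \<bullet> i) * (LINT z|lborel. f z * D (y - z) i))"
      by (intro bounded_linear_sum bounded_linear_mult_const bounded_linear_inner_left)
    fix h
    have lin: "linear (D x)" for x
      using mollifier_smooth[OF mol, of 1]
      by (auto simp: D_def intro!: linear_frechet_derivative)
    have Dh: "D x h = (\<Sum>i\<in>Basis. (h \<bullet> i) * D x i)" for x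
      by (rule linear_functional_expand[OF lin])
    have fD: "f z * D (y - z) h = (\<Sum>i\<in>Basis. (h \<bullet> i) * (f z * D (y - z) i))" for z
      by (simp add: Dh sum_distrib_left mult.left_commute)
    have iD: "integrable lborel (\<lambda>z. f z * D (y - z) h)"
      unfolding fD using int by (intro Bochner_Integration.integrable_sum) auto
    have "(\<Sum>i\<in>Basis. (h \<bullet> i) * (LINT z|lborel. f z * D (y - z) i)) = (LINT z|lborel. f z * D (y - z) h)"
      unfolding fD using int by (subst Bochner_Integration.integral_sum) auto
    then have "mollify \<rho> f (y + h) - mollify \<rho> f y
        - (\<Sum>i\<in>Basis. (h \<bullet> i) * (LINT z|lborel. f z * D (y - z) i)) =
        (LINT z|lborel. f z * \<rho> (y + h - z) - f z * \<rho> (y - z) - f z * D (y - z) h)"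
      using iD integrable_mollify_integrand by (simp add: mollify_def)
    also have "\<bar>\<dots>\<bar> \<le> (LINT z|lborel. \<bar>f z\<bar> * (M * (norm h)\<^sup>2))"
    proof (rule integral_abs_bound_integral)
      show "integrable lborel (\<lambda>z. f z * \<rho> (y + h - z) - f z * \<rho> (y - z) - f z * D (y - z) h)"
        using iD integrable_mollify_integrand by simp
      fix z
      have "f z * \<rho> (y + h - z) - f z * \<rho> (y - z) - f z * D (y - z) h
          = f z * (\<rho> ((y - z) + h) - \<rho> (y - z) - D (y - z) h)"
        by (simp add: algebra_simps)
      then show "\<bar>f z * \<rho> (y + h - z) - f z * \<rho> (y - z) - f z * D (y - z) h\<bar> \<le> \<bar>f z\<bar> * (M * (norm h)\<^sup>2)"
        using M(2)[of "y - z" h] by (simp add: abs_mult mult_left_mono)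
    qed (use f in auto)
    also have "\<dots> = M * (LINT z|lborel. \<bar>f z\<bar>) * (norm h)\<^sup>2" by simp
    finally show "\<bar>mollify \<rho> f (y + h) - mollify \<rho> f y
        - (\<Sum>i\<in>Basis. (h \<bullet> i) * (LINT z|lborel. f z * D (y - z) i))\<bar>
        \<le> M * (LINT z|lborel. \<bar>f z\<bar>) * (norm h)\<^sup>2" .
  qed
qed

lemma continuous_mollify: "continuous_on UNIV (mollify \<rho> f)"
  using has_derivative_mollify by (auto simp: continuous_on_eq_continuous_at intro: has_derivative_continuous)

lemma mollify_lipschitz_bounded:
  obtains C where "0 \<le> C" "C-lipschitz_on UNIV (mollify \<rho> f)" "\<And>y. \<bar>mollify \<rho> f y\<bar> \<le> C"
proof -
  obtain B where B: "0 \<le> B" "\<And>x. \<bar>\<rho> x\<bar> \<le> B" "B-lipschitz_on UNIV \<rho>"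
    using Ck_compact_support_bounds[OF mollifier_smooth[OF mol] mollifier_compact_support[OF mol]] by metis
  define C where "C = B * (LINT z|lborel. \<bar>f z\<bar>)"
  have C: "0 \<le> C" using B(1) by (simp add: C_def integral_nonneg_AE)
  show thesis
  proof
    show "0 \<le> C" by fact
    show "C-lipschitz_on UNIV (mollify \<rho> f)"
      unfolding lipschitz_on_def
    proof (intro conjI C ballI)
      fix x y
      have "\<bar>mollify \<rho> f x - mollify \<rho> f y\<bar> = \<bar>LINT z|lborel. f z * \<rho> (x - z) - f z * \<rho> (y - z)\<bar>"
        using integrable_mollify_integrand by (simp add: mollify_def)
      also have "\<dots> \<le> (LINT z|lborel. \<bar>f z\<bar> * (B * dist x y))"
      proof (rule integral_abs_bound_integral)
        fix z
        have "\<bar>\<rho> (x - z) - \<rho> (y - z)\<bar> \<le> B * dist x y"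
          using lipschitz_onD[OF B(3), of "x - z" "y - z"] by (simp add: dist_norm)
        then show "\<bar>f z * \<rho> (x - z) - f z * \<rho> (y - z)\<bar> \<le> \<bar>f z\<bar> * (B * dist x y)"
          by (simp add: right_diff_distrib[symmetric] abs_mult mult_left_mono)
      qed (use f integrable_mollify_integrand in auto)
      finally show "dist (mollify \<rho> f x) (mollify \<rho> f y) \<le> C * dist x y"
        by (simp add: dist_real_def C_def mult_ac)
    qed
    fix y
    have "\<bar>mollify \<rho> f y\<bar> \<le> (LINT z|lborel. \<bar>f z\<bar> * B)"
      unfolding mollify_def
      by (rule integral_abs_bound_integral)
        (use f integrable_mollify_integrand B(2) in \<open>auto simp: abs_mult intro: mult_left_mono\<close>)
    then show "\<bar>mollify \<rho> f y\<bar> \<le> C" by (simp add: C_def mult.commute)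
  qed
qed

text \<open>The mollification is an average of translates \<open>f (y - w)\<close> with \<open>norm w < r\<close>.  By Fubini its
  distance to \<open>f\<close> in \<open>L\<^sup>1\<close> is at most the same average of the translation gaps.\<close>

lemma mollify_L1_error:
  assumes gap: "\<And>w. norm w < r \<Longrightarrow> translation_gap f w \<le> ennreal e" and e: "0 \<le> e"
  shows "(\<integral>\<^sup>+y. ennreal \<bar>mollify \<rho> f y - f y\<bar> \<partial>lborel) \<le> ennreal e"
proof -
  have [measurable]: "f \<in> borel_measurable borel" using f by auto
  have "(\<integral>\<^sup>+y. ennreal \<bar>mollify \<rho> f y - f y\<bar> \<partial>lborel)
      \<le> (\<integral>\<^sup>+y. (\<integral>\<^sup>+w. ennreal (\<rho> w) * ennreal \<bar>f (y - w) - f y\<bar> \<partial>lborel) \<partial>lborel)"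
  proof (rule nn_integral_mono)
    fix y
    have i1: "integrable lborel (\<lambda>w. f (y - w) * \<rho> w)"
      using integrable_reflect[OF integrable_mollify_integrand[of y], of y] by simp
    have mr: "mollify \<rho> f y = (LINT w|lborel. f (y - w) * \<rho> w)"
      unfolding mollify_def
      using integral_reflect[of "\<lambda>z. f z * \<rho> (y - z)" y] by simp
    have "mollify \<rho> f y - f y = (LINT w|lborel. f (y - w) * \<rho> w) - (LINT w|lborel. f y * \<rho> w)"
      using mollifier_integral[OF mol] mr by simp
    also have "\<dots> = (LINT w|lborel. \<rho> w * (f (y - w) - f y))"
      using i1 mollifier_integrable[OF mol]
      by (subst Bochner_Integration.integral_diff[symmetric]) (auto simp: algebra_simps)
    finally have eq: "mollify \<rho> f y - f y = (LINT w|lborel. \<rho> w * (f (y - w) - f y))" .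
    have i2: "integrable lborel (\<lambda>w. \<rho> w * (f (y - w) - f y))"
      using i1 mollifier_integrable[OF mol] by (simp add: right_diff_distrib mult.commute)
    have "ennreal \<bar>mollify \<rho> f y - f y\<bar> \<le> (\<integral>\<^sup>+w. ennreal (norm (\<rho> w * (f (y - w) - f y))) \<partial>lborel)"
      using integral_norm_bound_ennreal[OF i2] eq by simp
    then show "ennreal \<bar>mollify \<rho> f y - f y\<bar>
        \<le> (\<integral>\<^sup>+w. ennreal (\<rho> w) * ennreal \<bar>f (y - w) - f y\<bar> \<partial>lborel)"
      using mollifier_nonneg[OF mol] by (simp add: abs_mult ennreal_mult')
  qed
  also have "\<dots> = (\<integral>\<^sup>+w. (\<integral>\<^sup>+y. ennreal (\<rho> w) * ennreal \<bar>f (y - w) - f y\<bar> \<partial>lborel) \<partial>lborel)"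
    by (rule lborel_pair.Fubini') measurable
  also have "\<dots> = (\<integral>\<^sup>+w. ennreal (\<rho> w) * translation_gap f w \<partial>lborel)"
    unfolding translation_gap_def by (intro nn_integral_cong nn_integral_cmult) measurable
  also have "\<dots> \<le> (\<integral>\<^sup>+w. ennreal (\<rho> w) * ennreal e \<partial>lborel)"
  proof (rule nn_integral_mono)
    fix w
    show "ennreal (\<rho> w) * translation_gap f w \<le> ennreal (\<rho> w) * ennreal e"
      using gap[of w] mollifier_zero[OF mol, of w] by (cases "norm w < r") (auto intro: mult_left_mono)
  qed
  also have "\<dots> = (\<integral>\<^sup>+w. ennreal (\<rho> w) \<partial>lborel) * ennreal e" by (rule nn_integral_multc) measurable
  also have "(\<integral>\<^sup>+w. ennreal (\<rho> w) \<partial>lborel) = 1"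
    using nn_integral_eq_integral[OF mollifier_integrable[OF mol]] mollifier_nonneg[OF mol]
      mollifier_integral[OF mol] by simp
  finally show ?thesis by simp
qed

lemma integrable_mollify: "integrable lborel (mollify \<rho> f)"
proof -
  have [measurable]: "f \<in> borel_measurable borel" using f by auto
  have m: "mollify \<rho> f \<in> borel_measurable borel"
    by (rule borel_measurable_continuous_onI[OF continuous_mollify])
  define e where "e = 2 * (LINT x|lborel. \<bar>f x\<bar>)"
  have e: "0 \<le> e" by (simp add: e_def integral_nonneg_AE)
  have "translation_gap f w \<le> ennreal e" for w
    using translation_gap_le_norm[of f w] nn_integral_eq_integral[of lborel "\<lambda>x. \<bar>f x\<bar>"] f
    by (simp add: e_def ennreal_mult')
  then have "(\<integral>\<^sup>+y. ennreal \<bar>mollify \<rho> f y - f y\<bar> \<partial>lborel) \<le> ennreal e"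
    using mollify_L1_error e by blast
  then have "integrable lborel (\<lambda>y. mollify \<rho> f y - f y)"
    using m by (intro integrableI_bounded) (auto intro: order_le_less_trans)
  from Bochner_Integration.integrable_add[OF this f] show ?thesis by simp
qed

end

lemma mollify_tendsto_L1:
  fixes f :: "'a::euclidean_space \<Rightarrow> real"
  assumes f: "integrable lborel f" and mol: "\<And>n. mollifier (r n) (\<rho> n)" and r: "r \<longlonglongrightarrow> 0"
  shows "(\<lambda>n. \<integral>\<^sup>+y. ennreal \<bar>mollify (\<rho> n) f y - f y\<bar> \<partial>lborel) \<longlonglongrightarrow> 0"
proof (rule tendsto_zero_ennreal)
  fix e :: real assume "0 < e"
  then obtain d where d: "d > 0" "\<And>w. norm w < d \<Longrightarrow> translation_gap f w \<le> ennreal (e/2)"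
    using translation_gap_tendsto_0[OF f, of "e/2"] by auto
  have "\<forall>\<^sub>F n in sequentially. r n < d" using r d(1) by (rule order_tendstoD(2))
  then show "\<forall>\<^sub>F n in sequentially. (\<integral>\<^sup>+y. ennreal \<bar>mollify (\<rho> n) f y - f y\<bar> \<partial>lborel) < ennreal e"
  proof eventually_elim
    case (elim n)
    have "(\<integral>\<^sup>+y. ennreal \<bar>mollify (\<rho> n) f y - f y\<bar> \<partial>lborel) \<le> ennreal (e/2)"
      using d elim \<open>0 < e\<close> by (intro mollify_L1_error[OF mol[of n] f]) auto
    also have "\<dots> < ennreal e" using \<open>0 < e\<close> by (intro ennreal_lessI) auto
    finally show ?case .
  qed
qed

section \<open>The chain rule for weak gradients\<close>

lemma directional_derivative_LIMSEQ:
  fixes f :: "'a::real_normed_vector \<Rightarrow> 'b::real_normed_vector"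
  assumes f: "(f has_derivative f') (at x)"
  shows "(\<lambda>n. real (Suc n) *\<^sub>R (f (x + (1 / real (Suc n)) *\<^sub>R e) - f x)) \<longlonglongrightarrow> f' e"
proof -
  define g where "g t = f (x + t *\<^sub>R e)" for t :: real
  have lin: "linear f'" using f has_derivative_linear by blast
  have "((\<lambda>t::real. x + t *\<^sub>R e) has_derivative (\<lambda>t. t *\<^sub>R e)) (at 0)"
    by (auto intro!: derivative_eq_intros)
  then have "(g has_derivative (\<lambda>t. f' (t *\<^sub>R e))) (at 0)"
    unfolding g_def using f
      has_derivative_compose[of "\<lambda>t::real. x + t *\<^sub>R e" "\<lambda>t. t *\<^sub>R e" 0 UNIV f f'] by simp
  then have lim: "((\<lambda>t. norm (g (0 + t) - g 0 - f' (t *\<^sub>R e)) / norm t) \<longlongrightarrow> 0) (at 0)"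
    unfolding has_derivative_at by blast
  have "filterlim (\<lambda>n. 1 / real (Suc n)) (at 0) sequentially"
    using LIMSEQ_inverse_real_of_nat by (auto simp: filterlim_at inverse_eq_divide)
  from filterlim_compose[OF lim this]
  have "(\<lambda>n. norm (g (1 / real (Suc n)) - g 0 - f' ((1 / real (Suc n)) *\<^sub>R e)) / norm (1 / real (Suc n))) \<longlonglongrightarrow> 0"
    by simp
  also have "(\<lambda>n. norm (g (1 / real (Suc n)) - g 0 - f' ((1 / real (Suc n)) *\<^sub>R e)) / norm (1 / real (Suc n)))
     = (\<lambda>n. norm (real (Suc n) *\<^sub>R (g (1 / real (Suc n)) - g 0) - f' e))"
  proof
    fix n
    define c where "c = real (Suc n)"
    have c: "0 < c" by (simp add: c_def)
    have "f' ((1 / c) *\<^sub>R e) = (1 / c) *\<^sub>R f' e" using lin by (simp add: linear_cmul)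
    then have "c *\<^sub>R (g (1 / c) - g 0) - f' e = c *\<^sub>R (g (1 / c) - g 0 - f' ((1 / c) *\<^sub>R e))"
      using c by (simp add: scaleR_diff_right)
    then have "norm (c *\<^sub>R (g (1 / c) - g 0) - f' e) = c * norm (g (1 / c) - g 0 - f' ((1 / c) *\<^sub>R e))"
      using c by simp
    then show "norm (g (1 / real (Suc n)) - g 0 - f' ((1 / real (Suc n)) *\<^sub>R e)) / norm (1 / real (Suc n))
      = norm (real (Suc n) *\<^sub>R (g (1 / real (Suc n)) - g 0) - f' e)"
      unfolding c_def[symmetric] using c by simp
  qed
  finally have "(\<lambda>n. real (Suc n) *\<^sub>R (g (1 / real (Suc n)) - g 0) - f' e) \<longlonglongrightarrow> 0"
    by (rule tendsto_norm_zero_cancel)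
  then have "(\<lambda>n. real (Suc n) *\<^sub>R (g (1 / real (Suc n)) - g 0)) \<longlonglongrightarrow> f' e"
    by (rule LIM_zero_cancel)
  then show ?thesis by (simp only: g_def scaleR_zero_left add_0_right)
qed

text \<open>Translation invariance gives the difference quotients integral zero; the Lipschitz bound and the
  bounded support dominate them, so the almost everywhere limit has integral zero as well.\<close>

lemma integral_directional_derivative_eq_0:
  fixes f :: "'a::euclidean_space \<Rightarrow> real"
  assumes lip: "C-lipschitz_on UNIV f" and supp: "\<And>x. R \<le> norm x \<Longrightarrow> f x = 0"
    and D: "AE x in lborel. (\<lambda>n. real (Suc n) * (f (x + (1 / real (Suc n)) *\<^sub>R e) - f x)) \<longlonglongrightarrow> D x"
    and [measurable]: "D \<in> borel_measurable borel"
  shows "(LINT x|lborel. D x) = 0"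
proof -
  define s where "s n x = real (Suc n) * (f (x + (1 / real (Suc n)) *\<^sub>R e) - f x)" for n x
  have cont: "continuous_on UNIV f" using lip by (rule lipschitz_on_continuous_on)
  have [measurable]: "f \<in> borel_measurable borel" using cont by (rule borel_measurable_continuous_onI)
  have int: "integrable lborel f" by (rule integrable_continuous_bounded_support[OF cont supp])
  have zero: "(LINT x|lborel. s n x) = 0" for n
  proof -
    have "(LINT x|lborel. f (x + (1 / real (Suc n)) *\<^sub>R e)) = (LINT x|lborel. f x)"
      using integral_translate[of f "- ((1 / real (Suc n)) *\<^sub>R e)"] by simp
    moreover have "integrable lborel (\<lambda>x. f (x + (1 / real (Suc n)) *\<^sub>R e))"
      using integrable_translate[OF int, of "- ((1 / real (Suc n)) *\<^sub>R e)"] by simp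
    ultimately show ?thesis using int by (simp add: s_def del: of_nat_Suc)
  qed
  have bound: "\<bar>s n x\<bar> \<le> C * norm e * indicator (cball 0 (R + norm e)) x" for n x
  proof (cases "x \<in> cball 0 (R + norm e)")
    case True
    have "\<bar>f (x + (1 / real (Suc n)) *\<^sub>R e) - f x\<bar> \<le> C * (norm e / real (Suc n))"
      using lipschitz_on_normD[OF lip, of "x + (1 / real (Suc n)) *\<^sub>R e" x] by (simp del: of_nat_Suc)
    then have "\<bar>s n x\<bar> \<le> real (Suc n) * (C * (norm e / real (Suc n)))"
      unfolding s_def abs_mult by (intro mult_mono) auto
    then show ?thesis using True by (simp del: of_nat_Suc)
  next
    case False
    have "norm ((1 / real (Suc n)) *\<^sub>R e) \<le> norm e"
      by (simp add: divide_le_eq mult_le_cancel_left1 del: of_nat_Suc)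
    moreover have "norm x \<le> norm (x + (1 / real (Suc n)) *\<^sub>R e) + norm ((1 / real (Suc n)) *\<^sub>R e)"
      using norm_triangle_ineq4[of "x + (1 / real (Suc n)) *\<^sub>R e" "(1 / real (Suc n)) *\<^sub>R e"] by simp
    ultimately have "R \<le> norm (x + (1 / real (Suc n)) *\<^sub>R e)" "R \<le> norm x" using False norm_ge_zero[of e]
      by (auto simp del: norm_ge_zero)
    then show ?thesis using supp False by (simp add: s_def)
  qed
  have "(\<lambda>n. LINT x|lborel. s n x) \<longlonglongrightarrow> (LINT x|lborel. D x)"
  proof (rule integral_dominated_convergence)
    show "integrable lborel (\<lambda>x. C * norm e * indicator (cball 0 (R + norm e)) x)"
      by (intro integrable_mult_right integrable_real_indicator) (simp_all add: emeasure_lborel_cball_finite[simplified])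
    show "AE x in lborel. (\<lambda>n. s n x) \<longlonglongrightarrow> D x" using D by (simp add: s_def)
    show "AE x in lborel. norm (s n x) \<le> C * norm e * indicator (cball 0 (R + norm e)) x" for n
      using bound by simp
  qed (auto simp: s_def[abs_def])
  then have "(\<lambda>n. 0) \<longlonglongrightarrow> (LINT x|lborel. D x)" unfolding zero .
  then show ?thesis by (rule LIMSEQ_unique[OF _ tendsto_const])
qed

context bilipschitz_change
begin

text \<open>Defined as the limit of a sequence of continuous functions, so that it is Borel measurable.
  It is the derivative of \<open>F\<close> in the direction \<open>i\<close> wherever \<open>F\<close> is differentiable, and arbitrary on the
  remaining null set.\<close>

definition directional_derivative :: "'a \<Rightarrow> 'a \<Rightarrow> 'a" where
  "directional_derivative i x = lim (\<lambda>n. real (Suc n) *\<^sub>R (F (x + (1 / real (Suc n)) *\<^sub>R i) - F x))"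

lemma measurable_F_borel [measurable]: "F \<in> borel_measurable borel"
  using continuous_F by (rule borel_measurable_continuous_onI)

lemma measurable_directional_derivative [measurable]: "directional_derivative i \<in> borel_measurable borel"
  unfolding directional_derivative_def[abs_def] by measurable

lemma directional_derivative_F:
  assumes "F differentiable (at x)"
  shows "(\<lambda>n. real (Suc n) *\<^sub>R (F (x + (1 / real (Suc n)) *\<^sub>R i) - F x)) \<longlonglongrightarrow> directional_derivative i x"
    "directional_derivative i x = frechet_derivative F (at x) i"
  using directional_derivative_LIMSEQ[OF assms[unfolded frechet_derivative_works], of i]
  by (auto simp: directional_derivative_def limI)

lemma norm_directional_derivative_le:
  assumes "F differentiable (at x)"
  shows "norm (directional_derivative i x) \<le> L * norm i"
proof (rule LIMSEQ_le_const2[OF tendsto_norm[OF directional_derivative_F(1)[OF assms]]])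
  have "norm (real (Suc n) *\<^sub>R (F (x + (1 / real (Suc n)) *\<^sub>R i) - F x)) \<le> L * norm i" for n
  proof -
    have "norm (F (x + (1 / real (Suc n)) *\<^sub>R i) - F x) \<le> L * (norm i / real (Suc n))"
      using lipschitz_on_normD[OF lipschitz_F, of "x + (1 / real (Suc n)) *\<^sub>R i" x] by (simp del: of_nat_Suc)
    then have "real (Suc n) * norm (F (x + (1 / real (Suc n)) *\<^sub>R i) - F x)
        \<le> real (Suc n) * (L * (norm i / real (Suc n)))" by (intro mult_left_mono) auto
    then show ?thesis by (simp del: of_nat_Suc)
  qed
  then show "\<exists>N. \<forall>n\<ge>N. norm (real (Suc n) *\<^sub>R (F (x + (1 / real (Suc n)) *\<^sub>R i) - F x)) \<le> L * norm i"
    by blast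
qed

lemma AE_differentiable_F: "AE x in lborel. F differentiable (at x)"
proof -
  have "AE x in lebesgue. F differentiable (at x)"
    using differentiable_F by (intro AE_I'[of "{x. \<not> F differentiable (at x)}"]) (auto simp: negligible_iff_null_sets)
  then show ?thesis by (simp only: AE_completion_iff)
qed

lemma nn_integral_lborel_pullback_le:
  fixes f :: "'a \<Rightarrow> ennreal"
  assumes "f \<in> borel_measurable borel"
  shows "(\<integral>\<^sup>+x. f (F x) \<partial>lborel) \<le> ennreal (L ^ DIM('a)) * (\<integral>\<^sup>+y. f y \<partial>lborel)"
proof -
  have "f \<in> borel_measurable (lebesgue_on UNIV)"
    using assms by (simp add: lebesgue_on_UNIV_eq measurable_completion)
  from nn_integral_lebesgue_pullback_le[OF _ this] show ?thesis
    by (simp add: lebesgue_on_UNIV_eq nn_integral_completion)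
qed

lemma integrable_F:
  fixes f :: "'a \<Rightarrow> real"
  assumes "integrable lborel f"
  shows "integrable lborel (\<lambda>x. f (F x))"
proof (rule integrableI_bounded)
  have [measurable]: "f \<in> borel_measurable borel" using assms by auto
  show "(\<lambda>x. f (F x)) \<in> borel_measurable lborel" by measurable
  have "(\<integral>\<^sup>+x. ennreal (norm (f (F x))) \<partial>lborel) \<le> ennreal (L ^ DIM('a)) * (\<integral>\<^sup>+x. ennreal (norm (f x)) \<partial>lborel)"
    by (rule nn_integral_lborel_pullback_le[where f = "\<lambda>x. ennreal (norm (f x))"]) measurable
  also have "\<dots> < \<infinity>" using assms by (auto simp: integrable_iff_bounded ennreal_mult_less_top)
  finally show "(\<integral>\<^sup>+x. ennreal (norm (f (F x))) \<partial>lborel) < \<infinity>" .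
qed

text \<open>Convergence in \<open>L\<^sup>1\<close> is preserved by composition with \<open>F\<close>, which increases \<open>L\<^sup>1\<close> norms by at
  most a constant factor.\<close>

lemma tendsto_integral_pullback:
  fixes h :: "nat \<Rightarrow> 'a \<Rightarrow> real"
  assumes hn: "\<And>n. integrable lborel (h n)" and h': "integrable lborel h'"
    and lim: "(\<lambda>n. \<integral>\<^sup>+y. ennreal \<bar>h n y - h' y\<bar> \<partial>lborel) \<longlonglongrightarrow> 0"
    and [measurable]: "q \<in> borel_measurable borel" and q: "AE x in lborel. \<bar>q x\<bar> \<le> B" and B: "0 \<le> B"
  shows "(\<lambda>n. LINT x|lborel. h n (F x) * q x) \<longlonglongrightarrow> (LINT x|lborel. h' (F x) * q x)"
proof -
  have [measurable]: "h n \<in> borel_measurable borel" "h' \<in> borel_measurable borel" for n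
    using hn h' by auto
  define a where "a n = (LINT x|lborel. h n (F x) * q x)" for n
  define a' where "a' = (LINT x|lborel. h' (F x) * q x)"
  define c where "c = ennreal B * ennreal (L ^ DIM('a))"
  have le: "ennreal \<bar>a n - a'\<bar> \<le> c * (\<integral>\<^sup>+y. ennreal \<bar>h n y - h' y\<bar> \<partial>lborel)" for n
  proof -
    have i: "integrable lborel (\<lambda>x. h n (F x) * q x)" "integrable lborel (\<lambda>x. h' (F x) * q x)"
      using q by (intro integrable_mult_bounded integrable_F hn h'; simp)+
    have "a n - a' = (LINT x|lborel. h n (F x) * q x - h' (F x) * q x)"
      unfolding a_def a'_def using i by simp
    also have "ennreal \<bar>\<dots>\<bar> \<le> (\<integral>\<^sup>+x. ennreal (norm (h n (F x) * q x - h' (F x) * q x)) \<partial>lborel)"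
      using integral_norm_bound_ennreal[OF Bochner_Integration.integrable_diff[OF i]] by simp
    also have "\<dots> \<le> (\<integral>\<^sup>+x. ennreal B * ennreal \<bar>h n (F x) - h' (F x)\<bar> \<partial>lborel)"
    proof (rule nn_integral_mono_AE)
      show "AE x in lborel. ennreal (norm (h n (F x) * q x - h' (F x) * q x))
          \<le> ennreal B * ennreal \<bar>h n (F x) - h' (F x)\<bar>"
        using q
      proof eventually_elim
        case (elim x)
        have "norm (h n (F x) * q x - h' (F x) * q x) = \<bar>q x\<bar> * \<bar>h n (F x) - h' (F x)\<bar>"
          by (simp only: real_norm_def abs_mult[symmetric] right_diff_distrib mult.commute[of _ "q x"])
        also have "\<dots> \<le> B * \<bar>h n (F x) - h' (F x)\<bar>" using elim by (intro mult_right_mono) auto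
        finally show ?case using B by (simp add: ennreal_mult'[symmetric] ennreal_leI)
      qed
    qed
    also have "\<dots> = ennreal B * (\<integral>\<^sup>+x. ennreal \<bar>h n (F x) - h' (F x)\<bar> \<partial>lborel)"
      by (rule nn_integral_cmult) measurable
    also have "\<dots> \<le> ennreal B * (ennreal (L ^ DIM('a)) * (\<integral>\<^sup>+y. ennreal \<bar>h n y - h' y\<bar> \<partial>lborel))"
      by (intro mult_left_mono nn_integral_lborel_pullback_le[where f = "\<lambda>y. ennreal \<bar>h n y - h' y\<bar>"]) auto
    finally show ?thesis by (simp add: c_def mult.assoc)
  qed
  have "(\<lambda>n. c * (\<integral>\<^sup>+y. ennreal \<bar>h n y - h' y\<bar> \<partial>lborel)) \<longlonglongrightarrow> c * 0"
    by (intro ennreal_tendsto_cmult lim) (simp add: c_def ennreal_mult_less_top)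
  then have "(\<lambda>n. c * (\<integral>\<^sup>+y. ennreal \<bar>h n y - h' y\<bar> \<partial>lborel)) \<longlonglongrightarrow> 0" by simp
  from tendsto_sandwich[OF always_eventually always_eventually tendsto_const this, of "\<lambda>n. ennreal \<bar>a n - a'\<bar>"]
  have "(\<lambda>n. ennreal \<bar>a n - a'\<bar>) \<longlonglongrightarrow> ennreal 0" using le by simp
  then have "(\<lambda>n. \<bar>a n - a'\<bar>) \<longlonglongrightarrow> 0" by (rule tendsto_ennrealD) simp_all
  then show ?thesis
    unfolding a_def[symmetric] a'_def[symmetric]
    by (rule LIM_zero_cancel[OF tendsto_rabs_zero_cancel])
qed

end

text \<open>The function \<open>z \<mapsto> \<rho> (y - z)\<close> is a test function on \<open>\<Omega>\<close> when the ball of radius \<open>r\<close> about \<open>y\<close> lies in \<open>\<Omega>\<close>,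
  and its derivative in \<open>z\<close> is minus the derivative of \<open>\<rho>\<close>.  So the gradient of the mollification is
  the mollification of the weak gradient at such points.\<close>

lemma mollify_weak_gradient:
  fixes u :: "'a::euclidean_space \<Rightarrow> real"
  assumes mol: "mollifier r \<rho>" and y: "cball y r \<subseteq> \<Omega>" and j: "j \<in> Basis"
    and weak: "\<And>\<phi>. test_function \<Omega> \<phi> \<Longrightarrow>
      (LINT x|lborel. u x * frechet_derivative \<phi> (at x) j) = - (LINT x|lborel. g x * \<phi> x)"
  shows "(LINT z|lborel. u z * frechet_derivative \<rho> (at (y - z)) j) = mollify \<rho> g y"
proof -
  have "{z. \<rho> (y - z) \<noteq> 0} \<subseteq> cball y r"
  proof
    fix z assume "z \<in> {z. \<rho> (y - z) \<noteq> 0}"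
    then have "\<not> r \<le> norm (y - z)" using mollifier_zero[OF mol] by blast
    then show "z \<in> cball y r" by (simp add: dist_norm)
  qed
  then have sub: "closure {z. \<rho> (y - z) \<noteq> 0} \<subseteq> cball y r" by (simp add: closure_minimal)
  then have "bounded (closure {z. \<rho> (y - z) \<noteq> 0})" using bounded_cball bounded_subset by blast
  then have "compact (closure {z. \<rho> (y - z) \<noteq> 0})" by (simp only: compact_eq_bounded_closed closed_closure)
  then have "test_function \<Omega> (\<lambda>z. \<rho> (y - z))"
    using sub y mollifier_reflect_smooth[OF mol] by (auto simp: test_function_def)
  from weak[OF this] show ?thesis
    using frechet_derivative_reflect[OF mollifier_smooth[OF mol, of 1], of y _ j]
    by (simp add: mollify_def)
qed

context bilipschitz_change
begin

lemma AE_directional_derivative_mult_bounded: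
  assumes "i \<in> Basis" "j \<in> Basis" "\<And>x. \<bar>\<psi> x\<bar> \<le> (B::real)"
  shows "AE x in lborel. \<bar>(directional_derivative i x \<bullet> j) * \<psi> x\<bar> \<le> L * B"
  using AE_differentiable_F
proof eventually_elim
  case (elim x)
  have "\<bar>directional_derivative i x \<bullet> j\<bar> \<le> L"
    using norm_directional_derivative_le[OF elim, of i] Basis_le_norm[OF assms(2), of "directional_derivative i x"] assms(1) by simp
  then show ?case
    using assms(3)[of x] L_pos unfolding abs_mult by (intro mult_mono) auto
qed

lemma integrable_pullback_directional_derivative:
  fixes h \<psi> :: "'a \<Rightarrow> real"
  assumes "integrable lborel h" "i \<in> Basis" "j \<in> Basis" "\<And>x. \<bar>\<psi> x\<bar> \<le> B"
    and [measurable]: "\<psi> \<in> borel_measurable borel"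
  shows "integrable lborel (\<lambda>x. h (F x) * ((directional_derivative i x \<bullet> j) * \<psi> x))"
  by (rule integrable_mult_bounded[OF integrable_F[OF assms(1)] _ AE_directional_derivative_mult_bounded[OF assms(2-4)]])
    measurable

text \<open>For the mollified function the weak identity is the vanishing of the integral of a partial
  derivative of the Lipschitz function \<open>(v \<circ> F) \<psi>\<close>.\<close>

lemma weak_gradient_pullback_mollified:
  fixes u :: "'a \<Rightarrow> real" and g :: "'a \<Rightarrow> 'a \<Rightarrow> real"
  assumes mol: "mollifier r \<rho>" and u: "integrable lborel u"
    and g: "\<And>j. j \<in> Basis \<Longrightarrow> integrable lborel (g j)"
    and weak: "\<And>\<phi> j. test_function \<Omega> \<phi> \<Longrightarrow> j \<in> Basis \<Longrightarrow>
      (LINT x|lborel. u x * frechet_derivative \<phi> (at x) j) = - (LINT x|lborel. g j x * \<phi> x)"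
    and \<psi>: "test_function (F -` \<Omega>) \<psi>"
    and r: "\<And>x. \<psi> x \<noteq> 0 \<Longrightarrow> cball (F x) r \<subseteq> \<Omega>"
    and i: "i \<in> Basis"
  shows "(LINT x|lborel. mollify \<rho> u (F x) * frechet_derivative \<psi> (at x) i) =
    - (\<Sum>j\<in>Basis. LINT x|lborel. mollify \<rho> (g j) (F x) * ((directional_derivative i x \<bullet> j) * \<psi> x))"
proof -
  define v where "v = mollify \<rho> u"
  define w where "w j = mollify \<rho> (g j)" for j
  define D\<psi> where "D\<psi> x = frechet_derivative \<psi> (at x)" for x
  have \<psi>1: "Ck 1 \<psi>" and cpt: "compact (closure {x. \<psi> x \<noteq> 0})"
    using \<psi> by (auto simp: test_function_def Ck_all_orders)
  obtain B where B: "0 \<le> B" "\<And>x. \<bar>\<psi> x\<bar> \<le> B" "\<And>x i. i \<in> Basis \<Longrightarrow> \<bar>D\<psi> x i\<bar> \<le> B" "B-lipschitz_on UNIV \<psi>"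
    using Ck_compact_support_bounds[OF \<psi>1 cpt] unfolding D\<psi>_def by metis
  have der\<psi>: "(\<psi> has_derivative D\<psi> x) (at x)" for x
    using \<psi>1 by (auto simp: D\<psi>_def frechet_derivative_works)
  have [measurable]: "\<psi> \<in> borel_measurable borel" 
    using lipschitz_on_continuous_on[OF B(4)] by (rule borel_measurable_continuous_onI)
  have [measurable]: "(\<lambda>x. D\<psi> x i) \<in> borel_measurable borel"
    using \<psi>1 i by (intro borel_measurable_continuous_onI) (auto simp: D\<psi>_def)
  obtain R where R: "\<And>x. R \<le> norm x \<Longrightarrow> \<psi> x = 0"
  proof -
    obtain b where b: "\<And>x. x \<in> closure {x. \<psi> x \<noteq> 0} \<Longrightarrow> norm x \<le> b"
      using compact_imp_bounded[OF cpt] by (auto simp: bounded_iff)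
    have "\<psi> x = 0" if "b + 1 \<le> norm x" for x
      using b[of x] closure_subset[of "{x. \<psi> x \<noteq> 0}"] that by fastforce
    then show ?thesis using that by blast
  qed
  obtain C where C: "0 \<le> C" "C-lipschitz_on UNIV v" "\<And>y. \<bar>v y\<bar> \<le> C"
    using mollify_lipschitz_bounded[OF mol u] unfolding v_def by metis
  have iv: "integrable lborel v" unfolding v_def by (rule integrable_mollify[OF mol u])
  have iw: "integrable lborel (w j)" if "j \<in> Basis" for j
    unfolding w_def by (rule integrable_mollify[OF mol g[OF that]])
  have vF: "\<bar>v (F x) - v (F y)\<bar> \<le> C * L * dist x y" for x y
  proof -
    have "\<bar>v (F x) - v (F y)\<bar> \<le> C * dist (F x) (F y)"
      using lipschitz_onD[OF C(2), of "F x" "F y"] by (simp add: dist_real_def)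
    also have "\<dots> \<le> C * (L * dist x y)"
      using lipschitz_onD[OF lipschitz_F, of x y] C(1) by (intro mult_left_mono) auto
    finally show ?thesis by (simp add: mult.assoc)
  qed
  have lip: "(C * B + C * L * B)-lipschitz_on UNIV (\<lambda>x. v (F x) * \<psi> x)"
    unfolding lipschitz_on_def
  proof (intro conjI ballI)
    show "0 \<le> C * B + C * L * B" using C(1) B(1) L_pos by simp
    fix x y
    have "\<bar>v (F x) * \<psi> x - v (F y) * \<psi> y\<bar> = \<bar>v (F x) * (\<psi> x - \<psi> y) + (v (F x) - v (F y)) * \<psi> y\<bar>"
      by (simp add: algebra_simps)
    also have "\<dots> \<le> \<bar>v (F x)\<bar> * \<bar>\<psi> x - \<psi> y\<bar> + \<bar>v (F x) - v (F y)\<bar> * \<bar>\<psi> y\<bar>"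
      by (metis abs_mult abs_triangle_ineq)
    also have "\<dots> \<le> C * (B * dist x y) + (C * L * dist x y) * B"
      using lipschitz_onD[OF B(4), of x y] vF C B L_pos
      by (intro add_mono mult_mono) (auto simp: dist_real_def)
    finally show "dist (v (F x) * \<psi> x) (v (F y) * \<psi> y) \<le> (C * B + C * L * B) * dist x y"
      by (simp add: dist_real_def algebra_simps)
  qed
  define D where "D x = v (F x) * D\<psi> x i + (\<Sum>j\<in>Basis. w j (F x) * ((directional_derivative i x \<bullet> j) * \<psi> x))" for x
  have [measurable]: "v \<in> borel_measurable borel" "\<And>j. j \<in> Basis \<Longrightarrow> w j \<in> borel_measurable borel"
    using iv iw by auto
  have "(LINT x|lborel. D x) = 0"
  proof (rule integral_directional_derivative_eq_0[OF lip])
    show "v (F x) * \<psi> x = 0" if "R \<le> norm x" for x using R[OF that] by simp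
    show "D \<in> borel_measurable borel" unfolding D_def[abs_def] by measurable
    show "AE x in lborel. (\<lambda>n. real (Suc n) * (v (F (x + (1 / real (Suc n)) *\<^sub>R i)) * \<psi> (x + (1 / real (Suc n)) *\<^sub>R i)
        - v (F x) * \<psi> x)) \<longlonglongrightarrow> D x"
      using AE_differentiable_F
    proof eventually_elim
      case (elim x)
      define Dv where "Dv h = (\<Sum>j\<in>Basis. (h \<bullet> j) * (LINT z|lborel. u z * frechet_derivative \<rho> (at (F x - z)) j))" for h
      have "(v has_derivative Dv) (at (F x))"
        unfolding v_def Dv_def[abs_def] by (rule has_derivative_mollify[OF mol u])
      from has_derivative_compose[OF elim[unfolded frechet_derivative_works] this]
      have "((\<lambda>x. v (F x) * \<psi> x) has_derivative
          (\<lambda>h. v (F x) * D\<psi> x h + Dv (frechet_derivative F (at x) h) * \<psi> x)) (at x)"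
        by (rule has_derivative_mult[OF _ der\<psi>])
      from directional_derivative_LIMSEQ[OF this, of i]
      have lim: "(\<lambda>n. real (Suc n) * (v (F (x + (1 / real (Suc n)) *\<^sub>R i)) * \<psi> (x + (1 / real (Suc n)) *\<^sub>R i)
          - v (F x) * \<psi> x)) \<longlonglongrightarrow> v (F x) * D\<psi> x i + Dv (directional_derivative i x) * \<psi> x"
        by (simp only: real_scaleR_def directional_derivative_F(2)[OF elim])
      \<comment> \<open>Where \<open>\<psi>\<close> vanishes both sides are zero; elsewhere the ball of radius \<open>r\<close> about \<open>F x\<close> lies in \<open>\<Omega>\<close>, so
        that the gradient of \<open>v\<close> at \<open>F x\<close> is the mollified weak gradient.\<close>
      have "Dv (directional_derivative i x) * \<psi> x = (\<Sum>j\<in>Basis. w j (F x) * ((directional_derivative i x \<bullet> j) * \<psi> x))"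
      proof (cases "\<psi> x = 0")
        case False
        have "(LINT z|lborel. u z * frechet_derivative \<rho> (at (F x - z)) j) = w j (F x)" if "j \<in> Basis" for j
          unfolding w_def using mollify_weak_gradient[OF mol r[OF False] that, of u "g j"] weak that by blast
        then show ?thesis unfolding Dv_def by (simp add: sum_distrib_left sum_distrib_right ac_simps)
      qed simp
      then show ?case using lim by (simp only: D_def)
    qed
  qed
  moreover have "integrable lborel (\<lambda>x. v (F x) * D\<psi> x i)"
    using B(3)[OF i] by (intro integrable_mult_bounded[OF integrable_F[OF iv]]) auto
  moreover have "integrable lborel (\<lambda>x. w j (F x) * ((directional_derivative i x \<bullet> j) * \<psi> x))" if j: "j \<in> Basis" for j
    using integrable_pullback_directional_derivative[OF iw[OF j] i j B(2)] by simp
  ultimately have "(LINT x|lborel. v (F x) * D\<psi> x i)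
      + (\<Sum>j\<in>Basis. LINT x|lborel. w j (F x) * ((directional_derivative i x \<bullet> j) * \<psi> x)) = 0"
    unfolding D_def[abs_def]
    by (subst (asm) Bochner_Integration.integral_add)
      (auto simp: Bochner_Integration.integral_sum)
  then show ?thesis by (simp add: v_def w_def D\<psi>_def)
qed

text \<open>Let the mollification radius tend to zero, starting below the distance from the image of the
  support of \<open>\<psi>\<close> to the complement of \<open>\<Omega>\<close>.\<close>

lemma weak_gradient_pullback_integrable:
  fixes u :: "'a \<Rightarrow> real" and g :: "'a \<Rightarrow> 'a \<Rightarrow> real"
  assumes \<Omega>: "open \<Omega>" and u: "integrable lborel u"
    and g: "\<And>j. j \<in> Basis \<Longrightarrow> integrable lborel (g j)"
    and weak: "\<And>\<phi> j. test_function \<Omega> \<phi> \<Longrightarrow> j \<in> Basis \<Longrightarrow>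
      (LINT x|lborel. u x * frechet_derivative \<phi> (at x) j) = - (LINT x|lborel. g j x * \<phi> x)"
    and \<psi>: "test_function (F -` \<Omega>) \<psi>" and i: "i \<in> Basis"
  shows "(LINT x|lborel. u (F x) * frechet_derivative \<psi> (at x) i) =
    - (\<Sum>j\<in>Basis. LINT x|lborel. g j (F x) * ((directional_derivative i x \<bullet> j) * \<psi> x))"
proof -
  define K where "K = closure {x. \<psi> x \<noteq> 0}"
  have \<psi>1: "Ck 1 \<psi>" and K: "compact K" "K \<subseteq> F -` \<Omega>"
    using \<psi> by (auto simp: test_function_def Ck_all_orders K_def)
  have "compact (F ` K)" using K(1) continuous_F by (rule compact_continuous_image[rotated])
  then obtain \<delta> where \<delta>: "0 < \<delta>" "\<And>y. y \<in> F ` K \<Longrightarrow> cball y \<delta> \<subseteq> \<Omega>"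
    using compact_subset_open_imp_cball_epsilon_subset[of "F ` K" \<Omega>] \<Omega> K(2)
    by (metis UN_subset_iff image_subset_iff_subset_vimage)
  define r where "r n = \<delta> / real (Suc n)" for n
  have r: "0 < r n" "r n \<le> \<delta>" for n
    using \<delta>(1) by (simp_all add: r_def divide_le_eq mult_le_cancel_left1 del: of_nat_Suc)
  have r0: "r \<longlonglongrightarrow> 0"
    unfolding r_def[abs_def] using LIMSEQ_Suc[OF lim_const_over_n[of \<delta>]] by simp
  have "\<exists>\<rho> :: 'a \<Rightarrow> real. mollifier (r n) \<rho>" for n using mollifier_exists[OF r(1)] .
  then obtain \<rho> :: "nat \<Rightarrow> 'a \<Rightarrow> real" where \<rho>: "\<And>n. mollifier (r n) (\<rho> n)" by metis
  have sub: "cball (F x) (r n) \<subseteq> \<Omega>" if "\<psi> x \<noteq> 0" for x n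
  proof -
    have "x \<in> K" using that closure_subset[of "{x. \<psi> x \<noteq> 0}"] by (auto simp: K_def)
    then show ?thesis using \<delta>(2)[of "F x"] subset_cball[OF r(2)] by blast
  qed
  have eq: "(LINT x|lborel. mollify (\<rho> n) u (F x) * frechet_derivative \<psi> (at x) i) =
    - (\<Sum>j\<in>Basis. LINT x|lborel. mollify (\<rho> n) (g j) (F x) * ((directional_derivative i x \<bullet> j) * \<psi> x))" for n
    by (rule weak_gradient_pullback_mollified[OF \<rho> u g weak \<psi> sub i])
  obtain B where B: "0 \<le> B" "\<And>x. \<bar>\<psi> x\<bar> \<le> B" "\<And>x i. i \<in> Basis \<Longrightarrow> \<bar>frechet_derivative \<psi> (at x) i\<bar> \<le> B"
      "B-lipschitz_on UNIV \<psi>"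
    using Ck_compact_support_bounds[OF \<psi>1 K(1)[unfolded K_def]] by metis
  have [measurable]: "\<psi> \<in> borel_measurable borel" 
    using lipschitz_on_continuous_on[OF B(4)] by (rule borel_measurable_continuous_onI)
  have [measurable]: "(\<lambda>x. frechet_derivative \<psi> (at x) i) \<in> borel_measurable borel"
    using \<psi>1 i by (intro borel_measurable_continuous_onI) auto
  have "(\<lambda>n. LINT x|lborel. mollify (\<rho> n) u (F x) * frechet_derivative \<psi> (at x) i)
      \<longlonglongrightarrow> (LINT x|lborel. u (F x) * frechet_derivative \<psi> (at x) i)"
    using B i by (intro tendsto_integral_pullback[where B = B] integrable_mollify[OF \<rho>] mollify_tendsto_L1[OF _ \<rho> r0] u) auto
  moreover have "(\<lambda>n. - (\<Sum>j\<in>Basis. LINT x|lborel. mollify (\<rho> n) (g j) (F x) * ((directional_derivative i x \<bullet> j) * \<psi> x)))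
      \<longlonglongrightarrow> - (\<Sum>j\<in>Basis. LINT x|lborel. g j (F x) * ((directional_derivative i x \<bullet> j) * \<psi> x))"
  proof (intro tendsto_minus tendsto_sum)
    fix j :: 'a assume j: "j \<in> Basis"
    show "(\<lambda>n. LINT x|lborel. mollify (\<rho> n) (g j) (F x) * ((directional_derivative i x \<bullet> j) * \<psi> x))
      \<longlonglongrightarrow> (LINT x|lborel. g j (F x) * ((directional_derivative i x \<bullet> j) * \<psi> x))"
      using B L_pos AE_directional_derivative_mult_bounded[OF i j B(2)]
      by (intro tendsto_integral_pullback[where B = "L * B"] integrable_mollify[OF \<rho>]
          mollify_tendsto_L1[OF _ \<rho> r0] g j) auto
  qed
  ultimately show ?thesis unfolding eq by (rule LIMSEQ_unique)
qed

end

lemma Ck_measurable: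
  assumes "\<forall>k. Ck k f"
  shows "f \<in> borel_measurable borel"
    and "i \<in> Basis \<Longrightarrow> (\<lambda>x. frechet_derivative f (at x) i) \<in> borel_measurable borel"
proof -
  have "Ck 1 f" using assms by blast
  then show "i \<in> Basis \<Longrightarrow> (\<lambda>x. frechet_derivative f (at x) i) \<in> borel_measurable borel"
    by (intro borel_measurable_continuous_onI) auto
  show "f \<in> borel_measurable borel"
    using Ck_all_orders(3)[OF assms] by (rule borel_measurable_continuous_onI)
qed

text \<open>On a bounded set square integrable functions are integrable.  Passing to a Borel function on the
  whole space makes translation and Fubini for \<open>lborel\<close> applicable.\<close>

lemma L2_borel_representative:
  fixes h :: "'a::euclidean_space \<Rightarrow> real"
  assumes \<Omega>: "open \<Omega>" "bounded \<Omega>" and h: "h \<in> borel_measurable (lebesgue_on \<Omega>)"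
    and fin: "(\<integral>\<^sup>+x. ennreal ((h x)\<^sup>2) \<partial>lebesgue_on \<Omega>) < \<infinity>"
  obtains h0 where "integrable lborel h0" "AE x in lebesgue. indicator \<Omega> x * h x = h0 x"
proof -
  have \<Omega>': "\<Omega> \<in> sets lebesgue" "\<Omega> \<in> sets borel" using \<Omega>(1) by auto
  have "integrable (lebesgue_on \<Omega>) h"
  proof (rule integrableI_bounded[OF h])
    have "(\<integral>\<^sup>+x. ennreal (norm (h x)) \<partial>lebesgue_on \<Omega>) \<le> (\<integral>\<^sup>+x. 1 + ennreal ((h x)\<^sup>2) \<partial>lebesgue_on \<Omega>)"
    proof (rule nn_integral_mono)
      fix x
      have "\<bar>h x\<bar> \<le> 1 + (h x)\<^sup>2"
        using power2_abs[of "h x"] sum_power2_ge_zero[of "\<bar>h x\<bar> - 1" 0]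
        by (smt (verit) power2_diff mult_cancel_left1 power_one zero_power2 sum_squares_bound abs_ge_zero)
      then show "ennreal (norm (h x)) \<le> 1 + ennreal ((h x)\<^sup>2)"
        by (metis ennreal_1 ennreal_leI ennreal_plus real_norm_def zero_le_one zero_le_power2)
    qed
    also have "\<dots> = emeasure (lebesgue_on \<Omega>) \<Omega> + (\<integral>\<^sup>+x. ennreal ((h x)\<^sup>2) \<partial>lebesgue_on \<Omega>)"
      using h by (subst nn_integral_add) (auto simp: space_restrict_space)
    also have "\<dots> < \<infinity>"
      using fin \<Omega>' emeasure_bounded_finite[OF \<Omega>(2)] by (simp add: emeasure_restrict_space)
    finally show "(\<integral>\<^sup>+x. ennreal (norm (h x)) \<partial>lebesgue_on \<Omega>) < \<infinity>" .
  qed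
  then have int: "integrable lebesgue (\<lambda>x. indicator \<Omega> x * h x)"
    using \<Omega>' by (subst (asm) integrable_restrict_space) auto
  then obtain h0 where h0: "h0 \<in> borel_measurable lborel" "AE x in lborel. indicator \<Omega> x * h x = h0 x"
    using completion_ex_borel_measurable_real[of "\<lambda>x. indicator \<Omega> x * h x" lborel] by auto
  from h0(2) have ae: "AE x in lebesgue. indicator \<Omega> x * h x = h0 x" by (rule AE_completion)
  have "integrable lebesgue h0"
    by (rule integrable_cong_AE_imp[OF int]) (use h0(1) ae in \<open>auto simp: measurable_completion eq_commute\<close>)
  then have "integrable lborel h0" using h0(1) by (simp add: integrable_completion)
  then show thesis using that ae by blast
qed

lemma integral_representative:
  fixes h h0 \<phi> :: "'a::euclidean_space \<Rightarrow> real"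
  assumes \<Omega>: "\<Omega> \<in> sets lebesgue" and h: "h \<in> borel_measurable (lebesgue_on \<Omega>)"
    and ae: "AE x in lebesgue. indicator \<Omega> x * h x = h0 x"
    and h0: "h0 \<in> borel_measurable borel" and \<phi>: "\<phi> \<in> borel_measurable borel"
  shows "(LINT x|lebesgue_on \<Omega>. h x * \<phi> x) = (LINT x|lborel. h0 x * \<phi> x)"
proof -
  have [measurable]: "h0 \<in> borel_measurable lebesgue" "\<phi> \<in> borel_measurable lebesgue"
    using h0 \<phi> by (auto intro: measurable_completion)
  have [measurable]: "(\<lambda>x. indicator \<Omega> x * h x) \<in> borel_measurable lebesgue"
    using h \<Omega> borel_measurable_restrict_space_iff[of \<Omega> lebesgue h] by (simp add: mult.commute)
  have "(LINT x|lebesgue_on \<Omega>. h x * \<phi> x) = (LINT x|lebesgue. (indicator \<Omega> x * h x) * \<phi> x)"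
    using \<Omega> by (simp add: integral_restrict_space mult.assoc)
  also have "\<dots> = (LINT x|lebesgue. h0 x * \<phi> x)"
    by (rule integral_cong_AE) (use ae in auto)
  also have "\<dots> = (LINT x|lborel. h0 x * \<phi> x)"
    using h0 \<phi> by (simp add: integral_completion)
  finally show ?thesis .
qed

lemma L2_diff:
  fixes u v :: "'a \<Rightarrow> real"
  assumes "u \<in> L2 M" "v \<in> L2 M"
  shows "(\<lambda>x. u x - v x) \<in> L2 M"
proof -
  have [measurable]: "u \<in> borel_measurable M" "v \<in> borel_measurable M"
    using assms by (auto simp: L2_def)
  have "L2_sqnorm M (\<lambda>x. u x - v x) \<le> (\<integral>\<^sup>+x. ennreal 2 * ennreal ((norm (u x))\<^sup>2) + ennreal 2 * ennreal ((norm (v x))\<^sup>2) \<partial>M)"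
    unfolding L2_sqnorm_def
  proof (rule nn_integral_mono)
    fix x
    have "(u x - v x)\<^sup>2 \<le> 2 * (u x)\<^sup>2 + 2 * (v x)\<^sup>2"
      using zero_le_power2[of "u x + v x"] by (simp add: power2_eq_square algebra_simps)
    then have "ennreal ((u x - v x)\<^sup>2) \<le> ennreal (2 * (u x)\<^sup>2 + 2 * (v x)\<^sup>2)" by (rule ennreal_leI)
    then show "ennreal ((norm (u x - v x))\<^sup>2) \<le> ennreal 2 * ennreal ((norm (u x))\<^sup>2) + ennreal 2 * ennreal ((norm (v x))\<^sup>2)"
      by (simp only: real_norm_def power2_abs ennreal_mult' ennreal_plus zero_le_power2 zero_le_mult_iff zero_le_numeral simp_thms)
  qed
  also have "\<dots> = ennreal 2 * L2_sqnorm M u + ennreal 2 * L2_sqnorm M v"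
    unfolding L2_sqnorm_def
    by (subst nn_integral_add) (auto simp: nn_integral_cmult simp del: ennreal_numeral)
  also have "\<dots> < \<infinity>" using assms by (auto simp: L2_def ennreal_mult_less_top)
  finally show ?thesis by (simp add: L2_def)
qed

context bilipschitz_change
begin

lemma open_bounded_vimage:
  assumes "open \<Omega>" "bounded \<Omega>"
  shows "open (F -` \<Omega>)" "bounded (F -` \<Omega>)"
proof -
  show "open (F -` \<Omega>)" using assms(1) continuous_F[of UNIV] by (simp add: open_vimage)
  have "compact (G ` closure \<Omega>)"
    using assms(2) by (intro compact_continuous_image continuous_G) (simp add: compact_closure)
  moreover have "F -` \<Omega> \<subseteq> G ` closure \<Omega>" unfolding vimage_F by (intro image_mono closure_subset)
  ultimately show "bounded (F -` \<Omega>)" using bounded_subset compact_imp_bounded by blast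
qed

lemma L2_sqnorm_pullback_le:
  fixes f :: "'a \<Rightarrow> 'b::euclidean_space"
  assumes "\<Omega> \<in> sets lebesgue" "f \<in> borel_measurable (lebesgue_on \<Omega>)"
  shows "L2_sqnorm (lebesgue_on (F -` \<Omega>)) (\<lambda>x. f (F x)) \<le> ennreal (L ^ DIM('a)) * L2_sqnorm (lebesgue_on \<Omega>) f"
  unfolding L2_sqnorm_def
  by (rule nn_integral_lebesgue_pullback_le[where f = "\<lambda>x. ennreal ((norm (f x))\<^sup>2)"]) (use assms in auto)

lemma L2_pullback:
  fixes f :: "'a \<Rightarrow> 'b::euclidean_space"
  assumes \<Omega>: "\<Omega> \<in> sets lebesgue" and f: "f \<in> L2 (lebesgue_on \<Omega>)"
  shows "(\<lambda>x. f (F x)) \<in> L2 (lebesgue_on (F -` \<Omega>))"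
proof -
  have m: "f \<in> borel_measurable (lebesgue_on \<Omega>)" using f by (simp add: L2_def)
  note L2_sqnorm_pullback_le[OF \<Omega> m]
  also have "ennreal (L ^ DIM('a)) * L2_sqnorm (lebesgue_on \<Omega>) f < \<infinity>"
    using f by (simp add: L2_def ennreal_mult_less_top)
  finally show ?thesis using measurable_lebesgue_on_F[OF m] by (simp add: L2_def)
qed

text \<open>The transposed derivative of \<open>F\<close> at \<open>x\<close>, applied to \<open>g (F x)\<close>.\<close>

definition pullback_gradient :: "('a \<Rightarrow> 'a) \<Rightarrow> 'a \<Rightarrow> 'a" where
  "pullback_gradient g x = (\<Sum>i\<in>Basis. (g (F x) \<bullet> directional_derivative i x) *\<^sub>R i)"

lemma norm_pullback_gradient_le:
  assumes "F differentiable (at x)"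
  shows "norm (pullback_gradient g x) \<le> (real DIM('a) * L) * norm (g (F x))"
proof -
  have "norm (pullback_gradient g x) \<le> (\<Sum>i\<in>(Basis::'a set). norm ((g (F x) \<bullet> directional_derivative i x) *\<^sub>R i))"
    unfolding pullback_gradient_def by (rule norm_sum)
  also have "\<dots> \<le> (\<Sum>i\<in>(Basis::'a set). norm (g (F x)) * L)"
  proof (rule sum_mono)
    fix i :: 'a assume i: "i \<in> Basis"
    have "\<bar>g (F x) \<bullet> directional_derivative i x\<bar> \<le> norm (g (F x)) * norm (directional_derivative i x)" by (rule Cauchy_Schwarz_ineq2)
    also have "\<dots> \<le> norm (g (F x)) * L"
      using norm_directional_derivative_le[OF assms, of i] i by (intro mult_left_mono) auto
    finally show "norm ((g (F x) \<bullet> directional_derivative i x) *\<^sub>R i) \<le> norm (g (F x)) * L" using i by simp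
  qed
  finally show ?thesis by (simp add: mult.commute mult.left_commute)
qed

lemma measurable_borel_imp_lebesgue_on:
  "f \<in> borel_measurable borel \<Longrightarrow> f \<in> borel_measurable (lebesgue_on S)"
  by (intro measurable_restrict_space1 measurable_completion) simp

lemma measurable_pullback_gradient:
  assumes "g \<in> borel_measurable (lebesgue_on \<Omega>)"
  shows "pullback_gradient g \<in> borel_measurable (lebesgue_on (F -` \<Omega>))"
  unfolding pullback_gradient_def[abs_def]
  using measurable_lebesgue_on_F[OF assms] measurable_borel_imp_lebesgue_on[OF measurable_directional_derivative]
  by (intro borel_measurable_sum borel_measurable_scaleR borel_measurable_inner borel_measurable_const) auto

lemma L2_sqnorm_pullback_gradient_le:
  assumes \<Omega>: "\<Omega> \<in> sets lebesgue" and g: "g \<in> borel_measurable (lebesgue_on \<Omega>)"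
  shows "L2_sqnorm (lebesgue_on (F -` \<Omega>)) (pullback_gradient g)
    \<le> ennreal ((real DIM('a) * L)\<^sup>2 * L ^ DIM('a)) * L2_sqnorm (lebesgue_on \<Omega>) g"
proof -
  have \<Omega>': "F -` \<Omega> \<in> sets lebesgue" using sets_G_image[OF \<Omega>] by (simp add: vimage_F)
  have ae: "AE x in lebesgue_on (F -` \<Omega>). F differentiable (at x)"
    using AE_completion[OF AE_differentiable_F] \<Omega>' by (subst AE_restrict_space_iff) auto
  have "L2_sqnorm (lebesgue_on (F -` \<Omega>)) (pullback_gradient g)
      \<le> (\<integral>\<^sup>+x. ennreal ((real DIM('a) * L)\<^sup>2) * ennreal ((norm (g (F x)))\<^sup>2) \<partial>lebesgue_on (F -` \<Omega>))"
    unfolding L2_sqnorm_def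
  proof (rule nn_integral_mono_AE)
    show "AE x in lebesgue_on (F -` \<Omega>). ennreal ((norm (pullback_gradient g x))\<^sup>2)
        \<le> ennreal ((real DIM('a) * L)\<^sup>2) * ennreal ((norm (g (F x)))\<^sup>2)"
      using ae
    proof eventually_elim
      case (elim x)
      have "(norm (pullback_gradient g x))\<^sup>2 \<le> ((real DIM('a) * L) * norm (g (F x)))\<^sup>2"
        using norm_pullback_gradient_le[OF elim] by (rule power_mono) simp
      then show ?case by (simp add: power_mult_distrib ennreal_mult'[symmetric] ennreal_leI)
    qed
  qed
  also have "\<dots> = ennreal ((real DIM('a) * L)\<^sup>2) * L2_sqnorm (lebesgue_on (F -` \<Omega>)) (\<lambda>x. g (F x))"
    unfolding L2_sqnorm_def using measurable_lebesgue_on_F[OF g] by (intro nn_integral_cmult) auto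
  also have "\<dots> \<le> ennreal ((real DIM('a) * L)\<^sup>2) * (ennreal (L ^ DIM('a)) * L2_sqnorm (lebesgue_on \<Omega>) g)"
    by (intro mult_left_mono L2_sqnorm_pullback_le[OF \<Omega> g]) auto
  finally show ?thesis by (simp add: ennreal_mult'' mult.assoc L_pos less_imp_le)
qed

text \<open>This transfers the identity for integrable Borel functions to \<open>H\<^sup>1\<close> functions on \<open>\<Omega>\<close>, by
  extending \<open>u\<close> and the components of \<open>g\<close> by zero.\<close>

lemma has_weak_gradient_pullback:
  assumes \<Omega>: "open \<Omega>" "bounded \<Omega>" and u: "u \<in> L2 (lebesgue_on \<Omega>)" and g: "has_weak_gradient \<Omega> u g"
  shows "has_weak_gradient (F -` \<Omega>) (\<lambda>x. u (F x)) (pullback_gradient g)"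
proof -
  have S: "\<Omega> \<in> sets lebesgue" "F -` \<Omega> \<in> sets lebesgue"
    using \<Omega> open_bounded_vimage[OF \<Omega>] by auto
  have mu: "u \<in> borel_measurable (lebesgue_on \<Omega>)" and mg: "g \<in> borel_measurable (lebesgue_on \<Omega>)"
    and fg: "L2_sqnorm (lebesgue_on \<Omega>) g < \<infinity>" and fu: "L2_sqnorm (lebesgue_on \<Omega>) u < \<infinity>"
    using u g by (auto simp: L2_def has_weak_gradient_def)
  have mgj: "(\<lambda>x. g x \<bullet> j) \<in> borel_measurable (lebesgue_on \<Omega>)" for j using mg by auto
  obtain u0 where u0: "integrable lborel u0" "AE x in lebesgue. indicator \<Omega> x * u x = u0 x"
    using L2_borel_representative[OF \<Omega> mu] fu by (auto simp: L2_sqnorm_def)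
  have "\<exists>h0. integrable lborel h0 \<and> (AE x in lebesgue. indicator \<Omega> x * (g x \<bullet> j) = h0 x)" if j: "j \<in> Basis" for j
  proof -
    have "(\<integral>\<^sup>+x. ennreal ((g x \<bullet> j)\<^sup>2) \<partial>lebesgue_on \<Omega>) \<le> L2_sqnorm (lebesgue_on \<Omega>) g"
      unfolding L2_sqnorm_def
    proof (rule nn_integral_mono, rule ennreal_leI)
      fix x
      show "(g x \<bullet> j)\<^sup>2 \<le> (norm (g x))\<^sup>2"
        using power_mono[OF Basis_le_norm[OF j, of "g x"], of 2] by simp
    qed
    then have fin: "(\<integral>\<^sup>+x. ennreal ((g x \<bullet> j)\<^sup>2) \<partial>lebesgue_on \<Omega>) < \<infinity>"
      using fg by (rule order_le_less_trans)
    show ?thesis by (rule L2_borel_representative[OF \<Omega> mgj fin]) blast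
  qed
  then obtain g0 where g0: "\<And>j. j \<in> Basis \<Longrightarrow> integrable lborel (g0 j)"
    "\<And>j. j \<in> Basis \<Longrightarrow> AE x in lebesgue. indicator \<Omega> x * (g x \<bullet> j) = g0 j x" by metis
  have m0 [measurable]: "u0 \<in> borel_measurable borel" "\<And>j. j \<in> Basis \<Longrightarrow> g0 j \<in> borel_measurable borel"
    using u0 g0 by auto
  have weak: "(LINT x|lborel. u0 x * frechet_derivative \<phi> (at x) j) = - (LINT x|lborel. g0 j x * \<phi> x)"
    if \<phi>: "test_function \<Omega> \<phi>" and j: "j \<in> Basis" for \<phi> j
  proof -
    have "(LINT x|lborel. u0 x * frechet_derivative \<phi> (at x) j) =
        (LINT x|lebesgue_on \<Omega>. u x * frechet_derivative \<phi> (at x) j)"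
      using \<phi> j by (intro integral_representative[symmetric] S mu u0 m0 Ck_measurable) (auto simp: test_function_def)
    also have "\<dots> = - (LINT x|lebesgue_on \<Omega>. (g x \<bullet> j) * \<phi> x)"
      using g \<phi> j by (simp add: has_weak_gradient_def)
    also have "(LINT x|lebesgue_on \<Omega>. (g x \<bullet> j) * \<phi> x) = (LINT x|lborel. g0 j x * \<phi> x)"
      using \<phi> j by (intro integral_representative S mgj g0 m0 Ck_measurable) (auto simp: test_function_def)
    finally show ?thesis .
  qed
  have pull: "(LINT x|lebesgue_on (F -` \<Omega>). u (F x) * frechet_derivative \<psi> (at x) i) =
      - (LINT x|lebesgue_on (F -` \<Omega>). (pullback_gradient g x \<bullet> i) * \<psi> x)"
    if \<psi>: "test_function (F -` \<Omega>) \<psi>" and i: "i \<in> Basis" for \<psi> i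
  proof -
    have \<psi>k: "\<forall>k. Ck k \<psi>" and \<psi>c: "compact (closure {x. \<psi> x \<noteq> 0})" using \<psi> by (auto simp: test_function_def)
    note m\<psi> [measurable] = Ck_measurable[OF \<psi>k]
    obtain B where B: "\<And>x. \<bar>\<psi> x\<bar> \<le> B"
      using Ck_compact_support_bounds[OF Ck_all_orders(1)[OF \<psi>k] \<psi>c] by metis
    have comp: "pullback_gradient g x \<bullet> i = (\<Sum>j\<in>Basis. (g (F x) \<bullet> j) * (directional_derivative i x \<bullet> j))" for x
      using i unfolding pullback_gradient_def by (simp add: inner_sum_left_Basis euclidean_inner[symmetric])
    have "(LINT x|lebesgue_on (F -` \<Omega>). u (F x) * frechet_derivative \<psi> (at x) i) =
        (LINT x|lborel. u0 (F x) * frechet_derivative \<psi> (at x) i)"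
    proof (rule integral_representative[OF S(2) measurable_lebesgue_on_F[OF mu]])
      show "AE x in lebesgue. indicator (F -` \<Omega>) x * u (F x) = u0 (F x)"
        using AE_F[OF u0(2)] by (simp add: indicator_def)
    qed (use i in measurable)
    also have "\<dots> = - (\<Sum>j\<in>Basis. LINT x|lborel. g0 j (F x) * ((directional_derivative i x \<bullet> j) * \<psi> x))"
      by (rule weak_gradient_pullback_integrable[OF \<Omega>(1) u0(1) g0(1) weak \<psi> i])
    also have "(\<Sum>j\<in>Basis. LINT x|lborel. g0 j (F x) * ((directional_derivative i x \<bullet> j) * \<psi> x)) =
        (LINT x|lborel. (\<Sum>j\<in>Basis. g0 j (F x) * (directional_derivative i x \<bullet> j)) * \<psi> x)"
      using integrable_pullback_directional_derivative[OF g0(1) i _ B m\<psi>(1)]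
      by (subst Bochner_Integration.integral_sum[symmetric]) (auto simp: sum_distrib_right mult.assoc)
    also have "\<dots> = (LINT x|lebesgue_on (F -` \<Omega>). (pullback_gradient g x \<bullet> i) * \<psi> x)"
    proof (rule integral_representative[symmetric, OF S(2) _ _ _ m\<psi>(1)])
      show "(\<lambda>x. pullback_gradient g x \<bullet> i) \<in> borel_measurable (lebesgue_on (F -` \<Omega>))"
        using measurable_pullback_gradient[OF mg] by auto
      have "AE x in lebesgue. \<forall>j\<in>Basis. indicator \<Omega> (F x) * (g (F x) \<bullet> j) = g0 j (F x)"
        using AE_F[OF g0(2)] by (intro AE_finite_allI) auto
      then show "AE x in lebesgue. indicator (F -` \<Omega>) x * (pullback_gradient g x \<bullet> i)
          = (\<Sum>j\<in>Basis. g0 j (F x) * (directional_derivative i x \<bullet> j))"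
      proof eventually_elim
        case (elim x)
        have "indicator (F -` \<Omega>) x * (pullback_gradient g x \<bullet> i)
            = (\<Sum>j\<in>Basis. (indicator \<Omega> (F x) * (g (F x) \<bullet> j)) * (directional_derivative i x \<bullet> j))"
          unfolding comp by (simp add: sum_distrib_left mult.assoc indicator_def)
        then show ?case using elim by simp
      qed
    qed measurable
    finally show ?thesis .
  qed
  have "L2_sqnorm (lebesgue_on (F -` \<Omega>)) (pullback_gradient g) < \<infinity>"
    using L2_sqnorm_pullback_gradient_le[OF S(1) mg] fg
    by (auto simp: ennreal_mult_less_top intro: order_le_less_trans)
  then have "pullback_gradient g \<in> L2 (lebesgue_on (F -` \<Omega>))"
    using measurable_pullback_gradient[OF mg] by (simp add: L2_def)
  then show ?thesis using pull by (auto simp: has_weak_gradient_def)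
qed

end

section \<open>Energies, traces and eigenvalues under a change of variables\<close>

context bilipschitz_change
begin

definition energy_factor :: real where
  "energy_factor = (real DIM('a) * L)\<^sup>2 * L ^ DIM('a)"

lemma energy_factor_pos: "0 < energy_factor"
  using L_pos by (simp add: energy_factor_def)

lemma dirichlet_energy_pullback_le:
  assumes \<Omega>: "open \<Omega>" "bounded \<Omega>" and u: "u \<in> L2 (lebesgue_on \<Omega>)"
  shows "dirichlet_energy (F -` \<Omega>) (\<lambda>x. u (F x)) \<le> ennreal energy_factor * dirichlet_energy \<Omega> u"
  unfolding dirichlet_energy_def[of \<Omega>]
proof (rule le_cmult_INF_ennreal[OF energy_factor_pos])
  fix g assume "g \<in> {g. has_weak_gradient \<Omega> u g}"
  then have g: "has_weak_gradient \<Omega> u g" by simp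
  then have mg: "g \<in> borel_measurable (lebesgue_on \<Omega>)" by (simp add: has_weak_gradient_def L2_def)
  have "dirichlet_energy (F -` \<Omega>) (\<lambda>x. u (F x)) \<le> L2_sqnorm (lebesgue_on (F -` \<Omega>)) (pullback_gradient g)"
    unfolding dirichlet_energy_def using has_weak_gradient_pullback[OF \<Omega> u g] by (intro INF_lower) simp
  also have "\<dots> \<le> ennreal energy_factor * L2_sqnorm (lebesgue_on \<Omega>) g"
    unfolding energy_factor_def using \<Omega> by (intro L2_sqnorm_pullback_gradient_le mg) auto
  finally show "dirichlet_energy (F -` \<Omega>) (\<lambda>x. u (F x)) \<le> ennreal energy_factor * L2_sqnorm (lebesgue_on \<Omega>) g" .
qed

lemma H1_pullback:
  assumes \<Omega>: "open \<Omega>" "bounded \<Omega>" and u: "u \<in> H1 \<Omega>"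
  shows "(\<lambda>x. u (F x)) \<in> H1 (F -` \<Omega>)"
  using assms L2_pullback[of \<Omega> u] has_weak_gradient_pullback[OF \<Omega>, of u] by (auto simp: H1_def)

lemma H1_sqnorm_pullback_le:
  assumes \<Omega>: "open \<Omega>" "bounded \<Omega>" and u: "u \<in> L2 (lebesgue_on \<Omega>)"
  shows "H1_sqnorm (F -` \<Omega>) (\<lambda>x. u (F x)) \<le> ennreal (L ^ DIM('a) + energy_factor) * H1_sqnorm \<Omega> u"
proof -
  have "H1_sqnorm (F -` \<Omega>) (\<lambda>x. u (F x))
      \<le> ennreal (L ^ DIM('a)) * L2_sqnorm (lebesgue_on \<Omega>) u + ennreal energy_factor * dirichlet_energy \<Omega> u"
    unfolding H1_sqnorm_def
    using \<Omega> u by (intro add_mono L2_sqnorm_pullback_le dirichlet_energy_pullback_le) (auto simp: L2_def)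
  also have "\<dots> \<le> ennreal (L ^ DIM('a) + energy_factor) * L2_sqnorm (lebesgue_on \<Omega>) u
      + ennreal (L ^ DIM('a) + energy_factor) * dirichlet_energy \<Omega> u"
    using L_pos energy_factor_pos by (intro add_mono mult_right_mono ennreal_leI) (auto simp: less_imp_le)
  finally show ?thesis by (simp add: H1_sqnorm_def distrib_left)
qed

lemma L2_sqnorm_surface_pullback_le:
  fixes w :: "'a \<Rightarrow> real"
  assumes "w \<in> borel_measurable (surface_measure S)"
  shows "L2_sqnorm (surface_measure (F -` S)) (\<lambda>x. w (F x))
    \<le> ennreal (L ^ (DIM('a) - 1)) * L2_sqnorm (surface_measure S) w"
  unfolding L2_sqnorm_def
  by (rule nn_integral_surface_pullback_le[where f = "\<lambda>x. ennreal ((norm (w x))\<^sup>2)"]) (use assms in auto)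

end

lemma continuous_on_measurable_surface:
  fixes v :: "'a::euclidean_space \<Rightarrow> real"
  assumes "continuous_on (closure S) v"
  shows "v \<in> borel_measurable (surface_measure S)"
proof -
  have "v \<in> borel_measurable (restrict_space borel (frontier S))"
    using assms by (intro borel_measurable_continuous_on_restrict)
      (auto intro: continuous_on_subset simp: frontier_def)
  moreover have "sets (surface_measure S) = sets (restrict_space borel (frontier S))"
    unfolding surface_measure_def by (rule sets_restrict_space_cong) simp
  ultimately show ?thesis using measurable_cong_sets[OF _ refl] by metis
qed

context bilipschitz_change
begin

text \<open>The continuous functions that approximate \<open>u\<close> and its trace are composed with \<open>F\<close>; this keeps them
  continuous up to the boundary and both convergences intact.\<close>

lemma has_trace_pullback:
  assumes \<Omega>: "open \<Omega>" "bounded \<Omega>" and tr: "has_trace \<Omega> u w"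
  shows "has_trace (F -` \<Omega>) (\<lambda>x. u (F x)) (\<lambda>x. w (F x))"
proof -
  obtain v where v: "\<And>m. v m \<in> H1 \<Omega>" "\<And>m. continuous_on (closure \<Omega>) (v m)"
      "(\<lambda>m. H1_sqnorm \<Omega> (\<lambda>x. v m x - u x)) \<longlonglongrightarrow> 0"
      "(\<lambda>m. L2_sqnorm (surface_measure \<Omega>) (\<lambda>x. v m x - w x)) \<longlonglongrightarrow> 0"
    using tr by (auto simp: has_trace_def)
  have u: "u \<in> H1 \<Omega>" and w: "w \<in> L2 (surface_measure \<Omega>)" using tr by (auto simp: has_trace_def)
  have mw: "w \<in> borel_measurable (surface_measure \<Omega>)" using w by (simp add: L2_def)
  have squeeze: "a \<longlonglongrightarrow> 0" if "\<And>m. a m \<le> ennreal c * b m" "b \<longlonglongrightarrow> 0" for a b :: "nat \<Rightarrow> ennreal" and c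
  proof -
    have "(\<lambda>m. ennreal c * b m) \<longlonglongrightarrow> ennreal c * 0" by (rule ennreal_tendsto_cmult[OF _ that(2)]) simp
    then have "(\<lambda>m. ennreal c * b m) \<longlonglongrightarrow> 0" by simp
    then show ?thesis
      by (rule tendsto_sandwich[OF always_eventually always_eventually tendsto_const, rotated 2]) (use that(1) in auto)
  qed
  have "continuous_on (closure (F -` \<Omega>)) (\<lambda>x. v m (F x))" for m
    by (rule continuous_on_compose2[OF v(2) continuous_F]) (auto simp: closure_vimage)
  moreover have "(\<lambda>m. H1_sqnorm (F -` \<Omega>) (\<lambda>x. v m (F x) - u (F x))) \<longlonglongrightarrow> 0"
  proof (rule squeeze[OF _ v(3)])
    show "H1_sqnorm (F -` \<Omega>) (\<lambda>x. v m (F x) - u (F x)) \<le>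
        ennreal (L ^ DIM('a) + energy_factor) * H1_sqnorm \<Omega> (\<lambda>x. v m x - u x)" for m
      using H1_sqnorm_pullback_le[OF \<Omega> L2_diff[of "v m" "lebesgue_on \<Omega>" u]] v(1)[of m] u by (simp add: H1_def)
  qed
  moreover have "(\<lambda>m. L2_sqnorm (surface_measure (F -` \<Omega>)) (\<lambda>x. v m (F x) - w (F x))) \<longlonglongrightarrow> 0"
  proof (rule squeeze[OF _ v(4)])
    show "L2_sqnorm (surface_measure (F -` \<Omega>)) (\<lambda>x. v m (F x) - w (F x)) \<le>
        ennreal (L ^ (DIM('a) - 1)) * L2_sqnorm (surface_measure \<Omega>) (\<lambda>x. v m x - w x)" for m
      using continuous_on_measurable_surface[OF v(2)] mw
      by (intro L2_sqnorm_surface_pullback_le[where w = "\<lambda>x. v m x - w x"]) auto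
  qed
  moreover have "(\<lambda>x. w (F x)) \<in> L2 (surface_measure (F -` \<Omega>))"
  proof -
    note L2_sqnorm_surface_pullback_le[OF mw]
    also have "ennreal (L ^ (DIM('a) - 1)) * L2_sqnorm (surface_measure \<Omega>) w < \<infinity>"
      using w by (simp add: L2_def ennreal_mult_less_top)
    finally show ?thesis
      using measurable_compose[OF measurable_surface_measure_F mw] by (simp add: L2_def)
  qed
  ultimately show ?thesis
    unfolding has_trace_def using H1_pullback[OF \<Omega>] u v(1)
    by (intro conjI exI[of _ "\<lambda>m x. v m (F x)"]) auto
qed

lemma boundary_energy_pullback_le:
  assumes \<Omega>: "open \<Omega>" "bounded \<Omega>"
  shows "boundary_energy (F -` \<Omega>) (\<lambda>x. u (F x)) \<le> ennreal (L ^ (DIM('a) - 1)) * boundary_energy \<Omega> u"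
  unfolding boundary_energy_def[of \<Omega>]
proof (rule le_cmult_INF_ennreal)
  show "0 < L ^ (DIM('a) - 1)" using L_pos by simp
  fix w assume "w \<in> {w. has_trace \<Omega> u w}"
  then have w: "has_trace \<Omega> u w" by simp
  have "boundary_energy (F -` \<Omega>) (\<lambda>x. u (F x)) \<le> L2_sqnorm (surface_measure (F -` \<Omega>)) (\<lambda>x. w (F x))"
    unfolding boundary_energy_def using has_trace_pullback[OF \<Omega> w] by (intro INF_lower) simp
  also have "\<dots> \<le> ennreal (L ^ (DIM('a) - 1)) * L2_sqnorm (surface_measure \<Omega>) w"
    using w by (intro L2_sqnorm_surface_pullback_le) (simp add: has_trace_def L2_def)
  finally show "boundary_energy (F -` \<Omega>) (\<lambda>x. u (F x)) \<le> ennreal (L ^ (DIM('a) - 1)) * L2_sqnorm (surface_measure \<Omega>) w" .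
qed

text \<open>The opposite inequality comes from applying the previous one to the inverse change of variables.\<close>

lemma boundary_energy_le_pullback:
  assumes \<Omega>: "open \<Omega>" "bounded \<Omega>"
  shows "boundary_energy \<Omega> u \<le> ennreal (L ^ (DIM('a) - 1)) * boundary_energy (F -` \<Omega>) (\<lambda>x. u (F x))"
proof -
  interpret inv: bilipschitz_change L G F by (rule swap)
  have "G -` F -` \<Omega> = \<Omega>" by auto
  then show ?thesis
    using inv.boundary_energy_pullback_le[OF open_bounded_vimage[OF \<Omega>], of "\<lambda>x. u (F x)"] by simp
qed

lemma null_on_pullback:
  assumes \<Omega>: "open \<Omega>" and u: "null_on \<Omega> u"
  shows "null_on (F -` \<Omega>) (\<lambda>x. u (F x))"
proof -
  have S: "\<Omega> \<in> sets lebesgue" using \<Omega> by auto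
  have S': "F -` \<Omega> \<in> sets lebesgue" using sets_G_image[OF S] by (simp add: vimage_F)
  have "AE x in lebesgue. x \<in> \<Omega> \<longrightarrow> u x = 0"
    using u S by (subst (asm) null_on_def, subst (asm) AE_restrict_space_iff) auto
  from AE_F[OF this] show ?thesis
    using S' unfolding null_on_def by (subst AE_restrict_space_iff) auto
qed

definition rayleigh_factor :: real where
  "rayleigh_factor = energy_factor * L ^ (DIM('a) - 1)"

lemma rayleigh_factor_pos: "0 < rayleigh_factor"
  using energy_factor_pos L_pos by (simp add: rayleigh_factor_def)

end

text \<open>Bounding a quotient needs an upper bound for the numerator and a lower bound for the
  denominator.  The denominators may be infinite, which is why the cases are separated.\<close>

lemma ennreal_divide_comparison:
  fixes a a' b b' c c' :: ennreal
  assumes a: "a' \<le> c * a" and b: "b \<le> c' * b'" and b0: "b \<noteq> 0" and c': "c' \<noteq> \<infinity>"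
  shows "a' / b' \<le> (c * c') * (a / b)"
proof (cases "b' = \<infinity>")
  case True
  then show ?thesis by simp
next
  case False
  have b'0: "b' \<noteq> 0" using b b0 by auto
  have bf: "b \<noteq> \<infinity>" using b False c' by (auto simp: ennreal_mult_eq_top_iff top_unique)
  have "a' \<le> c * a" by (rule a)
  also have "\<dots> = c * a * (b / b)" using b0 bf by (simp add: ennreal_divide_self less_top)
  also have "\<dots> = c * (a / b) * b" by (simp add: ennreal_times_divide mult.assoc mult.commute)
  also have "\<dots> \<le> c * (a / b) * (c' * b')" by (intro mult_left_mono b) auto
  also have "\<dots> = (c * c' * (a / b)) * b'" by (simp only: ac_simps)
  finally show ?thesis using b'0 False
    by (intro divide_le_posI_ennreal) (auto simp: mult.commute zero_less_iff_neq_zero)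
qed

context bilipschitz_change
begin

lemma rayleigh_quotient_pullback_le:
  assumes \<Omega>: "open \<Omega>" "bounded \<Omega>" and u: "u \<in> H1 \<Omega>"
  shows "rayleigh_quotient (F -` \<Omega>) (\<lambda>x. u (F x)) \<le> ennreal rayleigh_factor * rayleigh_quotient \<Omega> u"
proof (cases "boundary_energy \<Omega> u = 0")
  case True
  then show ?thesis using rayleigh_factor_pos by (simp add: rayleigh_quotient_def ennreal_mult_top)
next
  case False
  note le = boundary_energy_le_pullback[OF \<Omega>, of u]
  have "boundary_energy (F -` \<Omega>) (\<lambda>x. u (F x)) \<noteq> 0" using le False by auto
  moreover have "ennreal rayleigh_factor = ennreal energy_factor * ennreal (L ^ (DIM('a) - 1))"
    using energy_factor_pos L_pos by (simp add: rayleigh_factor_def ennreal_mult)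
  ultimately show ?thesis
    using ennreal_divide_comparison[OF dirichlet_energy_pullback_le[OF \<Omega>] le False] u False
    by (simp add: rayleigh_quotient_def H1_def)
qed

text \<open>Composition with \<open>F\<close> maps competing subspaces to competing subspaces of the same dimension, and
  composition with the inverse shows that every function in the image subspace arises in this way.\<close>

lemma steklov_eigenvalue_vimage_le:
  assumes \<Omega>: "open \<Omega>" "bounded \<Omega>"
  shows "steklov_eigenvalue k (F -` \<Omega>) \<le> ennreal rayleigh_factor * steklov_eigenvalue k \<Omega>"
  unfolding steklov_eigenvalue_def[of k \<Omega>]
proof (rule le_cmult_INF_ennreal[OF rayleigh_factor_pos])
  interpret inv: bilipschitz_change L G F by (rule swap)
  have GF: "G -` F -` \<Omega> = \<Omega>" by auto
  note \<Omega>' = open_bounded_vimage[OF \<Omega>]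
  fix V assume "V \<in> {V. H1_subspace \<Omega> (k + 1) V}"
  then obtain b where b: "\<And>i. i < k + 1 \<Longrightarrow> b i \<in> H1 \<Omega>"
      "\<And>c :: nat \<Rightarrow> real. null_on \<Omega> (\<lambda>x. \<Sum>i<k+1. c i * b i x) \<Longrightarrow> \<forall>i<k+1. c i = 0"
      "V = {u \<in> H1 \<Omega>. \<exists>c :: nat \<Rightarrow> real. null_on \<Omega> (\<lambda>x. u x - (\<Sum>i<k+1. c i * b i x))}"
    by (auto simp: H1_subspace_def)
  define V' where "V' = {u \<in> H1 (F -` \<Omega>). \<exists>c :: nat \<Rightarrow> real.
      null_on (F -` \<Omega>) (\<lambda>x. u x - (\<Sum>i<k+1. c i * b i (F x)))}"
  have "H1_subspace (F -` \<Omega>) (k + 1) V'"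
    unfolding H1_subspace_def
  proof (rule exI[of _ "\<lambda>i x. b i (F x)"], intro conjI)
    show "\<forall>i<k + 1. (\<lambda>x. b i (F x)) \<in> H1 (F -` \<Omega>)" using b(1) H1_pullback[OF \<Omega>] by blast
    show "\<forall>c :: nat \<Rightarrow> real. null_on (F -` \<Omega>) (\<lambda>x. \<Sum>i<k + 1. c i * b i (F x)) \<longrightarrow> (\<forall>i<k + 1. c i = 0)"
    proof (intro allI impI)
      fix c :: "nat \<Rightarrow> real" and i assume *: "null_on (F -` \<Omega>) (\<lambda>x. \<Sum>i<k + 1. c i * b i (F x))" and i: "i < k + 1"
      have "null_on \<Omega> (\<lambda>x. \<Sum>i<k + 1. c i * b i x)"
        using inv.null_on_pullback[OF \<Omega>'(1) *] GF by simp
      then show "c i = 0" using b(2) i by blast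
    qed
  qed (simp add: V'_def)
  then have "steklov_eigenvalue k (F -` \<Omega>) \<le> (SUP u\<in>{u \<in> V'. \<not> null_on (F -` \<Omega>) u}. rayleigh_quotient (F -` \<Omega>) u)"
    unfolding steklov_eigenvalue_def by (intro INF_lower) simp
  also have "\<dots> \<le> ennreal rayleigh_factor * (SUP u\<in>{u \<in> V. \<not> null_on \<Omega> u}. rayleigh_quotient \<Omega> u)"
  proof (rule SUP_least)
    fix u' assume u': "u' \<in> {u \<in> V'. \<not> null_on (F -` \<Omega>) u}"
    define u where "u y = u' (G y)" for y
    have uF: "(\<lambda>x. u (F x)) = u'" by (simp add: u_def)
    have u: "u \<in> H1 \<Omega>"
      using inv.H1_pullback[OF \<Omega>', of u'] u' GF by (simp add: u_def[abs_def] V'_def)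
    obtain c :: "nat \<Rightarrow> real" where "null_on (F -` \<Omega>) (\<lambda>x. u' x - (\<Sum>i<k+1. c i * b i (F x)))"
      using u' by (auto simp: V'_def)
    from inv.null_on_pullback[OF \<Omega>'(1) this]
    have "null_on \<Omega> (\<lambda>y. u y - (\<Sum>i<k+1. c i * b i y))" using GF by (simp add: u_def)
    then have "u \<in> V" using u b(3) by blast
    moreover have "\<not> null_on \<Omega> u" using null_on_pullback[OF \<Omega>(1), of u] u' uF by auto
    ultimately have "rayleigh_quotient \<Omega> u \<le> (SUP u\<in>{u \<in> V. \<not> null_on \<Omega> u}. rayleigh_quotient \<Omega> u)"
      by (intro SUP_upper) simp
    then show "rayleigh_quotient (F -` \<Omega>) u' \<le> ennreal rayleigh_factor * (SUP u\<in>{u \<in> V. \<not> null_on \<Omega> u}. rayleigh_quotient \<Omega> u)"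
      using rayleigh_quotient_pullback_le[OF \<Omega> u] unfolding uF
      by (meson order_trans mult_left_mono zero_le)
  qed
  finally show "steklov_eigenvalue k (F -` \<Omega>) \<le>
      ennreal rayleigh_factor * (SUP u\<in>{u \<in> V. \<not> null_on \<Omega> u}. rayleigh_quotient \<Omega> u)" .
qed

end

definition steklov_dominated :: "'a::euclidean_space set \<Rightarrow> 'a set \<Rightarrow> bool" where
  "steklov_dominated S T \<longleftrightarrow>
     (\<exists>C>0. \<forall>k. steklov_eigenvalue k S \<le> ennreal C * steklov_eigenvalue k T)"

lemma steklov_dominated_trans:
  assumes "steklov_dominated R S" "steklov_dominated S T"
  shows "steklov_dominated R T"
proof -
  obtain C D where C: "0 < C" "\<And>k. steklov_eigenvalue k R \<le> ennreal C * steklov_eigenvalue k S"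
    and D: "0 < D" "\<And>k. steklov_eigenvalue k S \<le> ennreal D * steklov_eigenvalue k T"
    using assms unfolding steklov_dominated_def by metis
  have "steklov_eigenvalue k R \<le> ennreal (C * D) * steklov_eigenvalue k T" for k
  proof -
    have "steklov_eigenvalue k R \<le> ennreal C * (ennreal D * steklov_eigenvalue k T)"
      using order_trans[OF C(2) mult_left_mono[OF D(2)]] by simp
    then show ?thesis using C(1) D(1) by (simp add: ennreal_mult mult.assoc)
  qed
  then show ?thesis unfolding steklov_dominated_def using C(1) D(1) by (intro exI[of _ "C * D"]) auto
qed

lemma (in bilipschitz_change) steklov_dominated_image:
  assumes "open S" "bounded S"
  shows "steklov_dominated (F ` S) S" "steklov_dominated S (F ` S)"
proof -
  interpret inv: bilipschitz_change L G F by (rule swap)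
  have *: "F ` S = G -` S" by (simp add: inv.vimage_F)
  show "steklov_dominated (F ` S) S"
    unfolding steklov_dominated_def *
    using inv.steklov_eigenvalue_vimage_le[OF assms] inv.rayleigh_factor_pos by blast
  have "F -` G -` S = S" by auto
  then show "steklov_dominated S (F ` S)"
    unfolding steklov_dominated_def *
    using steklov_eigenvalue_vimage_le[OF inv.open_bounded_vimage[OF assms]] rayleigh_factor_pos by metis
qed

section \<open>The gauge of a convex domain\<close>

definition convex_gauge :: "'a::real_normed_vector set \<Rightarrow> 'a \<Rightarrow> real" where
  "convex_gauge S x = Inf {t. 0 < t \<and> (1 / t) *\<^sub>R x \<in> S}"

locale open_convex_around_0 =
  fixes S :: "'a::euclidean_space set" and r R :: real
  assumes convex: "convex S" and open_S: "open S"
    and r: "0 < r" "ball 0 r \<subseteq> S" and R: "0 < R" "S \<subseteq> ball 0 R"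
begin

abbreviation "g \<equiv> convex_gauge S"

lemma zero_mem: "0 \<in> S" using r by auto

lemma gauge_witness: "norm x / r < t \<Longrightarrow> 0 < t \<and> (1 / t) *\<^sub>R x \<in> S"
proof -
  assume t: "norm x / r < t"
  then have "0 < t" using r(1) by (metis divide_nonneg_pos less_le_trans norm_ge_zero not_le)
  moreover have "norm ((1 / t) *\<^sub>R x) < r"
    using t \<open>0 < t\<close> r(1) by (simp add: field_simps)
  ultimately show ?thesis using r(2) by auto
qed

lemma gauge_bdd: "bdd_below {t. 0 < t \<and> (1 / t) *\<^sub>R x \<in> S}"
  by (rule bdd_belowI[of _ 0]) auto

lemma gauge_nonempty: "{t. 0 < t \<and> (1 / t) *\<^sub>R x \<in> S} \<noteq> {}"
  using gauge_witness[of x "norm x / r + 1"] by auto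

text \<open>Convexity and \<open>0 \<in> S\<close> make the set of admissible \<open>t\<close> an up-set; openness of \<open>S\<close> makes it open, so
  the inequality is strict.\<close>

lemma gauge_less_iff:
  assumes t: "0 < t"
  shows "g x < t \<longleftrightarrow> (1 / t) *\<^sub>R x \<in> S"
proof
  assume "g x < t"
  then obtain s where s: "0 < s" "(1 / s) *\<^sub>R x \<in> S" "s < t"
    unfolding convex_gauge_def using cInf_lessD[OF gauge_nonempty] by blast
  have "(s / t) *\<^sub>R ((1 / s) *\<^sub>R x) + (1 - s / t) *\<^sub>R 0 \<in> S"
    using s t by (intro convexD[OF convex] zero_mem) auto
  then show "(1 / t) *\<^sub>R x \<in> S" using s(1) by simp
next
  assume x: "(1 / t) *\<^sub>R x \<in> S"
  have "((\<lambda>s. (1 / s) *\<^sub>R x) \<longlongrightarrow> (1 / t) *\<^sub>R x) (at_left t)"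
    using t by (intro tendsto_intros) auto
  then have "\<forall>\<^sub>F s in at_left t. (1 / s) *\<^sub>R x \<in> S"
    using open_S x by (rule topological_tendstoD)
  moreover have "\<forall>\<^sub>F s in at_left t. 0 < s \<and> s < t"
    using t by (auto simp: eventually_at_left_field intro!: exI[of _ 0])
  ultimately have "\<forall>\<^sub>F s in at_left t. 0 < s \<and> s < t \<and> (1 / s) *\<^sub>R x \<in> S"
    by eventually_elim auto
  then obtain s where "0 < s" "s < t" "(1 / s) *\<^sub>R x \<in> S"
    using eventually_happens'[OF trivial_limit_at_left_real] by blast
  then show "g x < t"
    unfolding convex_gauge_def using cInf_lower[OF _ gauge_bdd, of s x] by simp
qed

lemma gauge_nonneg: "0 \<le> g x"
  unfolding convex_gauge_def by (rule cInf_greatest[OF gauge_nonempty]) auto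

lemma mem_iff_gauge: "x \<in> S \<longleftrightarrow> g x < 1"
  using gauge_less_iff[of 1 x] by simp

lemma gauge_le: "g x \<le> norm x / r"
proof (rule dense_ge)
  fix t assume "norm x / r < t"
  then show "g x \<le> t" using gauge_witness[of x t] gauge_less_iff[of t x] by simp
qed

lemma gauge_ge: "norm x / R \<le> g x"
proof (rule dense_ge)
  fix t assume t: "g x < t"
  then have "0 < t" using gauge_nonneg[of x] by simp
  then have "(1 / t) *\<^sub>R x \<in> ball 0 R" using t gauge_less_iff[of t x] R(2) by auto
  then show "norm x / R \<le> t" using R(1) \<open>0 < t\<close> by (simp add: field_simps)
qed

lemma gauge_0 [simp]: "g 0 = 0" using gauge_le[of 0] gauge_nonneg[of 0] by simp

lemma gauge_pos: "x \<noteq> 0 \<Longrightarrow> 0 < g x"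
  using gauge_ge[of x] R(1) by (smt (verit) divide_pos_pos zero_less_norm_iff)

lemma gauge_scaleR:
  assumes c: "0 < c"
  shows "g (c *\<^sub>R x) = c * g x"
proof -
  have "g (c *\<^sub>R x) < t \<longleftrightarrow> c * g x < t" if "0 < t" for t
  proof -
    have "g (c *\<^sub>R x) < t \<longleftrightarrow> (1 / (t / c)) *\<^sub>R x \<in> S" using gauge_less_iff[OF that] by simp
    also have "\<dots> \<longleftrightarrow> g x < t / c" using gauge_less_iff[of "t / c" x] that c by simp
    finally show ?thesis using c by (simp add: field_simps)
  qed
  moreover have "0 \<le> g (c *\<^sub>R x)" "0 \<le> c * g x" using gauge_nonneg c by auto
  ultimately show ?thesis by (metis linorder_neqE_linordered_idom order_le_less_trans order_less_irrefl)
qed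

lemma gauge_triangle: "g (x + y) \<le> g x + g y"
proof (rule field_le_epsilon)
  fix e :: real assume e: "0 < e"
  define s where "s = g x + e / 2"
  define t where "t = g y + e / 2"
  have st: "0 < s" "0 < t" "g x < s" "g y < t"
    using e gauge_nonneg[of x] gauge_nonneg[of y] by (auto simp: s_def t_def)
  have "(s / (s + t)) *\<^sub>R ((1 / s) *\<^sub>R x) + (t / (s + t)) *\<^sub>R ((1 / t) *\<^sub>R y) \<in> S"
    using st gauge_less_iff[of s x] gauge_less_iff[of t y]
    by (intro convexD[OF convex]) (auto simp: add_divide_distrib[symmetric])
  then have "(1 / (s + t)) *\<^sub>R (x + y) \<in> S" using st by (simp add: scaleR_add_right)
  then show "g (x + y) \<le> g x + g y + e"
    using gauge_less_iff[of "s + t" "x + y"] st by (simp add: s_def t_def)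
qed

lemma gauge_lipschitz: "\<bar>g x - g y\<bar> \<le> (1 / r) * norm (x - y)"
proof -
  have "g x - g y \<le> (1 / r) * norm (x - y)" for x y
    using gauge_triangle[of "x - y" y] gauge_le[of "x - y"] by simp
  from this[of x y] this[of y x] show ?thesis by (simp add: abs_le_iff norm_minus_commute)
qed

lemma frontier_gauge: 
  assumes "g p = 1"
  shows "p \<in> frontier S"
proof -
  have "p \<notin> S" using assms mem_iff_gauge by simp
  moreover have "p \<in> closure S"
    unfolding closure_approachable
  proof (intro allI impI)
    fix e :: real assume e: "0 < e"
    define t where "t = max (1 / 2) (1 - e / (2 * (norm p + 1)))"
    have d: "0 < e / (2 * (norm p + 1))" using e by (simp add: add_nonneg_pos)
    have t: "0 < t" "t < 1" "1 - t \<le> e / (2 * (norm p + 1))" using d by (auto simp: t_def)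
    have "t *\<^sub>R p \<in> S" using gauge_scaleR[OF t(1), of p] assms t by (simp add: mem_iff_gauge)
    moreover have "dist (t *\<^sub>R p) p < e"
    proof -
      have "dist (t *\<^sub>R p) p = (1 - t) * norm p"
        using t norm_scaleR[of "t - 1" p] by (simp add: dist_norm scaleR_diff_left)
      also have "\<dots> \<le> e / (2 * (norm p + 1)) * norm p" using t by (intro mult_right_mono) auto
      also have "\<dots> \<le> e / (2 * (norm p + 1)) * (norm p + 1)" using d by (intro mult_left_mono) auto
      also have "\<dots> = e / 2" using nonzero_mult_divide_mult_cancel_right[of "norm p + 1" e 2] norm_ge_zero[of p]
        by (simp add: mult.commute del: norm_ge_zero)
      also have "\<dots> < e" using e by simp
      finally show ?thesis .
    qed
    ultimately show "\<exists>y\<in>S. dist y p < e" by blast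
  qed
  ultimately show ?thesis using open_S by (simp add: frontier_def interior_open)
qed

text \<open>A boundary point \<open>p\<close> is not in \<open>S\<close>, and is the limit of the points \<open>t p\<close> in \<open>S\<close> as \<open>t\<close> increases to \<open>1\<close>.\<close>

lemma defining_function_zero:
  assumes p: "g p = 1" and c: "continuous (at p) \<Phi>" and d: "0 < d"
    and \<Phi>: "\<And>x. x \<in> ball p d \<Longrightarrow> x \<in> S \<longleftrightarrow> 0 < \<Phi> x"
  shows "\<Phi> p = (0::real)"
proof (rule antisym)
  have "p \<notin> S" using p mem_iff_gauge by simp
  then show "\<Phi> p \<le> 0" using \<Phi>[of p] d by simp
  have lim: "((\<lambda>t. t *\<^sub>R p) \<longlongrightarrow> p) (at_left (1::real))"
  proof -
    have "((\<lambda>t. t *\<^sub>R p) \<longlongrightarrow> 1 *\<^sub>R p) (at_left (1::real))" by (intro tendsto_intros)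
    then show ?thesis by simp
  qed
  have "((\<lambda>t. \<Phi> (t *\<^sub>R p)) \<longlongrightarrow> \<Phi> p) (at_left (1::real))"
    by (rule isCont_tendsto_compose[OF c lim])
  moreover have "\<forall>\<^sub>F t in at_left (1::real). 0 \<le> \<Phi> (t *\<^sub>R p)"
  proof -
    have "\<forall>\<^sub>F t in at_left (1::real). t *\<^sub>R p \<in> ball p d"
      using topological_tendstoD[OF lim open_ball] d by auto
    moreover have "\<forall>\<^sub>F t in at_left (1::real). 0 < t \<and> t < 1"
      by (auto simp: eventually_at_left_field intro!: exI[of _ 0])
    ultimately show ?thesis
    proof eventually_elim
      case (elim t)
      then have "t *\<^sub>R p \<in> S" using gauge_scaleR[of t p] p by (simp add: mem_iff_gauge)
      then show ?case using \<Phi>[of "t *\<^sub>R p"] elim by simp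
    qed
  qed
  ultimately show "0 \<le> \<Phi> p"
    by (rule tendsto_lowerbound) (rule trivial_limit_at_left_real)
qed

text \<open>The gauge satisfies the implicit equation \<open>\<Phi> (x / g x) = 0\<close> near \<open>p\<close>.  As \<open>g\<close> is Lipschitz, the
  distance of \<open>x / g x\<close> from \<open>p\<close> is of the order of \<open>norm (x - p)\<close>, so expanding \<open>\<Phi>\<close> at \<open>p\<close> to first
  order gives \<open>\<Phi>' x = g x * \<Phi>' p\<close> up to a smaller error.  This determines \<open>g\<close> to first order once
  \<open>\<Phi>' p \<noteq> 0\<close>, which expresses that rays from the interior point \<open>0\<close> are not tangent to the boundary.\<close>

lemma gauge_has_derivative_frontier:
  assumes p: "g p = 1" and d: "0 < d" and c: "\<And>x. continuous (at x) \<Phi>"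
    and \<Phi>: "\<And>x. x \<in> ball p d \<Longrightarrow> x \<in> S \<longleftrightarrow> 0 < \<Phi> x"
    and der: "(\<Phi> has_derivative \<Phi>') (at p)" and e: "0 < \<Phi>' e"
  shows "(g has_derivative (\<lambda>h. \<Phi>' h / \<Phi>' p)) (at p)"
proof -
  interpret bounded_linear \<Phi>' using der by (rule has_derivative_bounded_linear)
  have zero: "\<Phi> y = 0" if y: "g y = 1" "y \<in> ball p d" for y
  proof -
    obtain d' where "d' > 0" "ball y d' \<subseteq> ball p d" using y(2) open_ball openE by blast
    then show ?thesis using \<Phi> by (intro defining_function_zero[OF y(1) c, of d']) auto
  qed
  have \<Phi>p: "\<Phi> p = 0" using zero[OF p] d by simp
  have inward: "0 \<le> \<Phi>' (y - p)" if y: "y \<in> S" for y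
  proof -
    have lim: "(\<lambda>n. real (Suc n) *\<^sub>R (\<Phi> (p + (1 / real (Suc n)) *\<^sub>R (y - p)) - \<Phi> p)) \<longlonglongrightarrow> \<Phi>' (y - p)"
      by (rule directional_derivative_LIMSEQ[OF der])
    have "(\<lambda>n. p + (1 / real (Suc n)) *\<^sub>R (y - p)) \<longlonglongrightarrow> p + 0 *\<^sub>R (y - p)"
      by (intro tendsto_intros LIMSEQ_inverse_real_of_nat[unfolded inverse_eq_divide])
    then have "\<forall>\<^sub>F n in sequentially. p + (1 / real (Suc n)) *\<^sub>R (y - p) \<in> ball p d"
      using d by (intro topological_tendstoD[OF _ open_ball]) auto
    then have "\<forall>\<^sub>F n in sequentially. 0 \<le> real (Suc n) *\<^sub>R (\<Phi> (p + (1 / real (Suc n)) *\<^sub>R (y - p)) - \<Phi> p)"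
    proof eventually_elim
      case (elim n)
      define t where "t = 1 / real (Suc n)"
      have t: "0 < t" "t \<le> 1" by (auto simp: t_def divide_le_eq)
      have "p + t *\<^sub>R (y - p) = t *\<^sub>R y + (1 - t) *\<^sub>R p" by (simp add: algebra_simps)
      moreover have "g (t *\<^sub>R y + (1 - t) *\<^sub>R p) < 1"
      proof (cases "t = 1")
        case True
        then show ?thesis using y by (simp add: mem_iff_gauge)
      next
        case False
        then have "g (t *\<^sub>R y + (1 - t) *\<^sub>R p) \<le> t * g y + (1 - t) * g p"
          using gauge_triangle[of "t *\<^sub>R y" "(1 - t) *\<^sub>R p"] t by (simp add: gauge_scaleR)
        also have "\<dots> < t * 1 + (1 - t) * 1"
          using y t(1) by (intro add_less_le_mono mult_strict_left_mono) (auto simp: p mem_iff_gauge)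
        finally show ?thesis by simp
      qed
      ultimately have "p + t *\<^sub>R (y - p) \<in> S" by (simp add: mem_iff_gauge)
      then show ?case using \<Phi> elim \<Phi>p unfolding t_def[symmetric] by (simp del: of_nat_Suc)
    qed
    then show ?thesis by (rule tendsto_lowerbound[OF lim]) simp
  qed
  define \<kappa> where "\<kappa> = \<Phi>' p"
  have "e \<noteq> 0" using e zero by auto
  \<comment> \<open>Every point of \<open>S\<close> lies on the inner side of the tangent hyperplane at \<open>p\<close>.  Apply this to a point of
    \<open>S\<close> slightly off the origin in the direction \<open>- e\<close>.\<close>
  have "\<kappa> < 0"
  proof -
    define \<epsilon> where "\<epsilon> = r / (2 * norm e)"
    have \<epsilon>: "0 < \<epsilon>" using r(1) \<open>e \<noteq> 0\<close> by (simp add: \<epsilon>_def)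
    have "norm ((- \<epsilon>) *\<^sub>R e) < r" using r(1) \<open>e \<noteq> 0\<close> by (simp add: \<epsilon>_def)
    then have "(- \<epsilon>) *\<^sub>R e \<in> S" using r(2) by auto
    from inward[OF this] have "\<kappa> \<le> - \<epsilon> * \<Phi>' e" by (simp add: \<kappa>_def diff neg scaleR)
    also have "\<dots> < 0" using \<epsilon> e by simp
    finally show ?thesis .
  qed
  \<comment> \<open>The factor \<open>2\<close> is for \<open>1 / g x\<close>, since \<open>g x \<ge> 1/2\<close> within distance \<open>r / 2\<close> of \<open>p\<close>; the second factor
    bounds the norm of \<open>(x - p) - (g x - 1) p\<close>, the numerator of \<open>x / g x - p\<close>, relative to \<open>norm (x - p)\<close>.\<close>
  define C where "C = 2 * (1 + norm p / r)"
  have C: "0 < C" using r(1) by (simp add: C_def add_pos_nonneg)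
  have half: "1/2 \<le> g x" "g x \<le> 2" "norm ((1 / g x) *\<^sub>R x - p) \<le> C * norm (x - p)"
    if x: "norm (x - p) \<le> r / 2" for x
  proof -
    have gx: "\<bar>g x - 1\<bar> \<le> norm (x - p) / r" using gauge_lipschitz[of x p] p by simp
    have "norm (x - p) / r \<le> 1/2" using x r(1) by (simp add: field_simps)
    with gx have "\<bar>g x - 1\<bar> \<le> 1/2" by linarith
    then show g2: "1/2 \<le> g x" "g x \<le> 2" by linarith+
    have "(1 / g x) *\<^sub>R x - p = (1 / g x) *\<^sub>R ((x - p) - (g x - 1) *\<^sub>R p)"
      using g2 by (simp add: algebra_simps)
    then have "norm ((1 / g x) *\<^sub>R x - p) = (1 / g x) * norm ((x - p) - (g x - 1) *\<^sub>R p)" using g2 by simp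
    also have "\<dots> \<le> 2 * (norm (x - p) + norm (x - p) / r * norm p)"
    proof (rule mult_mono)
      show "norm ((x - p) - (g x - 1) *\<^sub>R p) \<le> norm (x - p) + norm (x - p) / r * norm p"
        using norm_triangle_ineq4[of "x - p" "(g x - 1) *\<^sub>R p"] mult_right_mono[OF gx, of "norm p"] by simp
    qed (use g2 in \<open>auto simp: field_simps\<close>)
    also have "\<dots> = C * norm (x - p)" by (simp add: C_def algebra_simps)
    finally show "norm ((1 / g x) *\<^sub>R x - p) \<le> C * norm (x - p)" .
  qed
  show ?thesis
    unfolding has_derivative_at_alt
  proof (intro conjI allI impI)
    show "bounded_linear (\<lambda>h. \<Phi>' h / \<Phi>' p)" using bounded_linear_divide bounded_linear_axioms by (rule bounded_linear_compose)
    fix \<eta> :: real assume \<eta>: "0 < \<eta>"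
    define \<epsilon> where "\<epsilon> = \<eta> * \<bar>\<kappa>\<bar> / (2 * C)"
    have \<epsilon>: "0 < \<epsilon>" unfolding \<epsilon>_def using \<eta> C \<open>\<kappa> < 0\<close>
      by (intro divide_pos_pos mult_pos_pos) auto
    obtain \<delta> where \<delta>: "0 < \<delta>" "\<And>y. norm (y - p) < \<delta> \<Longrightarrow> \<bar>\<Phi> y - \<Phi> p - \<Phi>' (y - p)\<bar> \<le> \<epsilon> * norm (y - p)"
      using der \<epsilon> unfolding has_derivative_at_alt by auto
    define \<delta>' where "\<delta>' = min (r / 2) (min \<delta> d / (2 * C))"
    have "0 < \<delta>'" using \<delta>(1) d r(1) C by (simp add: \<delta>'_def)
    moreover have "norm (g x - g p - \<Phi>' (x - p) / \<Phi>' p) \<le> \<eta> * norm (x - p)" if x: "norm (x - p) < \<delta>'" for x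
    proof -
      have xr: "norm (x - p) \<le> r / 2" using x by (simp add: \<delta>'_def)
      note h = half[OF xr]
      define y where "y = (1 / g x) *\<^sub>R x"
      have "C * norm (x - p) < min \<delta> d"
      proof -
        have "C * norm (x - p) \<le> C * (min \<delta> d / (2 * C))" using x C by (intro mult_left_mono) (auto simp: \<delta>'_def)
        also have "\<dots> = min \<delta> d / 2" using C by simp
        also have "\<dots> < min \<delta> d" using \<delta>(1) d by (simp add: min_def)
        finally show ?thesis .
      qed
      then have y: "norm (y - p) < \<delta>" "y \<in> ball p d"
        using h(3) by (auto simp: y_def dist_norm norm_minus_commute)
      have "g y = 1" unfolding y_def using h by (simp add: gauge_scaleR)
      then have "\<Phi> y = 0" using zero y(2) by blast
      then have "\<bar>\<Phi>' (y - p)\<bar> \<le> \<epsilon> * norm (y - p)" using \<delta>(2)[OF y(1)] \<Phi>p by simp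
      also have "\<dots> \<le> \<epsilon> * (C * norm (x - p))" using h(3) \<epsilon> unfolding y_def by (intro mult_left_mono) auto
      finally have b: "\<bar>\<Phi>' (y - p)\<bar> \<le> \<epsilon> * (C * norm (x - p))" .
      have eq: "g x * \<Phi>' (y - p) = \<Phi>' (x - p) + \<kappa> - \<kappa> * g x"
        using h(1) by (simp add: y_def diff scaleR \<kappa>_def algebra_simps)
      have "g x - g p - \<Phi>' (x - p) / \<kappa> = - (g x * \<Phi>' (y - p)) / \<kappa>"
        unfolding eq using \<open>\<kappa> < 0\<close> p by (simp add: field_simps)
      then have "\<bar>g x - g p - \<Phi>' (x - p) / \<kappa>\<bar> = g x * \<bar>\<Phi>' (y - p)\<bar> / \<bar>\<kappa>\<bar>"
        using h(1) by (simp add: abs_mult)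
      also have "\<dots> \<le> 2 * (\<epsilon> * (C * norm (x - p))) / \<bar>\<kappa>\<bar>"
        using h b by (intro divide_right_mono mult_mono) auto
      also have "\<dots> = \<eta> * norm (x - p)" using C \<open>\<kappa> < 0\<close> by (simp add: \<epsilon>_def)
      finally show ?thesis by (simp add: \<kappa>_def)
    qed
    ultimately show "\<exists>d>0. \<forall>y. norm (y - p) < d \<longrightarrow> norm (g y - g p - \<Phi>' (y - p) / \<Phi>' p) \<le> \<eta> * norm (y - p)"
      by blast
  qed
qed

end

text \<open>With \<open>q x = h1 x / h2 x\<close>, write \<open>q x x - q y y = q x (x - y) + (q x - q y) y\<close> where \<open>y\<close> is the
  shorter of the two vectors.  Then \<open>norm y / h2 x \<le> 1 / c\<close>, which compensates for the unbounded
  Lipschitz constant of \<open>q\<close> near the origin.\<close>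

lemma radial_map_lipschitz:
  fixes h1 h2 :: "'a::real_normed_vector \<Rightarrow> real"
  assumes h1: "\<And>x y. \<bar>h1 x - h1 y\<bar> \<le> A * norm (x - y)" "h1 0 = 0" "\<And>x. 0 \<le> h1 x"
    and h2: "\<And>x y. \<bar>h2 x - h2 y\<bar> \<le> A * norm (x - y)" "\<And>x. c * norm x \<le> h2 x"
    and A: "0 \<le> A" and c: "0 < c"
  shows "(2 * (A / c) + (A / c) * (A / c))-lipschitz_on UNIV (\<lambda>x. (h1 x / h2 x) *\<^sub>R x)"
proof -
  define K where "K = 2 * (A / c) + (A / c) * (A / c)"
  define q where "q x = h1 x / h2 x" for x
  have K: "0 \<le> K" using A c by (simp add: K_def)
  have "0 \<le> A / c" "0 \<le> (A / c) * (A / c)" using A c by simp_all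
  then have AK: "A / c \<le> K" unfolding K_def by linarith
  have h1A: "h1 x \<le> A * norm x" for x using h1(1)[of x 0] h1(2) by simp
  have q: "0 \<le> q x" "q x \<le> A / c" for x
  proof -
    have pos: "0 \<le> h2 x" using h2(2)[of x] c by (meson mult_nonneg_nonneg norm_ge_zero order_trans less_imp_le)
    then show "0 \<le> q x" using h1(3) by (simp add: q_def)
    show "q x \<le> A / c"
    proof (cases "x = 0")
      case True
      then show ?thesis using h1(2) A c by (simp add: q_def)
    next
      case False
      then have "0 < c * norm x" using c by simp
      then have "h1 x / h2 x \<le> (A * norm x) / (c * norm x)"
        using h1A[of x] h2(2)[of x] A by (intro frac_le) auto
      then show ?thesis using False by (simp add: q_def)
    qed
  qed
  have main: "norm (q x *\<^sub>R x - q y *\<^sub>R y) \<le> K * norm (x - y)" if le: "norm y \<le> norm x" for x y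
  proof (cases "y = 0")
    case True
    have "norm (q x *\<^sub>R x) \<le> A / c * norm x"
      using mult_right_mono[OF q(2)[of x], of "norm x"] q(1)[of x] by simp
    also have "\<dots> \<le> K * norm x" using AK by (intro mult_right_mono) auto
    finally show ?thesis using True by simp
  next
    case False
    then have x: "0 < norm x" and y: "0 < norm y" using le by auto
    have hx: "0 < h2 x" and hy: "0 < h2 y"
      using h2(2)[of x] h2(2)[of y] x y c by (meson less_le_trans mult_pos_pos)+
    have yx: "norm y / h2 x \<le> 1 / c"
    proof -
      have "c * norm y \<le> h2 x" using order_trans[OF mult_left_mono[OF le] h2(2)] c by simp
      then show ?thesis using hx c by (simp add: field_simps)
    qed
    have "q x - q y = (h1 x - h1 y) / h2 x + q y * (h2 y - h2 x) / h2 x"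
      using hx hy by (simp add: q_def field_simps)
    then have "\<bar>q x - q y\<bar> \<le> \<bar>h1 x - h1 y\<bar> / h2 x + q y * \<bar>h2 y - h2 x\<bar> / h2 x"
      using abs_triangle_ineq[of "(h1 x - h1 y) / h2 x" "q y * (h2 y - h2 x) / h2 x"] hx q(1)[of y]
      by (simp add: abs_mult)
    also have "\<dots> \<le> (A * norm (x - y)) / h2 x + (A / c) * (A * norm (x - y)) / h2 x"
      using h1(1)[of x y] h2(1)[of y x] q[of y] hx A c
      by (intro add_mono divide_right_mono mult_mono) (auto simp: norm_minus_commute)
    finally have "\<bar>q x - q y\<bar> * norm y \<le> ((A * norm (x - y)) / h2 x + (A / c) * (A * norm (x - y)) / h2 x) * norm y"
      by (rule mult_right_mono) simp
    also have "\<dots> = ((A * norm (x - y)) + (A / c) * (A * norm (x - y))) * (norm y / h2 x)"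
      by (simp add: algebra_simps)
    also have "\<dots> \<le> ((A * norm (x - y)) + (A / c) * (A * norm (x - y))) * (1 / c)"
      using A c by (intro mult_left_mono yx) auto
    finally have 1: "\<bar>q x - q y\<bar> * norm y \<le> ((A * norm (x - y)) + (A / c) * (A * norm (x - y))) * (1 / c)" .
    have "q x *\<^sub>R x - q y *\<^sub>R y = q x *\<^sub>R (x - y) + (q x - q y) *\<^sub>R y" by (simp add: algebra_simps)
    then have "norm (q x *\<^sub>R x - q y *\<^sub>R y) \<le> q x * norm (x - y) + \<bar>q x - q y\<bar> * norm y"
      using norm_triangle_ineq[of "q x *\<^sub>R (x - y)" "(q x - q y) *\<^sub>R y"] q(1)[of x] by simp
    also have "\<dots> \<le> (A / c) * norm (x - y) + ((A * norm (x - y)) + (A / c) * (A * norm (x - y))) * (1 / c)"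
      using q(2)[of x] by (intro add_mono mult_right_mono 1) auto
    also have "\<dots> = K * norm (x - y)" using c by (simp add: K_def field_simps)
    finally show ?thesis .
  qed
  show ?thesis
    unfolding lipschitz_on_def K_def[symmetric] q_def[symmetric]
  proof (intro conjI K ballI)
    fix x y :: 'a
    show "dist (q x *\<^sub>R x) (q y *\<^sub>R y) \<le> K * dist x y"
      using main[of x y] main[of y x] by (cases "norm y \<le> norm x") (auto simp: dist_norm norm_minus_commute)
  qed
qed

section \<open>Mapping convex domains to the ball\<close>

text \<open>For the epigraph of \<open>\<gamma>\<close> in the direction \<open>e\<close>, height above the graph is a defining function; its
  derivative in the direction \<open>e\<close> is \<open>1\<close>.\<close>

lemma C1_boundary_local_defining_function:
  fixes \<Omega> :: "'a::euclidean_space set"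
  assumes "C1_boundary \<Omega>" "p \<in> frontier \<Omega>"
  obtains d \<Phi> \<Phi>' e where "0 < d" "\<And>x. continuous (at x) \<Phi>" "(\<Phi> has_derivative \<Phi>') (at p)" "0 < (\<Phi>' e :: real)"
    "\<And>x. x \<in> ball p d \<Longrightarrow> x \<in> \<Omega> \<longleftrightarrow> 0 < \<Phi> x"
proof -
  obtain d e \<gamma> where d: "0 < d" "norm e = 1" "Ck 1 \<gamma>"
    "\<Omega> \<inter> ball p d = {x \<in> ball p d. \<gamma> (x - (x \<bullet> e) *\<^sub>R e) < x \<bullet> e}"
    using bspec[OF assms(1)[unfolded C1_boundary_def] assms(2)] by (elim exE conjE) (rule that)
  define P where "P x = x - (x \<bullet> e) *\<^sub>R e" for x
  define \<Phi> where "\<Phi> x = x \<bullet> e - \<gamma> (P x)" for x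
  have \<gamma>: "(\<gamma> has_derivative frechet_derivative \<gamma> (at y)) (at y)" for y
    using d(3) by (simp add: frechet_derivative_works)
  have P: "(P has_derivative P) (at x)" for x
    unfolding P_def[abs_def] by (auto intro!: derivative_eq_intros)
  have der: "(\<Phi> has_derivative (\<lambda>h. h \<bullet> e - frechet_derivative \<gamma> (at (P x)) (P h))) (at x)" for x
    unfolding \<Phi>_def[abs_def]
    by (rule has_derivative_diff[OF _ has_derivative_compose[OF P \<gamma>]]) (auto intro!: derivative_eq_intros)
  show thesis
  proof
    show "0 < d" by (rule d)
    show "continuous (at x) \<Phi>" for x using der by (rule has_derivative_continuous)
    show "(\<Phi> has_derivative (\<lambda>h. h \<bullet> e - frechet_derivative \<gamma> (at (P p)) (P h))) (at p)" by (rule der)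
    have ee: "e \<bullet> e = 1" using d(2) by (simp only: norm_eq_1)
    then have "P e = 0" by (simp add: P_def)
    then show "0 < e \<bullet> e - frechet_derivative \<gamma> (at (P p)) (P e)"
      using linear_0[OF has_derivative_linear[OF \<gamma>], of "P p"] ee by simp
    show "x \<in> \<Omega> \<longleftrightarrow> 0 < \<Phi> x" if "x \<in> ball p d" for x
      using eqset_imp_iff[OF d(4), of x] that by (simp only: Int_iff mem_Collect_eq \<Phi>_def P_def) simp
  qed
qed

context open_convex_around_0
begin

text \<open>By homogeneity, differentiability at \<open>x\<close> follows from that at the boundary point \<open>x / g x\<close>.\<close>

lemma gauge_differentiable:
  assumes local_def: "\<And>p. p \<in> frontier S \<Longrightarrow> \<exists>d \<Phi> \<Phi>' e. 0 < d \<and> (\<forall>x. continuous (at x) \<Phi>) \<and>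
      (\<Phi> has_derivative \<Phi>') (at p) \<and> 0 < (\<Phi>' e :: real) \<and> (\<forall>x\<in>ball p d. x \<in> S \<longleftrightarrow> 0 < \<Phi> x)"
    and x: "x \<noteq> 0"
  shows "g differentiable (at x)"
proof -
  define c where "c = g x"
  have c: "0 < c" using gauge_pos[OF x] by (simp add: c_def)
  define p where "p = (1 / c) *\<^sub>R x"
  have p: "g p = 1" using gauge_scaleR[of "1 / c" x] c by (simp add: p_def c_def)
  obtain d \<Phi> \<Phi>' e where "0 < d" "\<And>x. continuous (at x) \<Phi>"
      "(\<Phi> has_derivative \<Phi>') (at p)" "0 < (\<Phi>' e :: real)" "\<And>x. x \<in> ball p d \<Longrightarrow> x \<in> S \<longleftrightarrow> 0 < \<Phi> x"
    using local_def[OF frontier_gauge[OF p]] by metis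
  then obtain g' where g': "(g has_derivative g') (at p)"
    using gauge_has_derivative_frontier[OF p] by metis
  have "((\<lambda>y. (1 / c) *\<^sub>R y) has_derivative (\<lambda>h. (1 / c) *\<^sub>R h)) (at x)"
    by (auto intro!: derivative_eq_intros)
  from has_derivative_compose[OF this g'[unfolded p_def]]
  have "((\<lambda>y. c * g ((1 / c) *\<^sub>R y)) has_derivative (\<lambda>h. c * g' ((1 / c) *\<^sub>R h))) (at x)"
    by (rule has_derivative_mult_right)
  moreover have "(\<lambda>y. c * g ((1 / c) *\<^sub>R y)) = g"
    using c by (simp add: gauge_scaleR fun_eq_iff)
  ultimately show ?thesis by (auto simp: differentiable_def)
qed

text \<open>The two maps are inverse to each other because both the norm and the gauge are positively
  homogeneous.\<close>

lemma bilipschitz_radial_map: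
  assumes diff: "\<And>x. x \<noteq> 0 \<Longrightarrow> g differentiable (at x)"
  shows "\<exists>L. bilipschitz_change L (\<lambda>x. (norm x / g x) *\<^sub>R x) (\<lambda>x. (g x / norm x) *\<^sub>R x)"
proof -
  define F where "F x = (norm x / g x) *\<^sub>R x" for x
  define G where "G x = (g x / norm x) *\<^sub>R x" for x
  define A where "A = max 1 (1 / r)"
  define c where "c = min 1 (1 / R)"
  have A: "0 \<le> A" and c: "0 < c" using r(1) R(1) by (auto simp: A_def c_def)
  define L where "L = 2 * (A / c) + (A / c) * (A / c)"
  have "0 < A / c" using c by (simp add: A_def)
  then have L: "0 < L" unfolding L_def by (intro add_pos_pos mult_pos_pos) auto
  have n: "\<bar>norm x - norm y\<bar> \<le> A * norm (x - y)" for x y :: 'a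
    using norm_triangle_ineq3[of x y] mult_right_mono[of 1 A "norm (x - y)"] by (simp add: A_def)
  have gl: "\<bar>g x - g y\<bar> \<le> A * norm (x - y)" for x y
    using gauge_lipschitz[of x y] mult_right_mono[of "1/r" A "norm (x - y)"] by (simp add: A_def)
  have cg: "c * norm x \<le> g x" for x
    using gauge_ge[of x] mult_right_mono[of c "1/R" "norm x"] by (simp add: c_def)
  have cn: "c * norm x \<le> norm x" for x :: 'a
    using mult_right_mono[of c 1 "norm x"] by (simp add: c_def)
  have "L-lipschitz_on UNIV F"
    unfolding F_def[abs_def] L_def by (rule radial_map_lipschitz) (use n gl cg A c in auto)
  moreover have "L-lipschitz_on UNIV G"
    unfolding G_def[abs_def] L_def by (rule radial_map_lipschitz) (use n gl cn A c gauge_nonneg in auto)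
  moreover have "F (G y) = y" for y
  proof (cases "y = 0")
    case False
    then have "0 < g y / norm y" using gauge_pos by simp
    then show ?thesis using False gauge_pos[OF False]
      by (simp add: F_def G_def gauge_scaleR abs_of_pos)
  qed (simp add: F_def G_def)
  moreover have "G (F y) = y" for y
  proof (cases "y = 0")
    case False
    then have "0 < norm y / g y" using gauge_pos by simp
    then show ?thesis using False gauge_pos[OF False]
      by (simp add: F_def G_def gauge_scaleR abs_of_pos)
  qed (simp add: F_def G_def)
  moreover have "F differentiable (at x)" "G differentiable (at x)" if "x \<noteq> 0" for x
    unfolding F_def[abs_def] G_def[abs_def]
    using that diff[OF that] gauge_pos[OF that]
    by (auto intro!: derivative_intros differentiable_norm_at)
  then have "{x. \<not> F differentiable (at x)} \<subseteq> {0}" "{x. \<not> G differentiable (at x)} \<subseteq> {0}" by auto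
  then have "negligible {x. \<not> F differentiable (at x)}" "negligible {x. \<not> G differentiable (at x)}"
    by (meson negligible_sing negligible_subset)+
  ultimately have "bilipschitz_change L F G" using L by unfold_locales
  then show ?thesis unfolding F_def[abs_def] G_def[abs_def] by blast
qed

lemma steklov_dominated_ball:
  assumes diff: "\<And>x. x \<noteq> 0 \<Longrightarrow> g differentiable (at x)"
  shows "steklov_dominated S (ball 0 1)" "steklov_dominated (ball 0 1) S"
proof -
  define F where "F x = (norm x / g x) *\<^sub>R x" for x
  define G where "G x = (g x / norm x) *\<^sub>R x" for x
  obtain L where "bilipschitz_change L F G"
    using bilipschitz_radial_map[OF diff] unfolding F_def[abs_def] G_def[abs_def] by blast
  then interpret bilipschitz_change L F G .
  interpret inv: bilipschitz_change L G F by (rule swap)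
  have "norm (G y) = g y" for y
    using gauge_nonneg[of y] by (cases "y = 0") (auto simp: G_def)
  then have "F ` ball 0 1 = S"
    by (auto simp: inv.vimage_F[symmetric] mem_iff_gauge)
  then show "steklov_dominated S (ball 0 1)" "steklov_dominated (ball 0 1) S"
    using steklov_dominated_image[of "ball 0 1"] by auto
qed

end

lemma bilipschitz_affine:
  fixes A :: "'a::euclidean_space \<Rightarrow> 'a"
  assumes A: "linear A" "bij A"
  shows "\<exists>L G. bilipschitz_change L (\<lambda>x. A x + b) G"
proof -
  define B where "B = inv A"
  have AB: "A (B y) = y" "B (A x) = x" for x y
    using A(2) by (auto simp: B_def bij_is_surj surj_f_inv_f bij_is_inj)
  have B: "linear B"
  proof
    show "B (x + y) = B x + B y" for x y
      using AB(2)[of "B x + B y"] by (simp add: linear_add[OF A(1)] AB(1))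
    show "B (c *\<^sub>R x) = c *\<^sub>R B x" for c x
      using AB(2)[of "c *\<^sub>R B x"] by (simp add: linear_cmul[OF A(1)] AB(1))
  qed
  define L where "L = max 1 (max (onorm A) (onorm B))"
  have bl: "bounded_linear A" "bounded_linear B"
    using A(1) B by (simp_all add: linear_conv_bounded_linear)
  have "onorm A \<le> L" "onorm B \<le> L" by (auto simp: L_def)
  note oL = mult_right_mono[OF this(1) norm_ge_zero] mult_right_mono[OF this(2) norm_ge_zero]
  have lip: "norm (A x - A y) \<le> L * norm (x - y)" "norm (B x - B y) \<le> L * norm (x - y)" for x y
  proof -
    have "norm (A (x - y)) \<le> L * norm (x - y)"
      by (rule order_trans[OF onorm[OF bl(1)] oL(1)])
    then show "norm (A x - A y) \<le> L * norm (x - y)" using A(1) by (simp add: linear_diff)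
    have "norm (B (x - y)) \<le> L * norm (x - y)"
      by (rule order_trans[OF onorm[OF bl(2)] oL(2)])
    then show "norm (B x - B y) \<le> L * norm (x - y)" using B by (simp add: linear_diff)
  qed
  have dA: "(\<lambda>x. A x + b) differentiable (at x)" for x
    using bounded_linear_imp_differentiable[OF bl(1)] by simp
  have dB: "(\<lambda>y. B (y - b)) differentiable (at y)" for y
    using differentiable_compose[OF bounded_linear_imp_differentiable[OF bl(2)], of "\<lambda>y. y - b" y UNIV] by simp
  have "bilipschitz_change L (\<lambda>x. A x + b) (\<lambda>y. B (y - b))"
  proof
    show "0 < L" by (simp add: L_def)
    show "L-lipschitz_on UNIV (\<lambda>x. A x + b)"
      using lip(1) by (auto simp: lipschitz_on_def dist_norm L_def)
    show "L-lipschitz_on UNIV (\<lambda>y. B (y - b))"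
      using lip(2)[of "_ - b" "_ - b"] by (auto simp: lipschitz_on_def dist_norm L_def)
  qed (use dA dB AB in auto)
  then show ?thesis by blast
qed

lemma steklov_dominated_affine_image:
  assumes "nonsingular_affine \<phi>" "open S" "bounded S"
  shows "steklov_dominated (\<phi> ` S) S" "steklov_dominated S (\<phi> ` S)"
proof -
  obtain A b where A: "linear A" "bij A" "\<phi> = (\<lambda>x. A x + b)"
    using assms(1) by (auto simp: nonsingular_affine_def)
  then obtain L G where "bilipschitz_change L \<phi> G" using bilipschitz_affine by blast
  then interpret bilipschitz_change L \<phi> G .
  show "steklov_dominated (\<phi> ` S) S" "steklov_dominated S (\<phi> ` S)"
    using steklov_dominated_image[OF assms(2,3)] by auto
qed

lemma nonsingular_affine_translation: "nonsingular_affine (\<lambda>x. x + a)"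
  unfolding nonsingular_affine_def by (intro exI[of _ "\<lambda>x. x"] exI[of _ a]) (auto simp: linear_id[unfolded id_def] bij_id[unfolded id_def])

lemma convex_C1_steklov_dominated_ball:
  fixes \<Omega> :: "'a::euclidean_space set"
  assumes "domain \<Omega>" "bounded \<Omega>" "convex \<Omega>" "C1_boundary \<Omega>"
  shows "steklov_dominated \<Omega> (ball 0 1)" "steklov_dominated (ball 0 1) \<Omega>"
proof -
  have o: "open \<Omega>" using assms(1) by (simp add: domain_def)
  obtain a where "a \<in> \<Omega>" using assms(1) by (auto simp: domain_def)
  define S where "S = (\<lambda>x. x + (- a)) ` \<Omega>"
  have S: "x \<in> S \<longleftrightarrow> x + a \<in> \<Omega>" for x
    by (force simp: S_def image_iff)
  have \<Omega>S: "\<Omega> = (\<lambda>x. x + a) ` S" by (force simp: S_def image_image)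
  have oS: "open S" unfolding S_def using open_translation[OF o, of "-a"] by (simp add: add.commute)
  have bS: "bounded S" unfolding S_def using bounded_translation[OF assms(2), of "-a"] by (simp add: add.commute)
  have cS: "convex S" unfolding S_def using convex_translation[OF assms(3), of "-a"] by (simp add: add.commute)
  have "0 \<in> S" using \<open>a \<in> \<Omega>\<close> by (simp add: S)
  then obtain r where r: "0 < r" "ball 0 r \<subseteq> S" using oS openE by blast
  obtain R where R: "0 < R" "S \<subseteq> ball 0 R" using bS bounded_subset_ballD by blast
  interpret open_convex_around_0 S r R using cS oS r R by unfold_locales
  have "\<exists>d \<Phi> \<Phi>' e. 0 < d \<and> (\<forall>x. continuous (at x) \<Phi>) \<and>
      (\<Phi> has_derivative \<Phi>') (at p) \<and> 0 < (\<Phi>' e :: real) \<and> (\<forall>x\<in>ball p d. x \<in> S \<longleftrightarrow> 0 < \<Phi> x)"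
    if p: "p \<in> frontier S" for p
  proof -
    have "p + a \<in> frontier \<Omega>"
      using p unfolding \<Omega>S using frontier_translation[of a S] by (force simp: add.commute)
    then obtain d \<Phi> \<Phi>' e where *: "0 < d" "\<And>x. continuous (at x) \<Phi>" "(\<Phi> has_derivative \<Phi>') (at (p + a))"
        "0 < (\<Phi>' e :: real)" "\<And>x. x \<in> ball (p + a) d \<Longrightarrow> x \<in> \<Omega> \<longleftrightarrow> 0 < \<Phi> x"
      using C1_boundary_local_defining_function[OF assms(4)] by metis
    have t: "((\<lambda>x. x + a) has_derivative (\<lambda>h. h)) (at x)" for x :: 'a
      by (auto intro!: derivative_eq_intros)
    have "continuous (at x) (\<lambda>x. \<Phi> (x + a))" for x
      using isCont_o2[of x "\<lambda>x. x + a" \<Phi>] *(2) by simp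
    moreover have "((\<lambda>x. \<Phi> (x + a)) has_derivative \<Phi>') (at p)"
      using has_derivative_compose[OF t *(3)] by simp
    moreover have "x \<in> S \<longleftrightarrow> 0 < \<Phi> (x + a)" if "x \<in> ball p d" for x
      using *(5)[of "x + a"] that by (simp add: S dist_norm)
    ultimately show ?thesis using *(1,4) by blast
  qed
  then have "g differentiable (at x)" if "x \<noteq> 0" for x using gauge_differentiable that by blast
  note SB = steklov_dominated_ball[OF this]
  note tr = steklov_dominated_affine_image[OF nonsingular_affine_translation[of a] oS bS, folded \<Omega>S]
  show "steklov_dominated \<Omega> (ball 0 1)" by (rule steklov_dominated_trans[OF tr(1) SB(1)])
  show "steklov_dominated (ball 0 1) \<Omega>" by (rule steklov_dominated_trans[OF SB(2) tr(2)])
qed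

text \<open>The factor \<open>DIM('a)\<close> of the lower bound is absorbed by dividing the domination constant by it.\<close>

lemma two_sided_bounds_exist:
  fixes S T :: "'a::euclidean_space set"
  assumes ST: "steklov_dominated S T" and TS: "steklov_dominated T S"
  shows "\<exists>c1 c2 :: real. c1 > 0 \<and> c2 > 0 \<and>
    (\<forall>k\<ge>1. ennreal (1 / (c2 * real DIM('a))) * steklov_eigenvalue k T \<le> steklov_eigenvalue k S \<and>
       steklov_eigenvalue k S \<le> ennreal c1 * steklov_eigenvalue k T)"
proof -
  obtain C where C: "0 < C" "\<And>k. steklov_eigenvalue k S \<le> ennreal C * steklov_eigenvalue k T"
    using ST unfolding steklov_dominated_def by blast
  obtain D where D: "0 < D" "\<And>k. steklov_eigenvalue k T \<le> ennreal D * steklov_eigenvalue k S"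
    using TS unfolding steklov_dominated_def by blast
  have "ennreal (1 / (D / real DIM('a) * real DIM('a))) * steklov_eigenvalue k T \<le> steklov_eigenvalue k S" for k
  proof -
    have "ennreal (1 / (D / real DIM('a) * real DIM('a))) * steklov_eigenvalue k T
        \<le> ennreal (1 / D) * (ennreal D * steklov_eigenvalue k S)"
      using D by (intro mult_mono) auto
    also have "\<dots> = steklov_eigenvalue k S"
      using D(1) by (simp add: mult.assoc[symmetric] ennreal_mult'[symmetric])
    finally show ?thesis .
  qed
  then show ?thesis using C D(1) by (intro exI[of _ C] exI[of _ "D / real DIM('a)"]) auto
qed

theorem theorem1p2:
  assumes "DIM('a::euclidean_space) \<ge> 2"
  shows "(\<exists>(C1 :: 'a set \<Rightarrow> 'a set \<Rightarrow> real) (C2 :: 'a set \<Rightarrow> 'a set \<Rightarrow> real). \<forall>\<Omega> E.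
            domain \<Omega> \<and> bounded \<Omega> \<and> convex \<Omega> \<and> C1_boundary \<Omega> \<and> max_volume_ellipsoid E \<Omega> \<longrightarrow>
              C1 \<Omega> E > 0 \<and> C2 \<Omega> E > 0 \<and>
              (\<forall>k\<ge>1.
                 ennreal (1 / (C2 \<Omega> E * real DIM('a))) * steklov_eigenvalue k E
                   \<le> steklov_eigenvalue k \<Omega> \<and>
                 steklov_eigenvalue k \<Omega> \<le> ennreal (C1 \<Omega> E) * steklov_eigenvalue k E)) \<and>
         (\<exists>(c1 :: 'a set \<Rightarrow> 'a set \<Rightarrow> real) (c2 :: 'a set \<Rightarrow> 'a set \<Rightarrow> real). \<forall>\<Omega> E \<phi> \<Omega>' B.
            domain \<Omega> \<and> bounded \<Omega> \<and> convex \<Omega> \<and> C1_boundary \<Omega> \<and> max_volume_ellipsoid E \<Omega> \<and>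
            B = ball 0 1 \<and> nonsingular_affine \<phi> \<and> B = \<phi> -` E \<and> \<Omega>' = \<phi> -` \<Omega> \<longrightarrow>
              c1 \<Omega>' B > 0 \<and> c2 \<Omega>' B > 0 \<and>
              (\<forall>k\<ge>1.
                 ennreal (1 / (real DIM('a) * c2 \<Omega>' B)) * steklov_eigenvalue k B
                   \<le> steklov_eigenvalue k \<Omega>' \<and>
                 steklov_eigenvalue k \<Omega>' \<le> ennreal (c1 \<Omega>' B) * steklov_eigenvalue k B))"
proof -
  define bounds where "bounds S T c \<longleftrightarrow> fst c > 0 \<and> snd c > 0 \<and>
    (\<forall>k\<ge>1. ennreal (1 / (snd c * real DIM('a))) * steklov_eigenvalue k T \<le> steklov_eigenvalue k S \<and>
       steklov_eigenvalue k S \<le> ennreal (fst c) * steklov_eigenvalue k T)"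
    for S T :: "'a set" and c :: "real \<times> real"
  define const where "const S T = (SOME c. bounds S T c)" for S T
  have const: "bounds S T (const S T)" if "steklov_dominated S T" "steklov_dominated T S" for S T
  proof -
    have "\<exists>c. bounds S T c" using two_sided_bounds_exist[OF that] unfolding bounds_def by auto
    then show ?thesis unfolding const_def by (rule someI_ex)
  qed
  have part1: "bounds \<Omega> E (const \<Omega> E)"
    if \<Omega>: "domain \<Omega>" "bounded \<Omega>" "convex \<Omega>" "C1_boundary \<Omega>" and E: "max_volume_ellipsoid E \<Omega>" for \<Omega> E
  proof -
    obtain \<phi> where \<phi>: "nonsingular_affine \<phi>" "E = \<phi> ` ball 0 1"
      using E by (auto simp: max_volume_ellipsoid_def ellipsoid_def)
    note EB = steklov_dominated_affine_image[OF \<phi>(1) open_ball bounded_ball, of 0 1, folded \<phi>(2)]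
    note \<Omega>B = convex_C1_steklov_dominated_ball[OF \<Omega>]
    show ?thesis
      using steklov_dominated_trans[OF \<Omega>B(1) EB(2)] steklov_dominated_trans[OF EB(1) \<Omega>B(2)] by (rule const)
  qed
  have part2: "bounds (\<phi> -` \<Omega>) (ball 0 1) (const (\<phi> -` \<Omega>) (ball 0 1))"
    if \<Omega>: "domain \<Omega>" "bounded \<Omega>" "convex \<Omega>" "C1_boundary \<Omega>" and \<phi>: "nonsingular_affine \<phi>" for \<Omega> \<phi>
  proof -
    obtain A b where A: "linear A" "bij A" "\<phi> = (\<lambda>x. A x + b)"
      using \<phi> by (auto simp: nonsingular_affine_def)
    obtain L G where "bilipschitz_change L \<phi> G" using bilipschitz_affine[OF A(1,2)] A(3) by blast
    then interpret bilipschitz_change L \<phi> G .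
    have o: "open \<Omega>" using \<Omega>(1) by (simp add: domain_def)
    have "\<phi> ` (\<phi> -` \<Omega>) = \<Omega>" by (simp add: vimage_F image_image)
    then have tr: "steklov_dominated \<Omega> (\<phi> -` \<Omega>)" "steklov_dominated (\<phi> -` \<Omega>) \<Omega>"
      using steklov_dominated_image[OF open_bounded_vimage[OF o \<Omega>(2)]] by auto
    note \<Omega>B = convex_C1_steklov_dominated_ball[OF \<Omega>]
    show ?thesis
      using steklov_dominated_trans[OF tr(2) \<Omega>B(1)] steklov_dominated_trans[OF \<Omega>B(2) tr(1)] by (rule const)
  qed
  show ?thesis
    unfolding mult.commute[of "real DIM('a)"]
    by (rule conjI; rule exI[of _ "\<lambda>S T. fst (const S T)"]; rule exI[of _ "\<lambda>S T. snd (const S T)"])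
      (use part1 part2 in \<open>simp_all add: bounds_def\<close>)
qed

end
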